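(* Let $m\in\mathbb{N}_0$ and let $\eta,\tilde\eta$ be two positive functions in $W_2^{m+3}[0,1]$, each satisfying $\eta(1)=1$, $\eta^{(u)}(1)=0$ for $u=1,\dots,m+1$, $\eta^{(m+2)}(1)\neq0$ (and likewise for $\tilde\eta$), and suppose $a:=\int_0^1\sqrt{\eta(r)}\,dr>1$. Let $\varepsilon\in(0,1)$ be defined by $\int_\varepsilon^1\sqrt{\eta(r)}\,dr=\frac{a-1}{2}$. Suppose that $\tilde\eta(r)=\eta(r)$ for all $r\in[\varepsilon,1]$, and that the characteristic functions $d$ and $\tilde d$ (of $\eta$ and $\tilde\eta$ respectively) have the same zeros counted with multiplicity. Then $\tilde\eta=\eta$ on $[0,1]$. In other words, $\eta$ on $[0,1]$ is uniquely determined by its values on $[\varepsilon,1]$ together with all zeros of $d$ (real and non-real, including multiplicities).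
   Context: For a positive function $\eta$ on $[0,1]$ with $\eta(1)=1$, $\eta'(1)=0$: let $y(r,k)$ be the solution of $y''+k^2\eta(r)y=0$ with $y(0,k)=0$, $y'(0,k)=1$, and define the characteristic function $d(k):=y'(1,k)\frac{\sin k}{k}-y(1,k)\cos k$, an entire function of $k$; $\tilde d$ is defined in the same way from $\tilde\eta$. The squares of the zeros of $d$ are the transmission eigenvalues of the problem $y''+k^2\eta y=0$, $0<r<1$, $y(0)=0=y'(1)\frac{\sin k}{k}-y(1)\cos k$. *)

theory Defs
  imports "HOL-Analysis.Analysis"
begin

text \<open>Sobolev space W_2^n[0,1] (n \<ge> 1), with the list D 0, ..., D (n-1) of the classical
  derivatives on [0,1]: D 0 = f on [0,1], D j has derivative D (j+1) on [0,1] for j < n-1,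
  and D (n-1) is absolutely continuous with derivative in L^2(0,1), i.e.
  D (n-1) x = D (n-1) 0 + integral of g over [0,x] with g square integrable.\<close>
definition W2_derivs :: "nat \<Rightarrow> (real \<Rightarrow> real) \<Rightarrow> (nat \<Rightarrow> real \<Rightarrow> real) \<Rightarrow> bool" where
  "W2_derivs n f D \<longleftrightarrow>
     (\<forall>x\<in>{0..1}. D 0 x = f x) \<and>
     (\<forall>j. Suc j < n \<longrightarrow> (\<forall>x\<in>{0..1}. (D j has_real_derivative D (Suc j) x) (at x within {0..1}))) \<and>
     (\<exists>g. g absolutely_integrable_on {0..1} \<and> (\<lambda>x. (g x)\<^sup>2) integrable_on {0..1} \<and>
          (\<forall>x\<in>{0..1}. D (n - 1) x = D (n - 1) 0 + integral {0..x} g))"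

definition in_W2 :: "nat \<Rightarrow> (real \<Rightarrow> real) \<Rightarrow> bool" where
  "in_W2 n f \<longleftrightarrow> (\<exists>D. W2_derivs n f D)"

text \<open>Standing assumptions on eta for a given m: positive on [0,1], in W_2^{m+3}[0,1],
  eta(1) = 1, eta^(u)(1) = 0 for u = 1..m+1, eta^(m+2)(1) \<noteq> 0.
  (The derivatives D u are uniquely determined on [0,1].)\<close>
definition admissible :: "nat \<Rightarrow> (real \<Rightarrow> real) \<Rightarrow> bool" where
  "admissible m eta \<longleftrightarrow>
     (\<forall>x\<in>{0..1}. eta x > 0) \<and>
     (\<exists>D. W2_derivs (m + 3) eta D \<and> D 0 1 = 1 \<and>
          (\<forall>u\<in>{1..m+1}. D u 1 = 0) \<and> D (m + 2) 1 \<noteq> 0)"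

definition is_sol :: "(real \<Rightarrow> real) \<Rightarrow> complex \<Rightarrow> (real \<Rightarrow> complex) \<Rightarrow> (real \<Rightarrow> complex) \<Rightarrow> bool" where
  "is_sol eta k Y Y' \<longleftrightarrow>
     Y 0 = 0 \<and> Y' 0 = 1 \<and>
     (\<forall>r\<in>{0..1}. (Y has_vector_derivative Y' r) (at r within {0..1}) \<and>
                 (Y' has_vector_derivative (- (k\<^sup>2 * complex_of_real (eta r) * Y r))) (at r within {0..1}))"

definition sinc :: "complex \<Rightarrow> complex" where
  "sinc k = (if k = 0 then 1 else sin k / k)"

definition char_fun :: "(real \<Rightarrow> real) \<Rightarrow> complex \<Rightarrow> complex" where
  "char_fun eta k = (THE v. \<exists>Y Y'. is_sol eta k Y Y' \<and> v = Y' 1 * sinc k - Y 1 * cos k)"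

text \<open>f and g have the same zeros counted with multiplicity: for every point z and every n,
  z is a zero of f of multiplicity at least n iff it is one of g.\<close>
definition same_zeros_mult :: "(complex \<Rightarrow> complex) \<Rightarrow> (complex \<Rightarrow> complex) \<Rightarrow> bool" where
  "same_zeros_mult f g \<longleftrightarrow>
     (\<forall>z n. (\<forall>j<n. (deriv ^^ j) f z = 0) \<longleftrightarrow> (\<forall>j<n. (deriv ^^ j) g z = 0))"

end

theory Submission
  imports Defs "HOL-Complex_Analysis.Complex_Analysis"
begin

text \<open>
  Let \<open>S\<close> be the solution with \<open>S(1) = sin k / k\<close>, \<open>S'(1) = cos k\<close>. The characteristic function is the
  Wronskian \<open>d = y' S - y S'\<close>, which may be evaluated at \<open>\<epsilon>\<close>. Being even, of exponential type and with equal
  zeros, \<open>d = c d~\<close> for a constant \<open>c\<close>, so \<open>F = (y - c y~) / S = (y' - c y~') / S'\<close>, taken at \<open>\<epsilon>\<close>, is entire.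
  It is bounded on the real axis by the conserved energy. On the imaginary axis the fixed sign of \<open>\<eta>'\<close>
  near \<open>1\<close> produces a reflected wave in \<open>S\<close>, and by the choice of \<open>\<epsilon>\<close> that wave has at \<open>\<epsilon>\<close> the same exponential
  rate as \<open>y\<close>; hence \<open>F\<close> has subexponential growth there and is constant by Phragmen-Lindelof. Comparing
  frequencies on the real axis gives \<open>F = 0\<close>, whence \<open>c = 1\<close>, \<open>y = y~\<close> and \<open>y' = y~'\<close> at \<open>\<epsilon>\<close>.

  It remains to recover \<open>\<eta>\<close> on \<open>[0, \<epsilon>]\<close>. For points \<open>r\<close>, \<open>\<rho>\<close> with equal travel times to \<open>\<epsilon>\<close> in the two media, an
  antisymmetric combination of the transfer matrices from \<open>\<epsilon>\<close> is an entire function of \<open>k\<close> that vanishes by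
  the same Phragmen-Lindelof argument (as in Bennewitz' proof of the Borg-Marchenko theorem). Its value at
  \<open>k = 0\<close> is \<open>\<rho> - r\<close>, so the travel times, and with them the media, coincide.
\<close>

section \<open>Entire functions of exponential type\<close>

text \<open>The obstacle is a lower bound for \<open>S\<close> at \<epsilon> on the imaginary axis.
  At \<open>k = \<i>\<tau>\<close> the data of \<open>S\<close> at 1 are two waves of sizes
  \<open>exp \<tau>\<close> and \<open>exp (- \<tau>)\<close>. Propagated inwards without
  reflection, both stay exponentially smaller at \<epsilon> than \<open>y\<close>. A reflected wave
  born next to 1 has size \<open>exp \<tau>\<close> up to a subexponential factor and gains the
  travel time (a-1)/2 on its way to \<epsilon>. The total rate (a+1)/2 is the travel time from 0 to
  \<epsilon>, that is, the rate of \<open>y\<close>. The strength of the reflection depends on the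
  order to which \<eta> is flat at 1. Its asymptotics can be bypassed because Phragmen-Lindelof
  tolerates a loss \<open>exp (\<sigma>\<tau>)\<close> for every \<sigma> > 0; the sign of \<eta>'
  next to 1, inherited from the non-zero derivative of order m+2, is enough. Accordingly the
  estimates on the imaginary axis use invariant cones and Gronwall inequalities, with constants that
  depend on the medium only. The condition a > 1 returns on the real axis, where a-1 is the
  frequency difference that forces \<open>F\<close> to vanish.\<close>

lemma borel_caratheodory:
  assumes hol: "f holomorphic_on ball 0 R" and A: "A > 0"
    and Re: "\<And>z. norm z < R \<Longrightarrow> Re (f z - f 0) < A" and z: "norm z < R"
  shows "norm (f z - f 0) \<le> 2 * A * norm z / (R - norm z)"
proof -
  have R: "R > 0" using z by (smt (verit) norm_ge_zero)
  define u where "u \<zeta> = f (of_real R * \<zeta>) - f 0" for \<zeta>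
  \<comment> \<open>The Moebius map sends the half-plane \<open>Re u < A\<close> into the unit disc
    and fixes 0, so the Schwarz lemma applies.\<close>
  define w where "w \<zeta> = u \<zeta> / (2 * of_real A - u \<zeta>)" for \<zeta>
  have inR: "norm (of_real R * \<zeta>) < R" if "norm \<zeta> < 1" for \<zeta> :: complex
    using that R by (simp add: norm_mult)
  have ReA: "Re (u \<zeta>) < A" if "norm \<zeta> < 1" for \<zeta>
    using Re[OF inR[OF that]] by (simp add: u_def)
  have nz: "2 * of_real A - u \<zeta> \<noteq> 0" if "norm \<zeta> < 1" for \<zeta>
    using ReA[OF that] A by (auto simp: complex_eq_iff)
  have lt: "norm (w \<zeta>) < 1" if "norm \<zeta> < 1" for \<zeta>
  proof -
    have "(norm (u \<zeta>))\<^sup>2 < (norm (2 * of_real A - u \<zeta>))\<^sup>2"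
      using ReA[OF that] A unfolding cmod_power2 by (simp add: power2_eq_square algebra_simps)
    then have "norm (u \<zeta>) < norm (2 * of_real A - u \<zeta>)" by (rule power2_less_imp_less) simp
    then show ?thesis unfolding w_def using nz[OF that] by (simp add: norm_divide)
  qed
  have "u holomorphic_on ball 0 1"
    unfolding u_def
    by (intro holomorphic_intros holomorphic_on_compose_gen[OF _ hol, unfolded o_def])
       (use inR in auto)
  then have holw: "w holomorphic_on ball 0 1"
    unfolding w_def by (intro holomorphic_intros) (use nz in auto)
  define \<zeta> where "\<zeta> = z / of_real R"
  have \<zeta>: "norm \<zeta> < 1" "norm \<zeta> = norm z / R" using z R by (auto simp: \<zeta>_def norm_divide)
  have le: "norm (w \<zeta>) \<le> norm \<zeta>"
    using Schwarz_Lemma(1)[OF holw _ lt \<zeta>(1)] by (simp add: w_def u_def)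
  have u: "u \<zeta> * (1 + w \<zeta>) = 2 * of_real A * w \<zeta>"
    using nz[OF \<zeta>(1)] by (simp add: w_def field_simps)
  have 1: "norm (1 + w \<zeta>) \<ge> 1 - norm \<zeta>"
    using norm_triangle_ineq4[of "1 + w \<zeta>" "w \<zeta>"] le by simp
  have "norm (u \<zeta>) * (1 - norm \<zeta>) \<le> norm (u \<zeta>) * norm (1 + w \<zeta>)"
    using 1 by (intro mult_left_mono) auto
  also have "\<dots> = 2 * A * norm (w \<zeta>)" using arg_cong[OF u, of norm] A by (simp add: norm_mult)
  also have "\<dots> \<le> 2 * A * norm \<zeta>" using le A by simp
  finally have "norm (u \<zeta>) \<le> 2 * A * norm \<zeta> / (1 - norm \<zeta>)" using \<zeta>(1) by (subst pos_le_divide_eq) auto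
  also have "\<dots> = 2 * A * norm z / (R - norm z)" using R z by (simp add: \<zeta>(2) field_simps)
  finally show ?thesis using R by (simp add: u_def \<zeta>_def)
qed

text \<open>On a zero-free ball \<open>g = exp L\<close>, and Borel-Caratheodory for
  \<open>L\<close> converts the upper bound of \<open>Re L\<close> into a lower one. The powers come
  from \<open>exp (2 * A)\<close> with \<open>A = ln (2 * M / norm (g 0))\<close>; the factor 2
  inside keeps \<open>A\<close> positive even if \<open>M = norm (g 0)\<close>.\<close>

lemma zero_free_lower_bound:
  assumes hol: "g holomorphic_on ball 0 R" and R: "R > 0"
    and nz: "\<And>z. norm z < R \<Longrightarrow> g z \<noteq> 0" and M: "\<And>z. norm z < R \<Longrightarrow> norm (g z) \<le> M"
    and z: "norm z \<le> R / 2"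
  shows "norm (g 0) ^ 3 \<le> 4 * M\<^sup>2 * norm (g z)"
proof -
  obtain L where L: "L holomorphic_on ball 0 R" "\<And>z. z \<in> ball 0 R \<Longrightarrow> g z = exp (L z)"
    using contractible_imp_holomorphic_log[OF hol] nz
    by (metis convex_ball convex_imp_contractible mem_ball_0)
  have g0: "norm (g 0) > 0" using nz[of 0] R by simp
  have M0: "M > 0" using g0 M[of 0] R by (metis less_le_trans norm_zero)
  have nL: "norm (g z) = exp (Re (L z))" if "norm z < R" for z
    using L(2)[of z] that by simp
  define A where "A = ln (2 * M / norm (g 0))"
  have A: "A > 0" unfolding A_def using g0 M0 M[of 0] R by (intro ln_gt_zero) (simp add: less_divide_eq)
  have Re: "Re (L z - L 0) < A" if "norm z < R" for z
  proof -
    have "exp (Re (L z - L 0)) = norm (g z) / norm (g 0)"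
      using nL[OF that] nL[of 0] R by (simp add: exp_diff)
    also have "\<dots> < 2 * M / norm (g 0)"
      using M[OF that] g0 M0 by (intro divide_strict_right_mono) auto
    also have "\<dots> = exp A" using g0 M0 by (simp add: A_def)
    finally show ?thesis by simp
  qed
  have zR: "norm z < R" using z R by simp
  have "norm (L z - L 0) \<le> 2 * A * norm z / (R - norm z)"
    by (rule borel_caratheodory[OF L(1) A Re zR])
  also have "\<dots> \<le> 2 * A"
  proof -
    have "2 * A * norm z \<le> 2 * A * (R - norm z)" using z A by (intro mult_left_mono) auto
    then show ?thesis using zR by (simp add: field_simps)
  qed
  finally have "Re (L 0 - L z) \<le> 2 * A"
    using complex_Re_le_cmod[of "L 0 - L z"] by (simp add: norm_minus_commute)
  then have "exp (Re (L 0 - L z)) \<le> exp (2 * A)" by simp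
  also have "exp (2 * A) = (2 * M / norm (g 0))\<^sup>2"
    using g0 M0 by (simp add: A_def exp_double power2_eq_square[symmetric])
  also have "exp (Re (L 0 - L z)) = norm (g 0) / norm (g z)"
    using nL[OF zR] nL[of 0] R by (simp add: exp_diff)
  finally show ?thesis using g0 nz[OF zR]
    by (simp add: field_simps power2_eq_square power3_eq_cube)
qed

text \<open>Zeros of the denominator are removed one at a time with a Blaschke factor; each removal at
  least doubles the value at the centre, which stays bounded by \<open>M\<close>, so the process stops.\<close>
lemma quotient_bound_ball:
  assumes "F holomorphic_on UNIV" "g holomorphic_on UNIV" "g 0 \<noteq> 0" "R > 0"
    and "\<And>z. norm z \<le> R \<Longrightarrow> norm (g z) \<le> M"
    and "\<And>z. norm z \<le> R \<Longrightarrow> norm (F z * g z) \<le> M"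
    and "M < 2 ^ n * norm (g 0)"
    and "norm z \<le> R / 4"
  shows "norm (F z) * norm (g 0) ^ 3 \<le> 4 * M ^ 3"
  using assms
proof (induction n arbitrary: g)
  case 0
  have "norm (g 0) \<le> M" using "0.prems"(4) by (intro "0.prems"(5)) simp
  with "0.prems"(7) show ?case by simp
next
  case (Suc n)
  show ?case
  proof (cases "\<exists>a. norm a < R / 2 \<and> g a = 0")
    \<comment> \<open>Zeros are removed only from the ball of radius \<open>R / 2\<close>; the
      zero-free estimate there reaches radius \<open>R / 4\<close>.\<close>
    case False
    have "norm (g 0) ^ 3 \<le> 4 * M\<^sup>2 * norm (g z)"
      using False Suc.prems \<open>R > 0\<close>
      by (intro zero_free_lower_bound[of g "R/2" M]) (auto intro: holomorphic_on_subset)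
    then have "norm (F z) * norm (g 0) ^ 3 \<le> norm (F z) * (4 * M\<^sup>2 * norm (g z))"
      by (intro mult_left_mono) auto
    also have "\<dots> = 4 * M\<^sup>2 * norm (F z * g z)" by (simp add: norm_mult)
    also have "\<dots> \<le> 4 * M\<^sup>2 * M"
      using Suc.prems by (intro mult_left_mono Suc.prems(6)) auto
    finally show ?thesis by (simp add: power2_eq_square power3_eq_cube)
  next
    case True
    then obtain a where a: "norm a < R / 2" "g a = 0" by blast
    define g2 where "g2 z = (if z = a then deriv g a else (g z - g a) / (z - a))" for z
    have g2: "g2 holomorphic_on UNIV"
      using pole_lemma[OF Suc.prems(2), of a] by (simp add: g2_def[abs_def])
    have gg2: "g z = (z - a) * g2 z" for z using a by (simp add: g2_def)
    \<comment> \<open>\<open>G\<close> is \<open>g\<close> divided by the Blaschke factor of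
      \<open>a\<close> for radius \<open>R\<close>. Passing through \<open>g2\<close> keeps it
      entire, and on the sphere its modulus equals that of \<open>g\<close>, so both bounds by
      \<open>M\<close> survive by the maximum principle.\<close>
    define G where "G z = g2 z * ((of_real R)\<^sup>2 - cnj a * z) / of_real R" for z
    have G: "G holomorphic_on UNIV" unfolding G_def using g2 \<open>R > 0\<close> by (intro holomorphic_intros) auto
    have sph: "norm ((of_real R)\<^sup>2 - cnj a * z) = R * norm (z - a)" if "norm z = R" for z
    proof -
      have "(of_real R)\<^sup>2 = z * cnj z" using complex_norm_square[of z] that by simp
      then have "(of_real R)\<^sup>2 - cnj a * z = z * cnj (z - a)" by (simp add: algebra_simps)
      then show ?thesis using that by (simp only: norm_mult complex_mod_cnj)
    qed
    have sphG: "norm (G z) = norm (g z)" if "norm z = R" for z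
      using sph[OF that] \<open>R > 0\<close> by (simp add: G_def gg2 norm_mult norm_divide)
    have max: "norm (f z) \<le> M" if "f holomorphic_on UNIV" "\<And>z. norm z = R \<Longrightarrow> norm (f z) \<le> M" "norm z \<le> R" for f z
      by (rule maximum_modulus_frontier[of f "cball 0 R"])
         (use that in \<open>auto intro: holomorphic_on_subset holomorphic_on_imp_continuous_on\<close>)
    have bG: "norm (G z) \<le> M" if "norm z \<le> R" for z
      using max[OF G] that sphG Suc.prems(5) by auto
    have bFG: "norm (F z * G z) \<le> M" if "norm z \<le> R" for z
    proof (rule max[of "\<lambda>z. F z * G z"])
      show "(\<lambda>z. F z * G z) holomorphic_on UNIV" using G Suc.prems(1) by (intro holomorphic_intros)
      show "norm (F z * G z) \<le> M" if "norm z = R" for z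
        using sphG[OF that] Suc.prems(6)[of z] that by (simp add: norm_mult)
    qed fact
    have dbl: "norm (G 0) \<ge> 2 * norm (g 0)"
    proof -
      have "norm (G 0) = norm (g2 0) * R" using \<open>R > 0\<close> by (simp add: G_def norm_mult norm_divide power2_eq_square)
      moreover have "norm (g 0) = norm a * norm (g2 0)" by (simp add: gg2 norm_mult)
      moreover have "norm (g2 0) * (2 * norm a) \<le> norm (g2 0) * R" using a by (intro mult_left_mono) auto
      ultimately show ?thesis by (simp add: algebra_simps)
    qed
    have "norm (F z) * norm (g 0) ^ 3 \<le> norm (F z) * norm (G 0) ^ 3"
      using dbl norm_ge_zero[of "g 0"] by (intro mult_left_mono power_mono) (linarith | simp)+
    also have "\<dots> \<le> 4 * M ^ 3"
    proof (rule Suc.IH)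
      show "M < 2 ^ n * cmod (G 0)"
      proof -
        have "M < 2 ^ n * (2 * norm (g 0))" using Suc.prems(7) by simp
        also have "\<dots> \<le> 2 ^ n * norm (G 0)" using dbl by (intro mult_left_mono) auto
        finally show ?thesis .
      qed
      show "G 0 \<noteq> 0" using dbl Suc.prems(3) by auto
    qed (use Suc.prems G bG bFG in auto)
    finally show ?thesis .
  qed
qed

text \<open>This takes the place of Hadamard factorisation. The ball estimate is applied with
  \<open>R\<close> proportional to \<open>norm z\<close>, which makes \<open>M\<close> exponential
  in \<open>norm z\<close>; the number of zeros removed does not enter the bound. The constant 15
  dominates \<open>3 * (1 + R)\<close>.\<close>

lemma quotient_exp_type_at_0:
  assumes F: "F holomorphic_on UNIV" and g: "g holomorphic_on UNIV" and g0: "g 0 \<noteq> 0"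
    and bg: "\<And>z. norm (g z) \<le> exp (K * (1 + norm z))"
    and bFg: "\<And>z. norm (F z * g z) \<le> exp (K * (1 + norm z))"
  shows "\<exists>K'. \<forall>z. norm (F z) \<le> exp (K' * (1 + norm z))"
proof -
  define K1 where "K1 = max K 0"
  have mono: "exp (K * (1 + norm w)) \<le> exp (K1 * (1 + R))" if "norm w \<le> R" for w :: complex and R
    using that by (auto simp: K1_def intro!: mult_mono)
  define B where "B = \<bar>ln (4 / norm (g 0) ^ 3)\<bar>"
  have "norm (F z) \<le> exp ((B + 15 * K1) * (1 + norm z))" for z
  proof -
    define R where "R = 4 * norm z + 1"
    define M where "M = exp (K1 * (1 + R))"
    obtain n where n: "M / norm (g 0) < 2 ^ n" using real_arch_pow[of 2] by auto
    have R: "R > 0" by (simp add: R_def add_nonneg_pos)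
    have "norm (F z) * norm (g 0) ^ 3 \<le> 4 * M ^ 3"
    proof (rule quotient_bound_ball[OF F g g0 R])
      show "norm (g w) \<le> M" if "norm w \<le> R" for w unfolding M_def using bg mono[OF that] order_trans by blast
      show "norm (F w * g w) \<le> M" if "norm w \<le> R" for w unfolding M_def using bFg mono[OF that] order_trans by blast
      show "M < 2 ^ n * norm (g 0)" using n g0 by (simp add: field_simps)
    qed (simp add: R_def)
    then have "norm (F z) \<le> 4 / norm (g 0) ^ 3 * M ^ 3" using g0 by (simp add: field_simps)
    also have "M ^ 3 = exp (3 * (K1 * (1 + R)))" by (simp add: M_def exp_of_nat_mult[symmetric])
    also have "4 / norm (g 0) ^ 3 = exp (ln (4 / norm (g 0) ^ 3))" using g0 by simp
    also have "exp (ln (4 / norm (g 0) ^ 3)) * exp (3 * (K1 * (1 + R))) = exp (ln (4 / norm (g 0) ^ 3) + 3 * (K1 * (1 + R)))"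
      by (simp add: exp_add)
    also have "\<dots> \<le> exp (B * (1 + norm z) + 15 * K1 * (1 + norm z))"
    proof -
      have "ln (4 / norm (g 0) ^ 3) \<le> B * 1" by (simp add: B_def)
      also have "\<dots> \<le> B * (1 + norm z)" by (intro mult_left_mono) (auto simp: B_def)
      finally have 1: "ln (4 / norm (g 0) ^ 3) \<le> B * (1 + norm z)" .
      have "K1 * (3 * (1 + R)) \<le> K1 * (15 * (1 + norm z))"
        by (intro mult_left_mono) (auto simp: R_def K1_def)
      with 1 show ?thesis by (simp add: algebra_simps)
    qed
    finally show ?thesis by (simp add: algebra_simps)
  qed
  then show ?thesis by blast
qed

lemma exp_type_shift:
  assumes "\<And>z. norm (f z :: complex) \<le> exp (K * (1 + norm z))"
  shows "norm (f (z + z0)) \<le> exp (\<bar>K\<bar> * (1 + norm z0) * (1 + norm (z :: complex)))"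
proof -
  have "norm (f (z + z0)) \<le> exp (K * (1 + norm (z + z0)))" by (rule assms)
  also have "\<dots> \<le> exp (\<bar>K\<bar> * ((1 + norm z0) * (1 + norm z)))"
  proof -
    have "K * (1 + norm (z + z0)) \<le> \<bar>K\<bar> * (1 + norm (z + z0))" by (intro mult_right_mono) auto
    also have "\<dots> \<le> \<bar>K\<bar> * ((1 + norm z0) * (1 + norm z))"
    proof (rule mult_left_mono)
      have "norm (z + z0) \<le> norm z + norm z0 + norm z * norm z0"
        using norm_triangle_ineq[of z z0] by (smt (verit) norm_ge_zero mult_nonneg_nonneg)
      then show "1 + norm (z + z0) \<le> (1 + norm z0) * (1 + norm z)" by (simp add: algebra_simps)
    qed simp
    finally show ?thesis by simp
  qed
  finally show ?thesis by (simp add: algebra_simps)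
qed

lemma quotient_exp_type:
  assumes F: "F holomorphic_on UNIV" and g: "g holomorphic_on UNIV" and g0: "g z0 \<noteq> 0"
    and bg: "\<And>z. norm (g z) \<le> exp (K * (1 + norm z))"
    and bFg: "\<And>z. norm (F z * g z) \<le> exp (K * (1 + norm z))"
  shows "\<exists>K'. \<forall>z. norm (F z) \<le> exp (K' * (1 + norm z))"
proof -
  have "\<exists>K'. \<forall>z. norm (F (z + z0)) \<le> exp (K' * (1 + norm z))"
  proof (rule quotient_exp_type_at_0)
    show "(\<lambda>z. F (z + z0)) holomorphic_on UNIV" "(\<lambda>z. g (z + z0)) holomorphic_on UNIV"
      using F g by (auto intro!: holomorphic_intros holomorphic_on_compose_gen[unfolded o_def, of _ _ F UNIV]
         holomorphic_on_compose_gen[unfolded o_def, of _ _ g UNIV])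
    show "norm (g (z + z0)) \<le> exp (\<bar>K\<bar> * (1 + norm z0) * (1 + norm z))" for z
      by (rule exp_type_shift[OF bg])
    show "norm (F (z + z0) * g (z + z0)) \<le> exp (\<bar>K\<bar> * (1 + norm z0) * (1 + norm z))" for z
      by (rule exp_type_shift[of "\<lambda>z. F z * g z", OF bFg])
  qed (use g0 in auto)
  then obtain K' where K': "\<And>z. norm (F (z + z0)) \<le> exp (K' * (1 + norm z))" by blast
  have "norm (F z) \<le> exp (\<bar>K'\<bar> * (1 + norm (- z0)) * (1 + norm z))" for z
    using exp_type_shift[of "\<lambda>z. F (z + z0)" K' z "- z0", OF K'] by simp
  then show ?thesis by blast
qed

text \<open>With \<open>h = exp L\<close>, exponential type bounds \<open>Re L\<close> linearly,
  Borel-Caratheodory on balls of twice the radius bounds \<open>L\<close> itself linearly, and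
  Liouville makes \<open>L\<close> affine. Evenness then removes the slope.\<close>

lemma even_zero_free_exp_type_constant:
  assumes h: "h holomorphic_on UNIV" and nz: "\<And>z. h z \<noteq> 0" and even: "\<And>z. h (- z) = h z"
    and bd: "\<And>z. norm (h z) \<le> exp (K * (1 + norm z))"
  shows "h z = h 0"
proof -
  obtain L where L: "L holomorphic_on UNIV" "\<And>z. h z = exp (L z)"
    using contractible_imp_holomorphic_log[OF h] nz by (metis UNIV_I contractible_UNIV)
  have K: "K \<ge> Re (L z) / (1 + norm z)" for z
  proof -
    have "exp (Re (L z)) \<le> exp (K * (1 + norm z))" using bd[of z] L(2)[of z] by simp
    then have "Re (L z) \<le> K * (1 + norm z)" by simp
    moreover have "1 + norm z > 0" by (simp add: add_pos_nonneg)
    ultimately show ?thesis by (simp add: field_simps)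
  qed
  define A where "A = \<bar>K\<bar> + \<bar>Re (L 0)\<bar> + 1"
  have lin: "norm (L z) \<le> (12 * A + norm (L 0)) * norm z ^ 1" if z: "1 \<le> norm z" for z
  proof -
    have R: "norm z < 2 * norm z" using z by auto
    have "norm (L z - L 0) \<le> 2 * (A * (1 + 2 * norm z)) * norm z / (2 * norm z - norm z)"
    proof (rule borel_caratheodory[OF _ _ _ R])
      show "L holomorphic_on ball 0 (2 * norm z)" using L(1) by (rule holomorphic_on_subset) auto
      show "0 < A * (1 + 2 * norm z)" by (intro mult_pos_pos) (auto simp: A_def add_pos_nonneg)
      fix w :: complex assume w: "norm w < 2 * norm z"
      have "1 + norm w > 0" by (simp add: add_pos_nonneg)
      then have "Re (L w) \<le> K * (1 + norm w)" using K[of w] by (simp add: field_simps)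
      also have "\<dots> \<le> \<bar>K\<bar> * (1 + 2 * norm z)" using w by (intro mult_mono) auto
      finally have "Re (L w - L 0) \<le> \<bar>K\<bar> * (1 + 2 * norm z) + \<bar>Re (L 0)\<bar> * 1" by simp
      also have "\<dots> < \<bar>K\<bar> * (1 + 2 * norm z) + (\<bar>Re (L 0)\<bar> + 1) * (1 + 2 * norm z)"
      proof -
        have "\<bar>Re (L 0)\<bar> * 1 < (\<bar>Re (L 0)\<bar> + 1) * 1" by simp
        also have "\<dots> \<le> (\<bar>Re (L 0)\<bar> + 1) * (1 + 2 * norm z)" by (intro mult_left_mono) auto
        finally show ?thesis by simp
      qed
      finally show "Re (L w - L 0) < A * (1 + 2 * norm z)" by (simp add: A_def algebra_simps)
    qed
    also have "\<dots> = 2 * A * (1 + 2 * norm z)"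
    proof -
      have "norm z \<noteq> 0" using z by linarith
      then show ?thesis by simp
    qed
    also have "\<dots> \<le> 2 * A * (3 * norm z)" using z by (intro mult_left_mono) (auto simp: A_def)
    finally have "norm (L z) \<le> 6 * A * norm z + norm (L 0)"
      using norm_triangle_ineq[of "L z - L 0" "L 0"] by simp
    also have "norm (L 0) \<le> norm (L 0) * norm z" using z mult_left_mono[of 1 "norm z" "norm (L 0)"] by simp
    also have "6 * A * norm z \<le> 12 * A * norm z" by (intro mult_right_mono) (auto simp: A_def)
    finally show ?thesis by (simp add: algebra_simps)
  qed
  have aff: "L z = L 0 + deriv L 0 * z" for z
    using Liouville_polynomial[OF L(1), of 1 "12 * A + norm (L 0)" 1 z] lin by simp
  define \<alpha> where "\<alpha> = deriv L 0"
  have e1: "exp (2 * \<alpha> * z) = 1" for z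
  proof -
    have "exp (L 0 + \<alpha> * z) = exp (L 0 + \<alpha> * (- z))"
      using even[of z] L(2)[of z] L(2)[of "-z"] aff[of z] aff[of "-z"] by (simp add: \<alpha>_def)
    then have "exp (L 0) * exp (\<alpha> * z) = exp (L 0) * exp (- (\<alpha> * z))" by (simp only: exp_add[symmetric] mult_minus_right)
    then have "exp (\<alpha> * z) = exp (- (\<alpha> * z))" by simp
    then have "exp (\<alpha> * z) * exp (\<alpha> * z) = 1" by (metis exp_minus_inverse)
    then show ?thesis by (simp add: exp_add[symmetric] mult.assoc)
  qed
  have "\<alpha> = 0"
  proof (rule ccontr)
    assume "\<alpha> \<noteq> 0"
    then have "exp 1 = (1 :: complex)" using e1[of "1 / (2 * \<alpha>)"] by simp
    then have "exp (1::real) = 1" by (metis exp_of_real of_real_1 of_real_eq_1_iff)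
    then show False by simp
  qed
  then show ?thesis using aff[of z] L(2) by (simp add: \<alpha>_def)
qed

section \<open>Phragmen-Lindelof principles\<close>

lemma Re_csqrt_cube_ge:
  assumes "0 < Re v" "\<bar>Im v\<bar> \<le> Re v"
  shows "Re (csqrt v ^ 3) \<ge> 3/10 * norm (csqrt v) ^ 3"
proof -
  define a b where "a = Re (csqrt v)" and "b = Im (csqrt v)"
  have a: "a \<ge> 0" using csqrt_principal[of v] by (auto simp: a_def)
  have v: "Re v = a\<^sup>2 - b\<^sup>2" "Im v = 2 * a * b"
    using arg_cong[OF power2_csqrt[of v], of Re] arg_cong[OF power2_csqrt[of v], of Im]
    by (simp_all only: a_def b_def Re_power2 Im_power2)
  \<comment> \<open>\<open>v\<close> lies in the sector of half-angle pi/4, so its root has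
    half-angle pi/8 and the cube 3 pi/8. The number 42/100 is just above tan (pi/8), and 3/10 leaves
    room below cos (3 pi/8).\<close>
  have b: "\<bar>b\<bar> \<le> 42/100 * a"
  proof (rule ccontr)
    assume "\<not> ?thesis"
    then have lt: "142/100 * a \<le> a + \<bar>b\<bar>" by simp
    have "(142/100 * a)\<^sup>2 \<le> (a + \<bar>b\<bar>)\<^sup>2" using lt a by (intro power_mono) auto
    also have "\<dots> = a\<^sup>2 + b\<^sup>2 + \<bar>2 * a * b\<bar>" using a by (simp add: power2_sum abs_mult)
    also have "\<dots> \<le> 2 * a\<^sup>2" using assms(2) v by simp
    finally have "a\<^sup>2 = 0" using zero_le_power2[of a] by (simp add: power_mult_distrib power_divide)
    then have "a = 0" by simp
    then show False using assms v by (smt (verit) zero_le_power2 power_zero_numeral)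
  qed
  have b2: "b\<^sup>2 \<le> (42/100)\<^sup>2 * a\<^sup>2"
    using power_mono[OF b, of 2] unfolding power_mult_distrib by simp
  have b2': "b\<^sup>2 \<le> 1764/10000 * a\<^sup>2" using b2 by (simp add: power2_eq_square)
  have "(norm (csqrt v))\<^sup>2 = a\<^sup>2 + b\<^sup>2" by (simp only: cmod_power2 a_def b_def)
  also have "\<dots> \<le> (11/10 * a)\<^sup>2" 
  proof -
    have "(11/10 * a)\<^sup>2 = 121/100 * a\<^sup>2" by (simp add: power2_eq_square)
    then show ?thesis using b2' zero_le_power2[of a] by linarith
  qed
  finally have "(norm (csqrt v))\<^sup>2 \<le> (11/10 * a)\<^sup>2" .
  then have "norm (csqrt v) \<le> 11/10 * a" by (rule power2_le_imp_le) (use a in auto)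
  then have "norm (csqrt v) ^ 3 \<le> (11/10 * a) ^ 3" by (intro power_mono) auto
  also have "\<dots> = 1331/1000 * (a * a\<^sup>2)" by (simp add: power3_eq_cube power2_eq_square)
  finally have 1: "3/10 * norm (csqrt v) ^ 3 \<le> 4/10 * (a * a\<^sup>2)"
    using mult_nonneg_nonneg[OF a zero_le_power2[of a]] by linarith
  have "a * (4/10 * a\<^sup>2) \<le> a * (a\<^sup>2 - 3 * b\<^sup>2)"
    using b2' zero_le_power2[of a] by (intro mult_left_mono a) linarith
  also have "\<dots> = Re (csqrt v ^ 3)"
    by (simp add: a_def b_def power3_eq_cube power2_eq_square algebra_simps)
  finally show ?thesis using 1 by simp
qed

lemma frontier_open_subset:
  assumes "open S" "closed T" "S \<subseteq> T" "z \<in> frontier S"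
  shows "z \<in> T" "z \<notin> S"
  using assms closure_minimal[of S T] by (auto simp: frontier_def interior_open)

lemma closed_halfplane_cball: "closed {z. Im z \<ge> 0 \<and> norm z \<le> \<rho>}"
  by (intro closed_Collect_conj closed_Collect_le continuous_intros)

lemma phragmen_lindelof_quadrant:
  assumes f: "f holomorphic_on UNIV" and K: "\<And>z. norm (f z) \<le> exp (K * (1 + norm z))"
    and B: "B > 0" and re: "\<And>x. x \<ge> 0 \<Longrightarrow> norm (f (of_real x)) \<le> B"
    and im: "\<And>x. x \<ge> 0 \<Longrightarrow> norm (f (\<i> * of_real x)) \<le> B"
    and z0: "Re z0 \<ge> 0" "Im z0 \<ge> 0"
  shows "norm (f z0) \<le> B"
proof -
  \<comment> \<open>A damping exponent of order 3/2: above the order 1 of \<open>f\<close>, below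
    the critical order 2 of a quadrant. The factor \<open>1 - \<i>\<close> turns the quadrant into
    the sector symmetric about the positive axis, and adding 1 keeps away from the branch
    point.\<close>
  define \<phi> where "\<phi> z = csqrt (1 + z * (1 - \<i>)) ^ 3" for z
  have \<phi>: "Re (\<phi> z) \<ge> 3/10 * (norm z * sqrt (norm z))" if "Re z \<ge> 0" "Im z \<ge> 0" for z
  proof -
    define v where "v = 1 + z * (1 - \<i>)"
    have v: "Re v = 1 + Re z + Im z" "Im v = Im z - Re z" by (auto simp: v_def algebra_simps)
    have "(norm z)\<^sup>2 \<le> (norm v)\<^sup>2" unfolding cmod_power2 v using that by (simp add: power2_eq_square algebra_simps)
    then have zv: "norm z \<le> norm v" by (rule power2_le_imp_le) simp
    have "norm z * sqrt (norm z) = sqrt (norm z) ^ 3" by (simp add: power3_eq_cube)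
    also have "\<dots> \<le> sqrt (norm v) ^ 3" using zv by (intro power_mono) auto
    also have "sqrt (norm v) = norm (csqrt v)" by simp
    finally have "3/10 * (norm z * sqrt (norm z)) \<le> 3/10 * norm (csqrt v) ^ 3" by simp
    also have "\<dots> \<le> Re (csqrt v ^ 3)" using v that by (intro Re_csqrt_cube_ge) auto
    finally show ?thesis by (simp add: \<phi>_def v_def)
  qed
  have hol\<phi>: "\<phi> holomorphic_on {z. Re z \<ge> 0 \<and> Im z \<ge> 0}"
    unfolding \<phi>_def by (intro holomorphic_intros) (auto simp: complex_nonpos_Reals_iff)
  have main: "norm (f z0) \<le> B * exp (\<zeta> * Re (\<phi> z0))" if \<zeta>: "\<zeta> > 0" for \<zeta>
  proof (cases "Re z0 = 0 \<or> Im z0 = 0")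
    case True
    then have "norm (f z0) \<le> B"
    proof
      assume "Re z0 = 0"
      then have "z0 = \<i> * of_real (Im z0)" by (simp add: complex_eq_iff)
      then show ?thesis using im[OF z0(2)] by simp
    next
      assume "Im z0 = 0"
      then have "z0 = of_real (Re z0)" by (simp add: complex_eq_iff)
      then show ?thesis using re[OF z0(1)] by simp
    qed
    also have "B * 1 \<le> B * exp (\<zeta> * Re (\<phi> z0))"
      using \<phi>[OF z0] \<zeta> B by (intro mult_left_mono) (auto intro!: mult_nonneg_nonneg order_trans[OF _ \<phi>[OF z0]])
    finally show ?thesis by simp
  next
    case False
    \<comment> \<open>For \<open>sqrt \<rho> \<ge> Q\<close> the damping
      \<open>3/10 * \<zeta> * \<rho> * sqrt \<rho>\<close> on the arc of radius \<rho> outweighs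
      both the type of \<open>f\<close> and \<open>ln B\<close>.\<close>
    define Q where "Q = (2 * \<bar>K\<bar> + \<bar>ln B\<bar>) / (3/10 * \<zeta>)"
    define \<rho> where "\<rho> = max 1 (max (norm z0 + 1) (Q\<^sup>2))"
    define S where "S = {z. Re z > 0 \<and> Im z > 0 \<and> norm z < \<rho>}"
    define T where "T = {z. Re z \<ge> 0 \<and> Im z \<ge> 0 \<and> norm z \<le> \<rho>}"
    have oS: "open S" unfolding S_def by (intro open_Collect_conj open_Collect_less continuous_intros)
    have cT: "closed T" unfolding T_def by (intro closed_Collect_conj closed_Collect_le continuous_intros)
    have ST: "S \<subseteq> T" by (auto simp: S_def T_def)
    have holT: "(\<lambda>z. f z * exp (- (of_real \<zeta> * \<phi> z))) holomorphic_on T"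
      using holomorphic_on_subset[OF f subset_UNIV] holomorphic_on_subset[OF hol\<phi>, of T]
      by (intro holomorphic_intros) (auto simp: T_def)
    have nrm: "norm (f z * exp (- (of_real \<zeta> * \<phi> z))) = norm (f z) * exp (- (\<zeta> * Re (\<phi> z)))" for z
      by (simp add: norm_mult)
    have "norm (f z0 * exp (- (of_real \<zeta> * \<phi> z0))) \<le> B"
    proof (rule maximum_modulus_frontier[of "\<lambda>z. f z * exp (- (of_real \<zeta> * \<phi> z))" S])
      show "(\<lambda>z. f z * exp (- (of_real \<zeta> * \<phi> z))) holomorphic_on interior S"
        using holT ST interior_subset by (meson holomorphic_on_subset order_trans)
      show "continuous_on (closure S) (\<lambda>z. f z * exp (- (of_real \<zeta> * \<phi> z)))"
        using holT closure_minimal[OF ST cT] by (meson continuous_on_subset holomorphic_on_imp_continuous_on)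
      show "bounded S" by (rule bounded_subset[of "ball 0 \<rho>"]) (auto simp: S_def)
      show "z0 \<in> S" using False z0 by (auto simp: S_def \<rho>_def)
      fix z assume "z \<in> frontier S"
      then have z: "z \<in> T" "z \<notin> S" using frontier_open_subset[OF oS cT ST] by auto
      then have z': "Re z \<ge> 0" "Im z \<ge> 0" by (auto simp: T_def)
      have ph: "Re (\<phi> z) \<ge> 0" by (rule order_trans[OF _ \<phi>[OF z']]) simp
      have "Re z = 0 \<or> Im z = 0 \<or> norm z = \<rho>" using z by (simp add: S_def T_def not_less) linarith
      then consider "Re z = 0" | "Im z = 0" | "norm z = \<rho>" by blast
      then show "norm (f z * exp (- (of_real \<zeta> * \<phi> z))) \<le> B"
      proof cases
        case 1
        then have "z = \<i> * of_real (Im z)" by (simp add: complex_eq_iff)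
        then have "norm (f z) \<le> B" using im[OF z'(2)] by simp
        then have "norm (f z) * exp (- (\<zeta> * Re (\<phi> z))) \<le> B * 1" using ph \<zeta> B by (intro mult_mono) auto
        then show ?thesis by (simp add: nrm)
      next
        case 2
        then have "z = of_real (Re z)" by (simp add: complex_eq_iff)
        then have "norm (f z) \<le> B" using re[OF z'(1)] by simp
        then have "norm (f z) * exp (- (\<zeta> * Re (\<phi> z))) \<le> B * 1" using ph \<zeta> B by (intro mult_mono) auto
        then show ?thesis by (simp add: nrm)
      next
        case 3
        have \<rho>1: "\<rho> \<ge> 1" by (simp add: \<rho>_def)
        have "Q \<le> sqrt \<rho>" by (rule real_le_rsqrt) (simp add: \<rho>_def)
        then have "2 * \<bar>K\<bar> + \<bar>ln B\<bar> \<le> 3/10 * \<zeta> * sqrt \<rho>" using \<zeta> by (simp add: Q_def field_simps)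
        then have "\<rho> * (2 * \<bar>K\<bar> + \<bar>ln B\<bar>) \<le> \<rho> * (3/10 * \<zeta> * sqrt \<rho>)" using \<rho>1 by (intro mult_left_mono) auto
        also have "\<dots> = \<zeta> * (3/10 * (norm z * sqrt (norm z)))" by (simp add: 3)
        also have "\<dots> \<le> \<zeta> * Re (\<phi> z)" using \<phi>[OF z'] \<zeta> by (intro mult_left_mono) auto
        finally have 4: "\<rho> * (2 * \<bar>K\<bar> + \<bar>ln B\<bar>) \<le> \<zeta> * Re (\<phi> z)" .
        have "K * (1 + \<rho>) \<le> \<bar>K\<bar> * (2 * \<rho>)" using \<rho>1 by (intro mult_mono) auto
        moreover have "1 * \<bar>ln B\<bar> \<le> \<rho> * \<bar>ln B\<bar>" using \<rho>1 by (intro mult_right_mono) auto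
        ultimately have "K * (1 + \<rho>) - \<zeta> * Re (\<phi> z) \<le> ln B" using 4 by (simp add: algebra_simps)
        then have "exp (K * (1 + \<rho>) - \<zeta> * Re (\<phi> z)) \<le> B" using B by (metis exp_le_cancel_iff exp_ln)
        moreover have "norm (f z) * exp (- (\<zeta> * Re (\<phi> z))) \<le> exp (K * (1 + \<rho>)) * exp (- (\<zeta> * Re (\<phi> z)))"
          using K[of z] 3 by (intro mult_right_mono) auto
        ultimately show ?thesis unfolding nrm by (simp add: exp_add[symmetric])
      qed
    qed
    then show ?thesis unfolding nrm by (simp add: exp_minus field_simps)
  qed
  have "((\<lambda>\<zeta>. B * exp (\<zeta> * Re (\<phi> z0))) \<longlongrightarrow> B * exp (0 * Re (\<phi> z0))) (at_right 0)"
    by (intro tendsto_intros)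
  then show ?thesis
    by (intro tendsto_lowerbound[where F = "at_right (0::real)"]) (auto intro!: main eventually_mono[OF eventually_at_right_less])
qed

text \<open>The factor \<open>exp (\<i> * of_real \<delta> * z)\<close> absorbs the growth on the
  imaginary axis, and the quadrant version gives a bound \<open>N\<close> that still depends on
  \<delta>. Before \<delta> can tend to 0, \<open>N\<close> must be replaced by the real-axis bound
  \<open>M\<close>; dividing by the linearly growing \<open>q\<close> achieves this, since
  boundedness is already known.\<close>

lemma phragmen_lindelof_halfplane:
  assumes f: "f holomorphic_on UNIV" and K: "\<And>z. norm (f z) \<le> exp (K * (1 + norm z))"
    and M: "M > 0" and re: "\<And>x. norm (f (of_real x)) \<le> M"
    and im: "\<And>\<delta>. \<delta> > 0 \<Longrightarrow> \<exists>B. \<forall>x\<ge>0. norm (f (\<i> * of_real x)) \<le> B * exp (\<delta> * x)"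
    and z0: "Im z0 \<ge> 0"
  shows "norm (f z0) \<le> M"
proof -
  have main: "norm (f z0) * exp (- (\<delta> * Im z0)) \<le> M" if \<delta>: "\<delta> > 0" for \<delta>
  proof -
    define g where "g z = f z * exp (\<i> * of_real \<delta> * z)" for z
    have g: "g holomorphic_on UNIV" unfolding g_def by (intro holomorphic_intros f)
    have ng: "norm (g z) = norm (f z) * exp (- (\<delta> * Im z))" for z by (simp add: g_def norm_mult)
    have Kg: "norm (g z) \<le> exp ((\<bar>K\<bar> + \<delta>) * (1 + norm z))" for z
    proof -
      have "- (\<delta> * Im z) \<le> \<delta> * norm z" using abs_Im_le_cmod[of z] \<delta> 
        by (smt (verit) mult_left_mono mult_minus_right)
      then have "K * (1 + norm z) + - (\<delta> * Im z) \<le> \<bar>K\<bar> * (1 + norm z) + \<delta> * (1 + norm z)"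
        using \<delta> by (intro add_mono mult_right_mono) (auto simp: algebra_simps)
      then have "exp (K * (1 + norm z)) * exp (- (\<delta> * Im z)) \<le> exp ((\<bar>K\<bar> + \<delta>) * (1 + norm z))"
        by (simp add: exp_add[symmetric] algebra_simps)
      moreover have "norm (g z) \<le> exp (K * (1 + norm z)) * exp (- (\<delta> * Im z))"
        unfolding ng using K by (intro mult_right_mono) auto
      ultimately show ?thesis by linarith
    qed
    obtain B where B: "\<And>x. x \<ge> 0 \<Longrightarrow> norm (f (\<i> * of_real x)) \<le> B * exp (\<delta> * x)" using im[OF \<delta>] by blast
    define N where "N = max M B"
    have N: "N > 0" using M by (simp add: N_def)
    have gr: "norm (g (of_real x)) \<le> N" for x using re[of x] by (simp add: ng N_def)
    have gi: "norm (g (\<i> * of_real x)) \<le> N" if "x \<ge> 0" for x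
    proof -
      have "norm (g (\<i> * of_real x)) \<le> B * exp (\<delta> * x) * exp (- (\<delta> * x))"
        unfolding ng using B[OF that] by (simp add: mult_right_mono)
      then show ?thesis by (simp add: exp_add[symmetric] mult.assoc N_def)
    qed
    have gN: "norm (g z) \<le> N" if "Im z \<ge> 0" for z
    proof (cases "Re z \<ge> 0")
      case True
      show ?thesis by (rule phragmen_lindelof_quadrant[OF g Kg N gr gi True that])
    next
      case False
      have "norm (g (\<i> * (- \<i> * z))) \<le> N"
      proof (rule phragmen_lindelof_quadrant[of "\<lambda>z. g (\<i> * z)"])
        show "(\<lambda>z. g (\<i> * z)) holomorphic_on UNIV"
          by (rule holomorphic_on_compose_gen[OF _ g, unfolded o_def]) (auto intro!: holomorphic_intros)
        show "norm (g (\<i> * z)) \<le> exp ((\<bar>K\<bar> + \<delta>) * (1 + norm z))" for z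
          using Kg[of "\<i> * z"] by (simp add: norm_mult)
        show "norm (g (\<i> * (\<i> * of_real x))) \<le> N" for x using gr[of "- x"] by (simp add: mult.assoc[symmetric])
      qed (use False that N gi in auto)
      then show ?thesis by (simp add: mult.assoc[symmetric])
    qed
    have main2: "norm (g z0) \<le> M * (1 + \<zeta> * norm z0)" if \<zeta>: "\<zeta> > 0" for \<zeta>
    proof (cases "Im z0 = 0")
      case True
      then have "z0 = of_real (Re z0)" by (simp add: complex_eq_iff)
      then have "norm (g z0) \<le> M * 1" using re[of "Re z0"] True by (simp add: ng)
      also have "\<dots> \<le> M * (1 + \<zeta> * norm z0)" using M \<zeta> by (intro mult_left_mono) auto
      finally show ?thesis .
    next
      case False
      define q where "q z = 1 - \<i> * of_real \<zeta> * z" for z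
      have q1: "norm (q z) \<ge> 1" "norm (q z) \<ge> \<zeta> * norm z" if "Im z \<ge> 0" for z
      proof -
        have "Re (q z) = 1 + \<zeta> * Im z" by (simp add: q_def)
        then show "norm (q z) \<ge> 1" using complex_Re_le_cmod[of "q z"] that \<zeta> by (smt (verit) mult_nonneg_nonneg)
        have "(\<zeta> * norm z)\<^sup>2 \<le> (norm (q z))\<^sup>2" unfolding power_mult_distrib cmod_power2
          using that \<zeta> by (simp add: q_def power2_eq_square algebra_simps)
        then show "norm (q z) \<ge> \<zeta> * norm z" by (rule power2_le_imp_le) simp
      qed
      define \<rho> where "\<rho> = max (norm z0 + 1) (N / (\<zeta> * M))"
      define S where "S = {z. Im z > 0 \<and> norm z < \<rho>}"
      define T where "T = {z. Im z \<ge> 0 \<and> norm z \<le> \<rho>}"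
      have oS: "open S" unfolding S_def by (intro open_Collect_conj open_Collect_less continuous_intros)
      have cT: "closed T" unfolding T_def by (rule closed_halfplane_cball)
      have ST: "S \<subseteq> T" by (auto simp: S_def T_def)
      have holT: "(\<lambda>z. g z / q z) holomorphic_on T"
      proof (intro holomorphic_on_divide)
        show "g holomorphic_on T" using g by (rule holomorphic_on_subset) simp
        show "q holomorphic_on T" unfolding q_def by (intro holomorphic_intros)
        show "q z \<noteq> 0" if "z \<in> T" for z using q1(1)[of z] that by (auto simp: T_def)
      qed
      have "norm (g z0 / q z0) \<le> M"
      proof (rule maximum_modulus_frontier[of "\<lambda>z. g z / q z" S])
        show "(\<lambda>z. g z / q z) holomorphic_on interior S"
          using holT ST interior_subset by (meson holomorphic_on_subset order_trans)
        show "continuous_on (closure S) (\<lambda>z. g z / q z)"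
          using holT closure_minimal[OF ST cT] by (meson continuous_on_subset holomorphic_on_imp_continuous_on)
        show "bounded S" by (rule bounded_subset[of "ball 0 \<rho>"]) (auto simp: S_def)
        show "z0 \<in> S" using False z0 by (auto simp: S_def \<rho>_def)
        fix z assume "z \<in> frontier S"
        then have z: "z \<in> T" "z \<notin> S" using frontier_open_subset[OF oS cT ST] by auto
        then have z': "Im z \<ge> 0" by (auto simp: T_def)
        have "Im z = 0 \<or> norm z = \<rho>" using z by (simp add: S_def T_def not_less) linarith
        then consider "Im z = 0" | "norm z = \<rho>" by blast
        then show "norm (g z / q z) \<le> M"
        proof cases
          case 1
          then have "z = of_real (Re z)" by (simp add: complex_eq_iff)
          then have "norm (g z) \<le> M * 1" using re[of "Re z"] 1 by (simp add: ng)
          also have "\<dots> \<le> M * norm (q z)" using M q1(1)[OF z'] by (intro mult_left_mono) auto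
          finally show ?thesis using q1(1)[OF z'] by (subst norm_divide, subst pos_divide_le_eq) auto
        next
          case 2
          have "N \<le> M * (\<zeta> * \<rho>)" using M \<zeta> by (auto simp: \<rho>_def max_def field_simps not_le)
          also have "\<dots> \<le> M * norm (q z)" using M q1(2)[OF z'] 2 by (intro mult_left_mono) auto
          finally have "norm (g z) \<le> M * norm (q z)" using gN[OF z'] by simp
          then show ?thesis using q1(1)[OF z'] by (subst norm_divide, subst pos_divide_le_eq) auto
        qed
      qed
      then have "norm (g z0) \<le> M * norm (q z0)" using q1(1)[OF z0] by (subst (asm) norm_divide, subst (asm) pos_divide_le_eq) auto
      also have "norm (q z0) \<le> 1 + \<zeta> * norm z0"
        unfolding q_def using norm_triangle_ineq4[of 1 "\<i> * of_real \<zeta> * z0"] \<zeta> by (simp add: norm_mult)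
      finally show ?thesis using M by simp
    qed
    have "((\<lambda>\<zeta>. M * (1 + \<zeta> * norm z0)) \<longlongrightarrow> M * (1 + 0 * norm z0)) (at_right 0)"
      by (intro tendsto_intros)
    then have "norm (g z0) \<le> M * (1 + 0 * norm z0)"
      by (rule tendsto_lowerbound) (auto intro!: main2 eventually_mono[OF eventually_at_right_less])
    then show ?thesis by (simp add: ng)
  qed
  have "((\<lambda>\<delta>. norm (f z0) * exp (- (\<delta> * Im z0))) \<longlongrightarrow> norm (f z0) * exp (- (0 * Im z0))) (at_right 0)"
    by (intro tendsto_intros)
  then have "norm (f z0) * exp (- (0 * Im z0)) \<le> M"
    by (rule tendsto_upperbound) (auto intro!: main eventually_mono[OF eventually_at_right_less])
  then show ?thesis by simp
qed

lemma bounded_on_segment: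
  assumes "continuous_on UNIV (f :: complex \<Rightarrow> complex)"
  obtains B where "B > 0" "\<And>x. \<bar>x\<bar> \<le> X \<Longrightarrow> norm (f (c * of_real x)) \<le> B"
proof -
  have "continuous_on {-X..X} (\<lambda>x. f (c * of_real x))"
    by (rule continuous_on_compose2[OF assms]) (auto intro!: continuous_intros)
  then have "bounded ((\<lambda>x. f (c * of_real x)) ` {-X..X})"
    by (intro compact_imp_bounded compact_continuous_image) auto
  then obtain B where "B > 0" "\<forall>y\<in>(\<lambda>x. f (c * of_real x)) ` {-X..X}. norm y \<le> B"
    unfolding bounded_pos by blast
  then show ?thesis by (intro that[of B]) (auto simp: abs_le_iff)
qed

text \<open>Both functions that have to vanish, \<open>F\<close> and later \<open>G\<close>, are
  first shown constant by this criterion. Evenness reduces the negative axis and the lower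
  half-plane to what is assumed; \<open>bounded_on_segment\<close> covers the initial pieces of the
  axes.\<close>

lemma even_exp_type_constant:
  assumes f: "f holomorphic_on UNIV" and K: "\<And>z. norm (f z) \<le> exp (K * (1 + norm z))"
    and even: "\<And>z. f (- z) = f z"
    and re: "\<And>x. x \<ge> X \<Longrightarrow> norm (f (of_real x)) \<le> M"
    and im: "\<And>\<delta>. \<delta> > 0 \<Longrightarrow> \<exists>B X. \<forall>x\<ge>X. norm (f (\<i> * of_real x)) \<le> B * exp (\<delta> * x)"
  shows "f z = f 0"
proof -
  have cont: "continuous_on UNIV f" using f by (rule holomorphic_on_imp_continuous_on)
  obtain B0 where B0: "B0 > 0" "\<And>x. \<bar>x\<bar> \<le> X \<Longrightarrow> norm (f (1 * of_real x)) \<le> B0"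
    using bounded_on_segment[OF cont] by blast
  define M' where "M' = max M B0"
  have M': "M' > 0" using B0 by (simp add: M'_def)
  have re': "norm (f (of_real x)) \<le> M'" for x
  proof -
    have "f (of_real x) = f (of_real \<bar>x\<bar>)" using even[of "of_real x"] by (cases "x \<ge> 0") auto
    moreover have "norm (f (of_real \<bar>x\<bar>)) \<le> M'"
      using re[of "\<bar>x\<bar>"] B0(2)[of "\<bar>x\<bar>"] by (cases "\<bar>x\<bar> \<ge> X") (auto simp: M'_def)
    ultimately show ?thesis by simp
  qed
  have im': "\<exists>B. \<forall>x\<ge>0. norm (f (\<i> * of_real x)) \<le> B * exp (\<delta> * x)" if \<delta>: "\<delta> > 0" for \<delta>
  proof -
    obtain B X where B: "\<And>x. x \<ge> X \<Longrightarrow> norm (f (\<i> * of_real x)) \<le> B * exp (\<delta> * x)" using im[OF \<delta>] by blast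
    obtain B1 where B1: "B1 > 0" "\<And>x. \<bar>x\<bar> \<le> X \<Longrightarrow> norm (f (\<i> * of_real x)) \<le> B1"
      using bounded_on_segment[OF cont] by blast
    have "norm (f (\<i> * of_real x)) \<le> max B B1 * exp (\<delta> * x)" if "x \<ge> 0" for x
    proof (cases "x \<ge> X")
      case True
      have "B * exp (\<delta> * x) \<le> max B B1 * exp (\<delta> * x)" by (intro mult_right_mono) auto
      then show ?thesis using B[OF True] by linarith
    next
      case False
      then have "norm (f (\<i> * of_real x)) \<le> B1 * 1" using B1(2)[of x] that by simp
      also have "\<dots> \<le> max B B1 * exp (\<delta> * x)" using B1 that \<delta> by (intro mult_mono) auto
      finally show ?thesis .
    qed
    then show ?thesis by blast
  qed
  have bd: "norm (f z) \<le> M'" for z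
  proof (cases "Im z \<ge> 0")
    case True
    show ?thesis by (rule phragmen_lindelof_halfplane[OF f K M' re' im' True])
  next
    case False
    then have "Im (- z) \<ge> 0" by simp
    from phragmen_lindelof_halfplane[OF f K M' re' im' this] show ?thesis by (simp add: even)
  qed
  have "bounded (range f)" using bd by (auto simp: bounded_iff)
  then obtain c where "\<And>z. f z = c" using Liouville_theorem[OF f] by (auto simp: constant_on_def)
  then show ?thesis by simp
qed

section \<open>The equation \<open>u'' + k\<^sup>2 \<eta> u = 0\<close>\<close>

definition solves :: "(real \<Rightarrow> real) \<Rightarrow> complex \<Rightarrow> (real \<Rightarrow> complex) \<Rightarrow> (real \<Rightarrow> complex) \<Rightarrow> bool" where
  "solves eta k u v \<longleftrightarrow>
     (\<forall>r\<in>{0..1}. (u has_vector_derivative v r) (at r within {0..1}) \<and>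
                 (v has_vector_derivative (- (k\<^sup>2 * complex_of_real (eta r) * u r))) (at r within {0..1}))"

lemma solvesD:
  assumes "solves eta k u v" "r \<in> {0..1}"
  shows "(u has_vector_derivative v r) (at r within {0..1})"
    "(v has_vector_derivative (- (k\<^sup>2 * complex_of_real (eta r) * u r))) (at r within {0..1})"
  using assms by (auto simp: solves_def)

lemma solves_linear:
  assumes "solves eta k u1 v1" "solves eta k u2 v2"
  shows "solves eta k (\<lambda>r. c1 * u1 r + c2 * u2 r) (\<lambda>r. c1 * v1 r + c2 * v2 r)"
  unfolding solves_def
  by (auto intro!: derivative_eq_intros solvesD[OF assms(1)] solvesD[OF assms(2)] simp: algebra_simps)

lemma wronskian_constant:
  assumes 1: "solves eta k u1 v1" and 2: "solves eta k u2 v2" and r: "r \<in> {0..1}" and s: "s \<in> {0..1}"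
  shows "u1 r * v2 r - v1 r * u2 r = u1 s * v2 s - v1 s * u2 s"
proof -
  have "((\<lambda>r. u1 r * v2 r - v1 r * u2 r) has_vector_derivative 0) (at r within {0..1})" if "r \<in> {0..1}" for r
    by (auto intro!: derivative_eq_intros solvesD[OF 1 that] solvesD[OF 2 that] simp: algebra_simps)
  then obtain c where "\<And>r. r \<in> {0..1} \<Longrightarrow> u1 r * v2 r - v1 r * u2 r = c"
    using has_vector_derivative_zero_constant[of "{0..1::real}" "\<lambda>r. u1 r * v2 r - v1 r * u2 r"] by auto
  then show ?thesis using r s by simp
qed

text \<open>The coefficients are Wronskians of \<open>u\<close> with \<open>C\<close> and
  \<open>D\<close>. Being constant they may be evaluated at \<open>r\<close>, where the identity is
  Cramer's rule. Uniqueness of solutions is read off from this.\<close>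

lemma solves_by_fundamental:
  assumes C: "solves eta k C C'" and D: "solves eta k D D'" and u: "solves eta k u v"
    and s: "s \<in> {0..1}" and W: "C s * D' s - C' s * D s = 1" and r: "r \<in> {0..1}"
  shows "u r = (u s * D' s - v s * D s) * C r + (v s * C s - u s * C' s) * D r"
    "v r = (u s * D' s - v s * D s) * C' r + (v s * C s - u s * C' s) * D' r"
proof -
  have W': "C r * D' r - C' r * D r = 1" using wronskian_constant[OF C D r s] W by simp
  have a: "u s * D' s - v s * D s = u r * D' r - v r * D r"
    using wronskian_constant[OF u D s r] by simp
  have b: "v s * C s - u s * C' s = v r * C r - u r * C' r"
    using wronskian_constant[OF C u s r] by (simp add: algebra_simps)
  have "u r = u r * (C r * D' r - C' r * D r)" "v r = v r * (C r * D' r - C' r * D r)" by (simp_all add: W')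
  then show "u r = (u s * D' s - v s * D s) * C r + (v s * C s - u s * C' s) * D r"
    "v r = (u s * D' s - v s * D s) * C' r + (v s * C s - u s * C' s) * D' r"
    unfolding a b by (simp_all add: algebra_simps)
qed

section \<open>Solutions as power series, analytic in the spectral parameter\<close>

lemma has_vector_derivative_series:
  fixes f :: "nat \<Rightarrow> real \<Rightarrow> 'b::banach"
  assumes S: "convex S" and f: "\<And>n x. x \<in> S \<Longrightarrow> (f n has_vector_derivative f' n x) (at x within S)"
    and lim: "uniform_limit S (\<lambda>n x. \<Sum>i<n. f' i x) g' sequentially"
    and x0: "x0 \<in> S" "summable (\<lambda>n. f n x0)"
  shows "\<exists>g. \<forall>x\<in>S. (\<lambda>n. f n x) sums g x \<and> (g has_vector_derivative g' x) (at x within S)"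
  unfolding has_vector_derivative_def
proof (rule has_derivative_series)
  show "convex S" "x0 \<in> S" "(\<lambda>n. f n x0) sums (\<Sum>n. f n x0)" using S x0 by auto
  show "(f n has_derivative (\<lambda>h. h *\<^sub>R f' n x)) (at x within S)" if "x \<in> S" for n x
    using f[OF that] by (simp add: has_vector_derivative_def)
  fix e :: real assume "e > 0"
  then have "\<forall>\<^sub>F n in sequentially. \<forall>x\<in>S. dist (\<Sum>i<n. f' i x) (g' x) < e"
    using lim by (simp add: uniform_limit_iff)
  then show "\<forall>\<^sub>F n in sequentially. \<forall>x\<in>S. \<forall>h. norm ((\<Sum>i<n. h *\<^sub>R f' i x) - h *\<^sub>R g' x) \<le> e * norm h"
  proof (rule eventually_mono, intro ballI allI)
    fix n x h assume *: "\<forall>x\<in>S. dist (\<Sum>i<n. f' i x) (g' x) < e" "x \<in> S"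
    have "(\<Sum>i<n. h *\<^sub>R f' i x) - h *\<^sub>R g' x = h *\<^sub>R ((\<Sum>i<n. f' i x) - g' x)"
      by (simp add: scaleR_sum_right scaleR_diff_right)
    then show "norm ((\<Sum>i<n. h *\<^sub>R f' i x) - h *\<^sub>R g' x) \<le> e * norm h"
      using * mult_left_mono[of "norm ((\<Sum>i<n. f' i x) - g' x)" e "\<bar>h\<bar>"] by (auto simp: dist_norm mult.commute less_imp_le)
  qed
qed

text \<open>\<open>picard eta a b n\<close> holds the coefficient of
  \<open>(- k\<^sup>2) ^ n\<close> in the solution with data \<open>a\<close>, \<open>b\<close> at
  0, together with its \<open>r\<close>-derivative. Expanding in this parameter makes solutions
  entire in \<open>k\<close> and the coefficients real.\<close>

primrec picard :: "(real \<Rightarrow> real) \<Rightarrow> real \<Rightarrow> real \<Rightarrow> nat \<Rightarrow> (real \<Rightarrow> real) \<times> (real \<Rightarrow> real)" where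
  "picard eta a b 0 = (\<lambda>r. a + b * r, \<lambda>r. b)"
| "picard eta a b (Suc n) =
    (\<lambda>r. integral {0..r} (\<lambda>t. integral {0..t} (\<lambda>x. eta x * fst (picard eta a b n) x)),
     \<lambda>r. integral {0..r} (\<lambda>x. eta x * fst (picard eta a b n) x))"

context
  fixes eta :: "real \<Rightarrow> real" and a b :: real
  assumes cont: "continuous_on {0..1} eta"
begin

abbreviation "pc n \<equiv> fst (picard eta a b n)"
abbreviation "pd n \<equiv> snd (picard eta a b n)"

lemma picard_derivs:
  "\<forall>r\<in>{0..1}. (pc n has_vector_derivative pd n r) (at r within {0..1})"
  "\<forall>r\<in>{0..1}. (pd n has_vector_derivative (case n of 0 \<Rightarrow> 0 | Suc m \<Rightarrow> eta r * pc m r)) (at r within {0..1})"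
proof (induction n)
  case 0
  show "\<forall>r\<in>{0..1}. (pc 0 has_vector_derivative pd 0 r) (at r within {0..1})"
    by (auto intro!: derivative_eq_intros)
  show "\<forall>r\<in>{0..1}. (pd 0 has_vector_derivative (case 0 of 0 \<Rightarrow> 0 | Suc m \<Rightarrow> eta r * pc m r)) (at r within {0..1})"
    by (auto intro!: derivative_eq_intros)
next
  case (Suc n)
  have c: "continuous_on {0..1} (pc n)"
    using Suc(1) by (meson has_vector_derivative_continuous continuous_on_eq_continuous_within)
  then have ec: "continuous_on {0..1} (\<lambda>x. eta x * pc n x)" using cont by (intro continuous_intros)
  show D: "\<forall>r\<in>{0..1}. (pd (Suc n) has_vector_derivative (case Suc n of 0 \<Rightarrow> 0 | Suc m \<Rightarrow> eta r * pc m r)) (at r within {0..1})"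
    using integral_has_vector_derivative[OF ec] by simp
  have "continuous_on {0..1} (pd (Suc n))"
    using D by (meson has_vector_derivative_continuous continuous_on_eq_continuous_within)
  from integral_has_vector_derivative[OF this]
  show "\<forall>r\<in>{0..1}. (pc (Suc n) has_vector_derivative pd (Suc n) r) (at r within {0..1})" by simp
qed

lemma integral_le_power:
  fixes f :: "real \<Rightarrow> real"
  assumes f: "continuous_on {0..1} f" and b: "\<And>t. t \<in> {0..1} \<Longrightarrow> \<bar>f t\<bar> \<le> B * t ^ n" and r: "r \<in> {0..1}"
  shows "\<bar>integral {0..r} f\<bar> \<le> B * r ^ Suc n / Suc n"
proof -
  have "((\<lambda>t. B * t ^ n) has_integral (B * r ^ Suc n / Suc n - B * 0 ^ Suc n / Suc n)) {0..r}"
  proof (rule fundamental_theorem_of_calculus)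
    fix t assume "t \<in> {0..r}"
    have "((\<lambda>t. B / Suc n * t ^ Suc n) has_real_derivative B * t ^ n) (at t)"
      using DERIV_cmult[OF DERIV_pow[of "Suc n" t], of "B / Suc n"] by simp
    then show "((\<lambda>t. B * t ^ Suc n / Suc n) has_vector_derivative B * t ^ n) (at t within {0..r})"
      unfolding has_real_derivative_iff_has_vector_derivative[symmetric] times_divide_eq_left[symmetric]
      by (rule has_field_derivative_at_within)
  qed (use r in auto)
  then have I: "((\<lambda>t. B * t ^ n) has_integral (B * r ^ Suc n / Suc n)) {0..r}" by simp
  then have "(\<lambda>t. B * t ^ n) integrable_on {0..r}" by (rule has_integral_integrable)
  moreover have "f integrable_on {0..r}"
    using r by (intro integrable_continuous_real continuous_on_subset[OF f]) auto
  ultimately have "norm (integral {0..r} f) \<le> integral {0..r} (\<lambda>t. B * t ^ n)"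
    using b r by (intro integral_norm_bound_integral) auto
  with integral_unique[OF I] show ?thesis by simp
qed

text \<open>Only one of the two integrations of a step is credited with a gain, so that both
  components share one bound; \<open>1 / fact n\<close> already gives convergence for every
  \<open>k\<close>.\<close>

lemma picard_bounds:
  assumes M: "\<And>x. x \<in> {0..1} \<Longrightarrow> \<bar>eta x\<bar> \<le> M" "M \<ge> 0"
  shows "\<forall>r\<in>{0..1}. \<bar>pc n r\<bar> \<le> (\<bar>a\<bar> + \<bar>b\<bar>) * M ^ n / fact n * r ^ n \<and> \<bar>pd n r\<bar> \<le> (\<bar>a\<bar> + \<bar>b\<bar>) * M ^ n / fact n * r ^ n"
proof (induction n)
  case 0
  have "\<bar>a + b * r\<bar> \<le> \<bar>a\<bar> + \<bar>b\<bar>" if "0 \<le> r" "r \<le> 1" for r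
  proof -
    have "\<bar>b * r\<bar> \<le> \<bar>b\<bar> * 1" using that unfolding abs_mult by (intro mult_left_mono) auto
    then show ?thesis by linarith
  qed
  then show ?case by auto
next
  case (Suc n)
  define A where "A = (\<bar>a\<bar> + \<bar>b\<bar>) * M ^ n / fact n"
  have A: "A \<ge> 0" using M by (simp add: A_def)
  have cc: "continuous_on {0..1} (pc n)" for n
    using picard_derivs(1) by (meson has_vector_derivative_continuous continuous_on_eq_continuous_within)
  have cd: "continuous_on {0..1} (pd n)" for n
    using picard_derivs(2) by (meson has_vector_derivative_continuous continuous_on_eq_continuous_within)
  have e: "\<bar>eta t * pc n t\<bar> \<le> (M * A) * t ^ n" if "t \<in> {0..1}" for t
  proof -
    have "\<bar>eta t * pc n t\<bar> \<le> M * (A * t ^ n)"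
      unfolding abs_mult using Suc that M by (intro mult_mono) (auto simp: A_def)
    then show ?thesis by (simp add: mult.assoc)
  qed
  have MA: "M * A / Suc n = (\<bar>a\<bar> + \<bar>b\<bar>) * M ^ Suc n / fact (Suc n)" by (simp add: A_def field_simps)
  have d: "\<bar>pd (Suc n) r\<bar> \<le> (M * A / Suc n) * r ^ Suc n" if "r \<in> {0..1}" for r
    using integral_le_power[OF _ e that] cc cont by (simp add: continuous_intros)
  have "\<bar>pc (Suc n) r\<bar> \<le> (M * A / Suc n) * r ^ Suc n" if r: "r \<in> {0..1}" for r
  proof -
    have "\<bar>pc (Suc n) r\<bar> \<le> (M * A / Suc n) * r ^ Suc (Suc n) / Suc (Suc n)"
      using integral_le_power[OF cd[of "Suc n"] d r] by simp
    also have "\<dots> = (M * A / Suc n) * r ^ Suc n * (r / Suc (Suc n))" by simp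
    also have "\<dots> \<le> (M * A / Suc n) * r ^ Suc n * 1"
      using r A M by (intro mult_left_mono) auto
    finally show ?thesis by simp
  qed
  then show ?case using d unfolding MA by simp
qed

lemma solution_family_real_data:
  "\<exists>u v. (\<forall>k. solves eta k (u k) (v k) \<and> u k 0 = of_real a \<and> v k 0 = of_real b) \<and>
     (\<forall>r\<in>{0..1}. (\<lambda>k. u k r) holomorphic_on UNIV \<and> (\<lambda>k. v k r) holomorphic_on UNIV)"
proof -
  have "bounded (eta ` {0..1})" using cont by (intro compact_imp_bounded compact_continuous_image) auto
  then obtain M where M: "M > 0" "\<And>x. x \<in> {0..1} \<Longrightarrow> \<bar>eta x\<bar> \<le> M" unfolding bounded_pos by auto
  define A where "A = \<bar>a\<bar> + \<bar>b\<bar>"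
  define B where "B w n = A * (inverse (fact n) * (M * norm w) ^ n)" for w :: complex and n
  have sumB: "summable (B w)" for w
    unfolding B_def by (intro summable_mult summable_exp)
  have B: "norm (complex_of_real (pc n r) * w ^ n) \<le> B w n" "norm (complex_of_real (pd n r) * w ^ n) \<le> B w n"
    if "r \<in> {0..1}" for n r w
  proof -
    have rn: "r ^ n \<le> 1" using that by (intro power_le_one) auto
    have "(A * M ^ n / fact n) * r ^ n \<le> (A * M ^ n / fact n) * 1"
      using M rn by (intro mult_left_mono) (auto simp: A_def)
    then have "\<bar>pc n r\<bar> \<le> A * M ^ n / fact n" "\<bar>pd n r\<bar> \<le> A * M ^ n / fact n"
      using picard_bounds[of M n] M that by (auto simp: A_def intro: order_trans)
    then have "\<bar>pc n r\<bar> * norm w ^ n \<le> (A * M ^ n / fact n) * norm w ^ n" "\<bar>pd n r\<bar> * norm w ^ n \<le> (A * M ^ n / fact n) * norm w ^ n"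
      by (intro mult_right_mono; simp)+
    then show "norm (complex_of_real (pc n r) * w ^ n) \<le> B w n" "norm (complex_of_real (pd n r) * w ^ n) \<le> B w n"
      by (auto simp: B_def norm_mult norm_power power_mult_distrib divide_inverse mult_ac)
  qed
  have sc: "summable (\<lambda>n. complex_of_real (pc n r) * w ^ n)" if "r \<in> {0..1}" for r w
    by (rule summable_comparison_test'[OF sumB[of w], of 0]) (use B(1)[OF that] in auto)
  have sd: "summable (\<lambda>n. complex_of_real (pd n r) * w ^ n)" if "r \<in> {0..1}" for r w
    by (rule summable_comparison_test'[OF sumB[of w], of 0]) (use B(2)[OF that] in auto)
  define U where "U w r = (\<Sum>n. complex_of_real (pc n r) * w ^ n)" for w r
  define V where "V w r = (\<Sum>n. complex_of_real (pd n r) * w ^ n)" for w r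
  have dU: "(U w has_vector_derivative V w r) (at r within {0..1})" if r: "r \<in> {0..1}" for w r
  proof -
    have "\<exists>g. \<forall>x\<in>{0..1}. (\<lambda>n. complex_of_real (pc n x) * w ^ n) sums g x \<and> (g has_vector_derivative V w x) (at x within {0..1})"
    proof (rule has_vector_derivative_series[where ?x0.0 = 0])
      show "((\<lambda>x. complex_of_real (pc n x) * w ^ n) has_vector_derivative complex_of_real (pd n x) * w ^ n) (at x within {0..1})"
        if "x \<in> {0..1}" for n x
        using picard_derivs(1) that by (auto intro!: derivative_eq_intros has_vector_derivative_of_real simp: has_real_derivative_iff_has_vector_derivative)
      show "uniform_limit {0..1} (\<lambda>n x. \<Sum>i<n. complex_of_real (pd i x) * w ^ i) (V w) sequentially"
        unfolding V_def using B(2) sumB by (intro Weierstrass_m_test[of _ _ "B w"]) auto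
    qed (use sc[of 0] in auto)
    then obtain g where g: "\<And>x. x \<in> {0..1} \<Longrightarrow> (\<lambda>n. complex_of_real (pc n x) * w ^ n) sums g x"
      "\<And>x. x \<in> {0..1} \<Longrightarrow> (g has_vector_derivative V w x) (at x within {0..1})" by blast
    have "U w x = g x" if "x \<in> {0..1}" for x using g(1)[OF that] by (simp add: U_def sums_unique[symmetric])
    then show ?thesis by (rule has_vector_derivative_transform[OF r _ g(2)[OF r]])
  qed
  have dV: "(V w has_vector_derivative (w * of_real (eta r) * U w r)) (at r within {0..1})" if r: "r \<in> {0..1}" for w r
  proof -
    \<comment> \<open>Index shift: \<open>pd (Suc n)\<close> differentiates to
      \<open>eta * pc n\<close>, so the differentiated series is \<open>w * eta\<close> times the
      series of \<open>U\<close>. With \<open>w = - k\<^sup>2\<close> this is the equation.\<close>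
    define f' where "f' n x = complex_of_real (case n of 0 \<Rightarrow> 0 | Suc m \<Rightarrow> eta x * pc m x) * w ^ n" for n x
    have f'0: "f' 0 x = 0" and f'S: "f' (Suc n) x = (w * of_real (eta x)) * (complex_of_real (pc n x) * w ^ n)" for n x
      by (simp_all add: f'_def)
    have lim: "(\<Sum>i. f' i x) = w * of_real (eta x) * U w x" if "x \<in> {0..1}" for x
    proof -
      have "(\<lambda>n. f' (Suc n) x) sums (w * of_real (eta x) * U w x)"
        unfolding f'S U_def using sc[OF that] by (intro sums_mult summable_sums)
      then have "(\<lambda>n. f' n x) sums (w * of_real (eta x) * U w x)"
        using sums_Suc[of "\<lambda>n. f' n x"] by (simp add: f'0)
      then show ?thesis by (simp add: sums_unique[symmetric])
    qed
    have "\<exists>g. \<forall>x\<in>{0..1}. (\<lambda>n. complex_of_real (pd n x) * w ^ n) sums g x \<and> (g has_vector_derivative (\<Sum>i. f' i x)) (at x within {0..1})"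
    proof (rule has_vector_derivative_series[where ?x0.0 = 0])
      show "((\<lambda>x. complex_of_real (pd n x) * w ^ n) has_vector_derivative f' n x) (at x within {0..1})"
        if "x \<in> {0..1}" for n x
        unfolding f'_def using picard_derivs(2) that by (auto intro!: derivative_eq_intros has_vector_derivative_of_real simp: has_real_derivative_iff_has_vector_derivative)
      show "uniform_limit {0..1} (\<lambda>n x. \<Sum>i<n. f' i x) (\<lambda>x. \<Sum>i. f' i x) sequentially"
      proof (rule Weierstrass_m_test[of _ _ "\<lambda>n. case n of 0 \<Rightarrow> 0 | Suc m \<Rightarrow> norm w * M * B w m"])
        show "summable (\<lambda>n. case n of 0 \<Rightarrow> 0 | Suc m \<Rightarrow> norm w * M * B w m)"
          using sumB[of w] by (subst summable_Suc_iff[symmetric]) (simp add: summable_mult)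
        show "norm (f' n x) \<le> (case n of 0 \<Rightarrow> 0 | Suc m \<Rightarrow> norm w * M * B w m)" if x: "x \<in> {0..1}" for n x
        proof (cases n)
          case (Suc m)
          have "norm (f' n x) = norm w * \<bar>eta x\<bar> * norm (complex_of_real (pc m x) * w ^ m)"
            by (simp add: Suc f'S norm_mult del: picard.simps)
          also have "\<dots> \<le> norm w * M * B w m"
            using M(1) by (intro mult_mono M(2)[OF x] B(1)[OF x]) auto
          finally show ?thesis by (simp add: Suc)
        qed (simp add: f'0)
      qed
    qed (use sd[of 0] in auto)
    then obtain g where g: "\<And>x. x \<in> {0..1} \<Longrightarrow> (\<lambda>n. complex_of_real (pd n x) * w ^ n) sums g x"
      "\<And>x. x \<in> {0..1} \<Longrightarrow> (g has_vector_derivative (\<Sum>i. f' i x)) (at x within {0..1})" by blast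
    have "V w x = g x" if "x \<in> {0..1}" for x using g(1)[OF that] by (simp add: V_def sums_unique[symmetric])
    then have "(V w has_vector_derivative (\<Sum>i. f' i r)) (at r within {0..1})"
      by (rule has_vector_derivative_transform[OF r _ g(2)[OF r]])
    then show ?thesis unfolding lim[OF r] .
  qed
  define u v where "u k = U (- k\<^sup>2)" and "v k = V (- k\<^sup>2)" for k
  have "solves eta k (u k) (v k)" for k
    unfolding solves_def u_def v_def using dU dV[of _ "- k\<^sup>2"] by auto
  moreover have "u k 0 = of_real a \<and> v k 0 = of_real b" for k
  proof -
    have "pc n 0 = (if n = 0 then a else 0)" "pd n 0 = (if n = 0 then b else 0)" for n by (cases n; simp)+
    then have "(\<lambda>n. complex_of_real (pc n 0) * (- k\<^sup>2) ^ n) = (\<lambda>n. if n = 0 then complex_of_real a else 0)"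
      "(\<lambda>n. complex_of_real (pd n 0) * (- k\<^sup>2) ^ n) = (\<lambda>n. if n = 0 then complex_of_real b else 0)" by auto
    then show ?thesis
      unfolding u_def v_def U_def V_def
      using sums_single[of 0 "\<lambda>_. complex_of_real a"] sums_single[of 0 "\<lambda>_. complex_of_real b"] by (simp add: sums_iff)
  qed
  moreover have "(\<lambda>k. u k r) holomorphic_on UNIV \<and> (\<lambda>k. v k r) holomorphic_on UNIV" if r: "r \<in> {0..1}" for r
  proof -
    have "(\<lambda>w. U w r) field_differentiable (at w)" "(\<lambda>w. V w r) field_differentiable (at w)" for w
      unfolding U_def V_def field_differentiable_def
      using termdiffs_strong_converges_everywhere[OF sc[OF r], of w] termdiffs_strong_converges_everywhere[OF sd[OF r], of w] by blast+
    then have "(\<lambda>w. U w r) holomorphic_on UNIV" "(\<lambda>w. V w r) holomorphic_on UNIV"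
      by (auto simp: holomorphic_on_def)
    moreover have "(\<lambda>k::complex. - k\<^sup>2) holomorphic_on UNIV" by (intro holomorphic_intros)
    ultimately show ?thesis unfolding u_def v_def
      using holomorphic_on_compose_gen[unfolded o_def, of "\<lambda>k. - k\<^sup>2" UNIV "\<lambda>w. U w r" UNIV]
        holomorphic_on_compose_gen[unfolded o_def, of "\<lambda>k. - k\<^sup>2" UNIV "\<lambda>w. V w r" UNIV] by simp
  qed
  ultimately show ?thesis by (intro exI[of _ u] exI[of _ v]) simp
qed

end

text \<open>The initial point and the \<open>k\<close>-dependence of the data are free because
  \<open>y\<close> starts at 0, \<open>S\<close> at 1 with the data \<open>sinc\<close> and
  \<open>cos\<close>, and the transfer matrices at \<epsilon>. Wronskian coefficients built from the
  two basic families adjust the data at \<open>s\<close> and are themselves entire.\<close>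

lemma solution_family:
  assumes cont: "continuous_on {0..1} eta" and s: "s \<in> {0..1}"
    and al: "al holomorphic_on UNIV" and be: "be holomorphic_on UNIV"
  obtains u v where "\<And>k. solves eta k (u k) (v k)" "\<And>k. u k s = al k" "\<And>k. v k s = be k"
    "\<And>r. r \<in> {0..1} \<Longrightarrow> (\<lambda>k. u k r) holomorphic_on UNIV" "\<And>r. r \<in> {0..1} \<Longrightarrow> (\<lambda>k. v k r) holomorphic_on UNIV"
proof -
  obtain C C' where C0: "\<forall>k. solves eta k (C k) (C' k) \<and> C k 0 = of_real 1 \<and> C' k 0 = of_real 0"
    "\<forall>r\<in>{0..1}. (\<lambda>k. C k r) holomorphic_on UNIV \<and> (\<lambda>k. C' k r) holomorphic_on UNIV"
    using solution_family_real_data[OF cont, of 1 0] by (elim exE conjE)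
  have C: "\<And>k. solves eta k (C k) (C' k)" "\<And>k. C k 0 = 1" "\<And>k. C' k 0 = 0"
    "\<And>r. r \<in> {0..1} \<Longrightarrow> (\<lambda>k. C k r) holomorphic_on UNIV" "\<And>r. r \<in> {0..1} \<Longrightarrow> (\<lambda>k. C' k r) holomorphic_on UNIV"
    using C0 by simp_all
  obtain D D' where D0: "\<forall>k. solves eta k (D k) (D' k) \<and> D k 0 = of_real 0 \<and> D' k 0 = of_real 1"
    "\<forall>r\<in>{0..1}. (\<lambda>k. D k r) holomorphic_on UNIV \<and> (\<lambda>k. D' k r) holomorphic_on UNIV"
    using solution_family_real_data[OF cont, of 0 1] by (elim exE conjE)
  have D: "\<And>k. solves eta k (D k) (D' k)" "\<And>k. D k 0 = 0" "\<And>k. D' k 0 = 1"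
    "\<And>r. r \<in> {0..1} \<Longrightarrow> (\<lambda>k. D k r) holomorphic_on UNIV" "\<And>r. r \<in> {0..1} \<Longrightarrow> (\<lambda>k. D' k r) holomorphic_on UNIV"
    using D0 by simp_all
  have W: "C k s * D' k s - C' k s * D k s = 1" for k
    using wronskian_constant[OF C(1) D(1) s, of 0 k] C D by simp
  define c1 c2 where "c1 k = al k * D' k s - be k * D k s" and "c2 k = be k * C k s - al k * C' k s" for k
  have hc: "c1 holomorphic_on UNIV" "c2 holomorphic_on UNIV"
    unfolding c1_def c2_def by (intro holomorphic_intros C(4,5)[OF s] D(4,5)[OF s] al be)+
  show ?thesis
  proof (rule that[of "\<lambda>k r. c1 k * C k r + c2 k * D k r" "\<lambda>k r. c1 k * C' k r + c2 k * D' k r"])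
    show "solves eta k (\<lambda>r. c1 k * C k r + c2 k * D k r) (\<lambda>r. c1 k * C' k r + c2 k * D' k r)" for k
      by (rule solves_linear[OF C(1) D(1)])
    have "c1 k * C k s + c2 k * D k s = al k * (C k s * D' k s - C' k s * D k s)" for k
      by (simp add: c1_def c2_def algebra_simps)
    then show "c1 k * C k s + c2 k * D k s = al k" for k by (simp add: W)
    have "c1 k * C' k s + c2 k * D' k s = be k * (C k s * D' k s - C' k s * D k s)" for k
      by (simp add: c1_def c2_def algebra_simps)
    then show "c1 k * C' k s + c2 k * D' k s = be k" for k by (simp add: W)
  qed (intro holomorphic_intros hc C(4,5) D(4,5); assumption)+
qed

lemma solves_unique:
  assumes cont: "continuous_on {0..1} eta" and 1: "solves eta k u1 v1" and 2: "solves eta k u2 v2"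
    and s: "s \<in> {0..1}" and eq: "u1 s = u2 s" "v1 s = v2 s" and r: "r \<in> {0..1}"
  shows "u1 r = u2 r" "v1 r = v2 r"
proof -
  obtain C C' where C: "\<And>k. solves eta k (C k) (C' k)" "\<And>k. C k s = 1" "\<And>k. C' k s = 0"
    by (rule solution_family[OF cont s holomorphic_on_const[of 1] holomorphic_on_const[of 0]]) blast
  obtain D D' where D: "\<And>k. solves eta k (D k) (D' k)" "\<And>k. D k s = 0" "\<And>k. D' k s = 1"
    by (rule solution_family[OF cont s holomorphic_on_const[of 0] holomorphic_on_const[of 1]]) blast
  have W: "C k s * D' k s - C' k s * D k s = 1" by (simp add: C D)
  show "u1 r = u2 r" "v1 r = v2 r"
    using solves_by_fundamental[OF C(1) D(1) 1 s W r] solves_by_fundamental[OF C(1) D(1) 2 s W r] eq by auto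
qed

section \<open>Energy estimates and wave components\<close>

lemma nonpos_deriv_le:
  fixes f :: "real \<Rightarrow> real"
  assumes ab: "a \<le> b" "0 \<le> a" "b \<le> 1"
    and f: "\<And>r. r \<in> {a..b} \<Longrightarrow> (f has_real_derivative f' r) (at r within {0..1})"
    and le: "\<And>r. r \<in> {a..b} \<Longrightarrow> f' r \<le> 0"
  shows "f b \<le> f a"
proof -
  have "\<exists>x\<in>{a..b}. f b - f a = f' x * (b - a)"
  proof (rule mvt_very_simple[OF ab(1)])
    fix x assume "a \<le> x" "x \<le> b"
    then have "(f has_real_derivative f' x) (at x within {a..b})"
      using f[of x] ab by (auto intro: has_field_derivative_subset)
    then show "(f has_derivative (\<lambda>h. f' x * h)) (at x within {a..b})" by (simp add: has_field_derivative_def)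
  qed
  then obtain x where "x \<in> {a..b}" "f b - f a = f' x * (b - a)" by blast
  then show ?thesis using le[of x] ab mult_nonpos_nonneg[of "f' x" "b - a"] by auto
qed

lemma gronwall_le:
  fixes f w :: "real \<Rightarrow> real"
  assumes ab: "a \<le> b" "0 \<le> a" "b \<le> 1"
    and f: "\<And>r. r \<in> {a..b} \<Longrightarrow> (f has_real_derivative f' r) (at r within {0..1})"
    and w: "\<And>r. r \<in> {a..b} \<Longrightarrow> (w has_real_derivative w' r) (at r within {0..1})"
    and le: "\<And>r. r \<in> {a..b} \<Longrightarrow> f' r \<le> w' r * f r"
  shows "f b \<le> f a * exp (w b - w a)"
proof -
  have "f b * exp (- w b) \<le> f a * exp (- w a)"
  proof (rule nonpos_deriv_le[OF ab])
    fix r assume r: "r \<in> {a..b}"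
    show "((\<lambda>r. f r * exp (- w r)) has_real_derivative (f' r - w' r * f r) * exp (- w r)) (at r within {0..1})"
      by (auto intro!: derivative_eq_intros f[OF r] w[OF r] simp: algebra_simps)
    show "(f' r - w' r * f r) * exp (- w r) \<le> 0"
      using le[OF r] by (intro mult_nonpos_nonneg) auto
  qed
  then have "f b * exp (- w b) * exp (w b) \<le> f a * exp (- w a) * exp (w b)" by (intro mult_right_mono) auto
  then show ?thesis by (simp add: mult.assoc exp_add[symmetric] add.commute)
qed

lemma gronwall_ge:
  fixes f w :: "real \<Rightarrow> real"
  assumes ab: "a \<le> b" "0 \<le> a" "b \<le> 1"
    and f: "\<And>r. r \<in> {a..b} \<Longrightarrow> (f has_real_derivative f' r) (at r within {0..1})"
    and w: "\<And>r. r \<in> {a..b} \<Longrightarrow> (w has_real_derivative w' r) (at r within {0..1})"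
    and le: "\<And>r. r \<in> {a..b} \<Longrightarrow> w' r * f r \<le> f' r"
  shows "f a * exp (w b - w a) \<le> f b"
proof -
  have "- f b \<le> - f a * exp (w b - w a)"
    by (rule gronwall_le[OF ab _ w, of "\<lambda>r. - f r" "\<lambda>r. - f' r"]) (auto intro!: derivative_eq_intros f le)
  then show ?thesis by simp
qed

lemma gronwall_abs:
  fixes f w :: "real \<Rightarrow> real"
  assumes rs: "r \<in> {0..1}" "s \<in> {0..1}"
    and f: "\<And>r. r \<in> {0..1} \<Longrightarrow> (f has_real_derivative f' r) (at r within {0..1})"
    and w: "\<And>r. r \<in> {0..1} \<Longrightarrow> (w has_real_derivative w' r) (at r within {0..1})"
    and le: "\<And>r. r \<in> {0..1} \<Longrightarrow> \<bar>f' r\<bar> \<le> w' r * f r"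
    and nn: "f s \<ge> 0"
  shows "f r \<le> f s * exp \<bar>w r - w s\<bar>"
proof (cases "s \<le> r")
  case True
  have "f r \<le> f s * exp (w r - w s)"
    by (rule gronwall_le[OF True _ _ f w]) (use rs le in \<open>auto simp: abs_le_iff\<close>)
  also have "\<dots> \<le> f s * exp \<bar>w r - w s\<bar>" using nn by (intro mult_left_mono) auto
  finally show ?thesis .
next
  case False
  then have rs': "r \<le> s" by simp
  have "f r * exp (- w s - - w r) \<le> f s"
  proof (rule gronwall_ge[OF rs'])
    show "((\<lambda>r. - w r) has_real_derivative - w' t) (at t within {0..1})" if "t \<in> {r..s}" for t
      using that rs by (auto intro!: derivative_eq_intros w)
    show "- w' t * f t \<le> f' t" if "t \<in> {r..s}" for t
      using le[of t] that rs by (auto simp: abs_le_iff)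
  qed (use rs f in auto)
  then have "f r * exp (w r - w s) * exp (w s - w r) \<le> f s * exp (w s - w r)" by (intro mult_right_mono) auto
  then have "f r \<le> f s * exp (w s - w r)" by (simp add: mult.assoc exp_add[symmetric])
  also have "\<dots> \<le> f s * exp \<bar>w r - w s\<bar>" using nn by (intro mult_left_mono) auto
  finally show ?thesis .
qed

lemma exp_decay_below:
  fixes \<gamma> \<epsilon> C :: real
  assumes "\<gamma> > 0" "\<epsilon> > 0"
  obtains T where "T \<ge> 0" "\<And>\<tau>. \<tau> \<ge> T \<Longrightarrow> C * exp (- (\<gamma> * \<tau>)) < \<epsilon>"
proof (rule that[of "\<bar>C\<bar> / (\<epsilon> * \<gamma>)"])
  show "0 \<le> \<bar>C\<bar> / (\<epsilon> * \<gamma>)" using assms by simp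
  fix \<tau> assume "\<tau> \<ge> \<bar>C\<bar> / (\<epsilon> * \<gamma>)"
  then have "C \<le> \<epsilon> * (\<gamma> * \<tau>)" using assms by (simp add: field_simps)
  also have "\<dots> < \<epsilon> * exp (\<gamma> * \<tau>)"
    using assms exp_ge_add_one_self[of "\<gamma> * \<tau>"] by (intro mult_strict_left_mono) linarith+
  finally show "C * exp (- (\<gamma> * \<tau>)) < \<epsilon>" by (simp add: exp_minus field_simps)
qed

lemma exponent_le:
  fixes a b C :: real
  assumes "\<And>\<tau>. \<tau> \<ge> T \<Longrightarrow> exp (2 * \<tau> * a) \<le> C * exp (2 * \<tau> * b)"
  shows "a \<le> b"
proof (rule ccontr)
  assume "\<not> a \<le> b"
  then have "2 * (a - b) > 0" by simp
  then obtain T1 where T1: "T1 \<ge> 0" "\<And>\<tau>. \<tau> \<ge> T1 \<Longrightarrow> C * exp (- (2 * (a - b) * \<tau>)) < 1"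
    using exp_decay_below[of "2 * (a - b)" 1 C] by auto
  define \<tau> where "\<tau> = max T T1"
  have "exp (2 * \<tau> * a) \<le> C * exp (2 * \<tau> * b)" by (rule assms) (simp add: \<tau>_def)
  also have "\<dots> = C * exp (- (2 * (a - b) * \<tau>)) * exp (2 * \<tau> * a)"
    by (simp add: mult.assoc exp_add[symmetric] algebra_simps)
  also have "\<dots> < 1 * exp (2 * \<tau> * a)" using T1(2)[of \<tau>] by (intro mult_strict_right_mono) (auto simp: \<tau>_def)
  finally show False by simp
qed

lemma has_vector_derivative_cis:
  assumes "(f has_real_derivative f') (at r within S)"
  shows "((\<lambda>r. cis (f r)) has_vector_derivative \<i> * of_real f' * cis (f r)) (at r within S)"
  unfolding has_vector_derivative_complex_iff by (auto intro!: derivative_eq_intros assms)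

lemma has_real_derivative_norm_square:
  fixes u :: "real \<Rightarrow> complex"
  assumes "(u has_vector_derivative v) (at r within S)"
  shows "((\<lambda>r. (norm (u r))\<^sup>2) has_real_derivative 2 * (u r \<bullet> v)) (at r within S)"
proof -
  have "((\<lambda>r. u r \<bullet> u r) has_derivative (\<lambda>h. u r \<bullet> (h *\<^sub>R v) + (h *\<^sub>R v) \<bullet> u r)) (at r within S)"
    using assms unfolding has_vector_derivative_def by (intro has_derivative_inner)
  then show ?thesis
    unfolding has_field_derivative_def power2_norm_eq_inner
    by (rule has_derivative_eq_rhs) (simp add: fun_eq_iff inner_commute algebra_simps)
qed

lemma inner_of_real_mult: "(x::complex) \<bullet> (of_real c * y) = c * (x \<bullet> y)"
  by (simp add: inner_complex_def algebra_simps)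

text \<open>The weight \<open>1 + (norm k)\<^sup>2\<close> in place of
  \<open>(norm k)\<^sup>2\<close> lets the energy control \<open>u\<close> at \<open>k = 0\<close>
  as well, so a single Gronwall estimate covers the whole plane.\<close>

lemma solves_exp_bound:
  assumes sol: "solves eta k u v" and M: "\<And>x. x \<in> {0..1} \<Longrightarrow> \<bar>eta x\<bar> \<le> M" and r: "r \<in> {0..1}" and s: "s \<in> {0..1}"
  shows "(norm (v r))\<^sup>2 + (1 + (norm k)\<^sup>2) * (norm (u r))\<^sup>2
    \<le> ((norm (v s))\<^sup>2 + (1 + (norm k)\<^sup>2) * (norm (u s))\<^sup>2) * exp ((M + 1) * (1 + norm k))"
proof -
  have M0: "M \<ge> 0" using M[of 0] by simp
  define \<kappa> where "\<kappa> = sqrt (1 + (norm k)\<^sup>2)"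
  have \<kappa>: "\<kappa>\<^sup>2 = 1 + (norm k)\<^sup>2" "\<kappa> \<ge> 0" by (simp_all add: \<kappa>_def add_nonneg_nonneg)
  have \<kappa>1: "\<kappa> \<le> 1 + norm k" unfolding \<kappa>_def by (rule real_le_lsqrt) (auto simp: power2_eq_square algebra_simps)
  define f where "f r = (norm (v r))\<^sup>2 + \<kappa>\<^sup>2 * (norm (u r))\<^sup>2" for r
  define f' where "f' r = 2 * (v r \<bullet> (- (k\<^sup>2 * complex_of_real (eta r) * u r))) + \<kappa>\<^sup>2 * (2 * (u r \<bullet> v r))" for r
  have "f r \<le> f s * exp \<bar>(M + 1) * \<kappa> * r - (M + 1) * \<kappa> * s\<bar>"
  proof (rule gronwall_abs[OF r s])
    fix t :: real assume t: "t \<in> {0..1}"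
    note D = solvesD[OF sol t]
    show "(f has_real_derivative f' t) (at t within {0..1})" unfolding f_def f'_def
      by (intro DERIV_add DERIV_cmult has_real_derivative_norm_square D)
    show "((\<lambda>t. (M + 1) * \<kappa> * t) has_real_derivative (M + 1) * \<kappa>) (at t within {0..1})"
      by (auto intro!: derivative_eq_intros)
    have "\<bar>v t \<bullet> (- (k\<^sup>2 * complex_of_real (eta t) * u t))\<bar> \<le> norm (v t) * norm (- (k\<^sup>2 * complex_of_real (eta t) * u t))"
      by (rule Cauchy_Schwarz_ineq2)
    also have "\<dots> = (norm (v t) * norm (u t)) * ((norm k)\<^sup>2 * \<bar>eta t\<bar>)" by (simp add: norm_mult norm_power mult_ac)
    also have "\<dots> \<le> (norm (v t) * norm (u t)) * (\<kappa>\<^sup>2 * M)"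
      using M[OF t] M0 unfolding \<kappa>(1) by (intro mult_left_mono mult_mono) auto
    finally have 1: "\<bar>v t \<bullet> (- (k\<^sup>2 * complex_of_real (eta t) * u t))\<bar> \<le> (norm (v t) * norm (u t)) * (\<kappa>\<^sup>2 * M)" .
    have "\<bar>u t \<bullet> v t\<bar> \<le> norm (v t) * norm (u t)" using Cauchy_Schwarz_ineq2[of "u t" "v t"] by (simp add: mult.commute)
    then have 2: "\<bar>\<kappa>\<^sup>2 * (u t \<bullet> v t)\<bar> \<le> \<kappa>\<^sup>2 * (norm (v t) * norm (u t))" by (simp add: abs_mult mult_left_mono)
    have "\<bar>f' t\<bar> \<le> 2 * ((norm (v t) * norm (u t)) * (\<kappa>\<^sup>2 * M)) + 2 * (\<kappa>\<^sup>2 * (norm (v t) * norm (u t)))"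
      unfolding f'_def using 1 2 by linarith
    also have "\<dots> = (M + 1) * \<kappa> * (2 * norm (v t) * (\<kappa> * norm (u t)))" by (simp add: power2_eq_square algebra_simps)
    also have "\<dots> \<le> (M + 1) * \<kappa> * f t"
    proof (rule mult_left_mono)
      show "2 * norm (v t) * (\<kappa> * norm (u t)) \<le> f t"
        using sum_squares_bound[of "norm (v t)" "\<kappa> * norm (u t)"] by (simp add: f_def power_mult_distrib)
    qed (use M0 \<kappa> in auto)
    finally show "\<bar>f' t\<bar> \<le> (M + 1) * \<kappa> * f t" .
  qed (auto simp: f_def)
  also have "\<dots> \<le> f s * exp ((M + 1) * (1 + norm k))"
  proof -
    have "\<bar>(M + 1) * \<kappa> * r - (M + 1) * \<kappa> * s\<bar> = (M + 1) * \<kappa> * \<bar>r - s\<bar>"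
      using M0 \<kappa> by (simp add: right_diff_distrib[symmetric] abs_mult)
    also have "\<dots> \<le> (M + 1) * (1 + norm k) * 1" using M0 \<kappa>(2) \<kappa>1 r s by (intro mult_mono) auto
    finally show ?thesis by (intro mult_left_mono) (auto simp: f_def)
  qed
  finally show ?thesis by (simp add: f_def \<kappa>(1))
qed

section \<open>A medium: travel time and energy estimates on both axes\<close>

locale medium =
  fixes \<eta> \<eta>1 \<eta>2 :: "real \<Rightarrow> real"
  assumes pos: "\<And>x. x \<in> {0..1} \<Longrightarrow> \<eta> x > 0"
    and d1: "\<And>x. x \<in> {0..1} \<Longrightarrow> (\<eta> has_real_derivative \<eta>1 x) (at x within {0..1})"
    and d2: "\<And>x. x \<in> {0..1} \<Longrightarrow> (\<eta>1 has_real_derivative \<eta>2 x) (at x within {0..1})"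
    and c2: "continuous_on {0..1} \<eta>2"
begin

definition g :: "real \<Rightarrow> real" where "g r = sqrt (\<eta> r)"
text \<open>Half the logarithmic derivative of \<open>g\<close>. It is the coupling between the two
  wave components, that is, the local reflection density.\<close>

definition h :: "real \<Rightarrow> real" where "h r = \<eta>1 r / (4 * \<eta> r)"
text \<open>Travel time from 0, the Liouville variable. Exponential rates and frequencies of
  solutions are measured in it.\<close>

definition X :: "real \<Rightarrow> real" where "X r = integral {0..r} g"

lemma c0: "continuous_on {0..1} \<eta>" and c1: "continuous_on {0..1} \<eta>1"
  using d1 d2 by (meson has_field_derivative_imp_has_derivative has_derivative_continuous continuous_on_eq_continuous_within)+

lemma g_pos: "x \<in> {0..1} \<Longrightarrow> g x > 0" using pos by (simp add: g_def)
lemma g_sq: "x \<in> {0..1} \<Longrightarrow> (g x)\<^sup>2 = \<eta> x" using pos[of x] by (simp add: g_def)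
lemma cg: "continuous_on {0..1} g" unfolding g_def by (intro continuous_intros c0)
lemma ch: "continuous_on {0..1} h" unfolding h_def using pos by (intro continuous_intros c0 c1) force

lemma dg: "x \<in> {0..1} \<Longrightarrow> (g has_real_derivative 2 * h x * g x) (at x within {0..1})"
proof -
  assume x: "x \<in> {0..1}"
  have "(g has_real_derivative (inverse (sqrt (\<eta> x)) / 2) * \<eta>1 x) (at x within {0..1})"
    unfolding g_def[abs_def]
    by (rule DERIV_chain2[where f = sqrt, OF _ d1[OF x]]) (use DERIV_real_sqrt[OF pos[OF x]] in auto)
  moreover have "(inverse (sqrt (\<eta> x)) / 2) * \<eta>1 x = 2 * h x * g x"
    using g_pos[OF x] g_sq[OF x] unfolding h_def g_sq[OF x, symmetric] g_def[symmetric]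
    by (simp add: field_simps power2_eq_square)
  ultimately show ?thesis by (simp only:)
qed

lemma dX: "x \<in> {0..1} \<Longrightarrow> (X has_real_derivative g x) (at x within {0..1})"
  unfolding X_def[abs_def] by (rule integral_has_real_derivative[OF cg])

lemma X_diff: "0 \<le> r \<Longrightarrow> r \<le> s \<Longrightarrow> s \<le> 1 \<Longrightarrow> X s - X r = integral {r..s} g"
  unfolding X_def using Henstock_Kurzweil_Integration.integral_combine[of 0 r s g]
    integrable_continuous_real[OF continuous_on_subset[OF cg, of "{0..s}"]] by auto

lemma X_mono_strict:
  assumes "0 \<le> r" "r < s" "s \<le> 1"
  shows "X r < X s"
proof -
  have "\<exists>x\<in>{r<..<s}. X s - X r = g x * (s - r)"
  proof (rule mvt_simple[OF assms(2)])
    fix x assume "r \<le> x" "x \<le> s"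
    then have "(X has_real_derivative g x) (at x within {r..s})"
      using dX[of x] assms by (auto intro: has_field_derivative_subset)
    then show "(X has_derivative (\<lambda>h. g x * h)) (at x within {r..s})" by (simp add: has_field_derivative_def)
  qed
  then obtain x where x: "x \<in> {r<..<s}" "X s - X r = g x * (s - r)" by blast
  then have "g x * (s - r) > 0" using g_pos[of x] assms by (intro mult_pos_pos) auto
  with x show ?thesis by simp
qed

lemma X_mono: "0 \<le> r \<Longrightarrow> r \<le> s \<Longrightarrow> s \<le> 1 \<Longrightarrow> X r \<le> X s"
  using X_mono_strict[of r s] by (cases "r = s") auto

lemma cX: "continuous_on {0..1} X"
  using dX by (meson has_field_derivative_imp_has_derivative has_derivative_continuous continuous_on_eq_continuous_within)

lemma bounds_exist:
  "\<exists>B>0. \<forall>x\<in>{0..1}. \<bar>h x\<bar> \<le> B" "\<exists>B>0. \<forall>x\<in>{0..1}. B \<le> g x" "\<exists>B>0. \<forall>x\<in>{0..1}. g x \<le> B"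
proof -
  have "bounded (h ` {0..1})" using ch by (intro compact_imp_bounded compact_continuous_image) auto
  then show "\<exists>B>0. \<forall>x\<in>{0..1}. \<bar>h x\<bar> \<le> B" unfolding bounded_pos by auto
  have "bounded (g ` {0..1})" using cg by (intro compact_imp_bounded compact_continuous_image) auto
  then show "\<exists>B>0. \<forall>x\<in>{0..1}. g x \<le> B" unfolding bounded_pos by (auto simp: abs_le_iff)
  obtain x where "x \<in> {0..1}" "\<And>y. y \<in> {0..1} \<Longrightarrow> g x \<le> g y"
    using continuous_attains_inf[OF _ _ cg] by auto
  then show "\<exists>B>0. \<forall>x\<in>{0..1}. B \<le> g x" using g_pos[of x] by blast
qed

text \<open>Bounds are named once, so that later constants visibly depend on the medium alone and
  not on \<open>k\<close> or on the solution.\<close>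

definition "H = (SOME B. B > 0 \<and> (\<forall>x\<in>{0..1}. \<bar>h x\<bar> \<le> B))"
definition "gmin = (SOME B. B > 0 \<and> (\<forall>x\<in>{0..1}. B \<le> g x))"
definition "gmax = (SOME B. B > 0 \<and> (\<forall>x\<in>{0..1}. g x \<le> B))"

lemma H: "H > 0" "x \<in> {0..1} \<Longrightarrow> \<bar>h x\<bar> \<le> H"
  using someI_ex[OF bounds_exist(1)[unfolded Bex_def]] unfolding H_def by auto
lemma gmin: "gmin > 0" "x \<in> {0..1} \<Longrightarrow> gmin \<le> g x"
  using someI_ex[OF bounds_exist(2)[unfolded Bex_def]] unfolding gmin_def by auto
lemma gmax: "gmax > 0" "x \<in> {0..1} \<Longrightarrow> g x \<le> gmax"
  using someI_ex[OF bounds_exist(3)[unfolded Bex_def]] unfolding gmax_def by auto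

lemma eta1_bound: "x \<in> {0..1} \<Longrightarrow> \<bar>\<eta>1 x\<bar> \<le> 4 * H * (g x)\<^sup>2"
  using H(2)[of x] pos[of x] by (simp add: h_def g_sq abs_mult field_simps)

text \<open>For real \<open>k\<close> the cross terms cancel and only \<open>\<eta>1\<close> drives
  the energy. As \<open>\<bar>\<eta>1\<bar>\<close> is at most \<open>4 * H * \<eta>\<close>, the
  Gronwall rate is independent of \<open>k\<close>.\<close>

lemma energy_real_axis:
  assumes sol: "solves \<eta> (of_real k) u v" and r: "r \<in> {0..1}" and s: "s \<in> {0..1}"
  shows "(norm (v r))\<^sup>2 + (k * g r * norm (u r))\<^sup>2 \<le> ((norm (v s))\<^sup>2 + (k * g s * norm (u s))\<^sup>2) * exp (4 * H)"
proof -
  define f where "f r = (norm (v r))\<^sup>2 + k\<^sup>2 * \<eta> r * (norm (u r))\<^sup>2" for r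
  define f' where "f' r = k\<^sup>2 * \<eta>1 r * (norm (u r))\<^sup>2" for r
  have feq: "f r = (norm (v r))\<^sup>2 + (k * g r * norm (u r))\<^sup>2" if "r \<in> {0..1}" for r
    using g_sq[OF that] by (simp add: f_def power_mult_distrib)
  have "f r \<le> f s * exp \<bar>4 * H * r - 4 * H * s\<bar>"
  proof (rule gronwall_abs[OF r s])
    fix t :: real assume t: "t \<in> {0..1}"
    note D = solvesD[OF sol t]
    have e: "- ((complex_of_real k)\<^sup>2 * complex_of_real (\<eta> t) * u t) = of_real (- (k\<^sup>2 * \<eta> t)) * u t" by simp
    show "(f has_real_derivative f' t) (at t within {0..1})" unfolding f_def
      by (rule derivative_eq_intros has_real_derivative_norm_square D d1 t refl)+
        (simp only: e inner_of_real_mult, simp add: f'_def inner_commute algebra_simps)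
    show "((\<lambda>t. 4 * H * t) has_real_derivative 4 * H) (at t within {0..1})" by (auto intro!: derivative_eq_intros)
    have "\<bar>f' t\<bar> = \<bar>\<eta>1 t\<bar> * (k\<^sup>2 * (norm (u t))\<^sup>2)" by (simp add: f'_def abs_mult mult_ac)
    also have "\<dots> \<le> 4 * H * (g t)\<^sup>2 * (k\<^sup>2 * (norm (u t))\<^sup>2)" using eta1_bound[OF t] by (intro mult_right_mono) auto
    also have "\<dots> \<le> 4 * H * f t" using H(1) by (simp add: f_def g_sq[OF t] algebra_simps)
    finally show "\<bar>f' t\<bar> \<le> 4 * H * f t" .
  qed (use pos[OF s] in \<open>auto simp: f_def\<close>)
  also have "\<dots> \<le> f s * exp (4 * H)"
  proof -
    have "\<bar>4 * H * r - 4 * H * s\<bar> = 4 * H * \<bar>r - s\<bar>"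
      using H(1) by (simp add: right_diff_distrib[symmetric] abs_mult)
    also have "\<dots> \<le> 4 * H * 1" using H(1) r s by (intro mult_left_mono) auto
    finally show ?thesis using pos[OF s] by (intro mult_left_mono) (auto simp: f_def)
  qed
  finally show ?thesis unfolding feq[OF r] feq[OF s] .
qed

text \<open>For \<open>k = \<i>\<tau>\<close> the cross terms add up instead and contribute at most
  \<open>2 * \<tau> * g\<close> times the energy; integrating \<open>g\<close> turns this into
  travel time.\<close>

lemma energy_imag_axis:
  assumes sol: "solves \<eta> (\<i> * of_real \<tau>) u v" and \<tau>: "\<tau> \<ge> 0" and r: "r \<in> {0..1}" and s: "s \<in> {0..1}"
  shows "(norm (v r))\<^sup>2 + (\<tau> * g r * norm (u r))\<^sup>2
    \<le> ((norm (v s))\<^sup>2 + (\<tau> * g s * norm (u s))\<^sup>2) * exp (4 * H + 2 * \<tau> * \<bar>X r - X s\<bar>)"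
proof -
  define f where "f r = (norm (v r))\<^sup>2 + \<tau>\<^sup>2 * \<eta> r * (norm (u r))\<^sup>2" for r
  define f' where "f' r = \<tau>\<^sup>2 * \<eta>1 r * (norm (u r))\<^sup>2 + 4 * \<tau>\<^sup>2 * \<eta> r * (u r \<bullet> v r)" for r
  have feq: "f r = (norm (v r))\<^sup>2 + (\<tau> * g r * norm (u r))\<^sup>2" if "r \<in> {0..1}" for r
    using g_sq[OF that] by (simp add: f_def power_mult_distrib)
  have "f r \<le> f s * exp \<bar>(4 * H * r + 2 * \<tau> * X r) - (4 * H * s + 2 * \<tau> * X s)\<bar>"
  proof (rule gronwall_abs[OF r s])
    fix t :: real assume t: "t \<in> {0..1}"
    note D = solvesD[OF sol t]
    have e: "- ((\<i> * complex_of_real \<tau>)\<^sup>2 * complex_of_real (\<eta> t) * u t) = of_real (\<tau>\<^sup>2 * \<eta> t) * u t"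
      by (simp add: power_mult_distrib)
    show "(f has_real_derivative f' t) (at t within {0..1})" unfolding f_def
      by (rule derivative_eq_intros has_real_derivative_norm_square D d1 t refl)+
        (simp only: e inner_of_real_mult, simp add: f'_def inner_commute algebra_simps)
    show "((\<lambda>t. 4 * H * t + 2 * \<tau> * X t) has_real_derivative (4 * H + 2 * \<tau> * g t)) (at t within {0..1})"
      by (auto intro!: derivative_eq_intros dX t)
    have "\<bar>\<tau>\<^sup>2 * \<eta>1 t * (norm (u t))\<^sup>2\<bar> = \<bar>\<eta>1 t\<bar> * (\<tau>\<^sup>2 * (norm (u t))\<^sup>2)" by (simp add: abs_mult mult_ac)
    also have "\<dots> \<le> 4 * H * (g t)\<^sup>2 * (\<tau>\<^sup>2 * (norm (u t))\<^sup>2)" using eta1_bound[OF t] by (intro mult_right_mono) auto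
    also have "\<dots> \<le> 4 * H * f t" using H(1) by (simp add: f_def g_sq[OF t] algebra_simps)
    finally have 1: "\<bar>\<tau>\<^sup>2 * \<eta>1 t * (norm (u t))\<^sup>2\<bar> \<le> 4 * H * f t" .
    have "\<bar>4 * \<tau>\<^sup>2 * \<eta> t * (u t \<bullet> v t)\<bar> = 4 * \<tau>\<^sup>2 * \<eta> t * \<bar>u t \<bullet> v t\<bar>" using pos[OF t] by (simp add: abs_mult)
    also have "\<dots> \<le> 4 * \<tau>\<^sup>2 * \<eta> t * (norm (u t) * norm (v t))"
      using pos[OF t] by (intro mult_left_mono Cauchy_Schwarz_ineq2) auto
    also have "\<dots> = 2 * \<tau> * g t * (2 * norm (v t) * (\<tau> * g t * norm (u t)))"
      by (simp add: g_sq[OF t, symmetric] power2_eq_square)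
    also have "\<dots> \<le> 2 * \<tau> * g t * f t"
      unfolding feq[OF t] using \<tau> g_pos[OF t] by (intro mult_left_mono sum_squares_bound) auto
    finally have 2: "\<bar>4 * \<tau>\<^sup>2 * \<eta> t * (u t \<bullet> v t)\<bar> \<le> 2 * \<tau> * g t * f t" .
    show "\<bar>f' t\<bar> \<le> (4 * H + 2 * \<tau> * g t) * f t"
      unfolding f'_def using 1 2 by (simp add: distrib_right)
  qed (use pos[OF s] in \<open>auto simp: f_def\<close>)
  also have "\<dots> \<le> f s * exp (4 * H + 2 * \<tau> * \<bar>X r - X s\<bar>)"
  proof -
    have "\<bar>4 * H * r - 4 * H * s\<bar> = 4 * H * \<bar>r - s\<bar>"
      using H(1) by (simp add: right_diff_distrib[symmetric] abs_mult)
    also have "\<dots> \<le> 4 * H * 1" using H(1) r s by (intro mult_left_mono) auto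
    finally have "\<bar>4 * H * r - 4 * H * s\<bar> \<le> 4 * H" by simp
    moreover have "\<bar>2 * \<tau> * X r - 2 * \<tau> * X s\<bar> = 2 * \<tau> * \<bar>X r - X s\<bar>"
      using \<tau> by (simp add: right_diff_distrib[symmetric] abs_mult)
    ultimately have "\<bar>(4 * H * r + 2 * \<tau> * X r) - (4 * H * s + 2 * \<tau> * X s)\<bar> \<le> 4 * H + 2 * \<tau> * \<bar>X r - X s\<bar>" by linarith
    then show ?thesis using pos[OF s] by (intro mult_left_mono) (auto simp: f_def)
  qed
  finally show ?thesis unfolding feq[OF r] feq[OF s] .
qed

end

section \<open>Wave components on the imaginary axis: cones, growth and reflection\<close>

lemma norm_add_imaginary_le:
  assumes "(norm (a::complex))\<^sup>2 + x\<^sup>2 \<le> M\<^sup>2" "M \<ge> 0" "norm b = \<bar>x\<bar>"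
  shows "norm (a + b) \<le> 2 * M" "norm (a - b) \<le> 2 * M"
proof -
  have "(norm a)\<^sup>2 \<le> M\<^sup>2" "x\<^sup>2 \<le> M\<^sup>2" using assms(1) zero_le_power2[of x] zero_le_power2[of "norm a"] by linarith+
  then have "norm a \<le> M" "\<bar>x\<bar> \<le> M" using assms(2) power2_le_imp_le[of "norm a" M] power2_le_imp_le[of "\<bar>x\<bar>" M] by auto
  then show "norm (a + b) \<le> 2 * M" "norm (a - b) \<le> 2 * M"
    using norm_triangle_ineq[of a b] norm_triangle_ineq4[of a b] assms(3) by auto
qed

text \<open>In the components \<open>p = v + t u\<close>, \<open>n = v - t u\<close> the Wronskian
  is \<open>n1 p2 - p1 n2\<close>. Its two products have different sizes when the solutions lie in
  opposite cones, so it can be bounded below.\<close>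

lemma wave_wronskian:
  assumes "Im u1 = 0" "Im v1 = 0" "Im u2 = 0" "Im v2 = 0"
  shows "2 * of_real t * (v1 * u2 - u1 * v2) = complex_of_real ((Re v1 - t * Re u1) * (Re v2 + t * Re u2) - (Re v1 + t * Re u1) * (Re v2 - t * Re u2))"
  using assms by (simp add: complex_eq_iff algebra_simps)

context medium
begin

text \<open>On the imaginary axis \<open>k = \<i>\<tau>\<close> a real solution is described by
  \<open>p = u' + \<tau> g u\<close> and \<open>n = u' - \<tau> g u\<close>, which to leading order grow and decay with \<open>r\<close>.\<close>
definition wave_pair :: "real \<Rightarrow> (real \<Rightarrow> real) \<Rightarrow> (real \<Rightarrow> real) \<Rightarrow> bool" where
  "wave_pair \<tau> p n \<longleftrightarrow> (\<forall>r\<in>{0..1}.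
     (p has_real_derivative \<tau> * g r * p r + h r * (p r - n r)) (at r within {0..1}) \<and>
     (n has_real_derivative - (\<tau> * g r * n r) - h r * (p r - n r)) (at r within {0..1}))"

lemma solves_imp_wave_pair:
  assumes sol: "solves \<eta> (\<i> * of_real \<tau>) u v"
  shows "wave_pair \<tau> (\<lambda>r. Re (v r) + \<tau> * g r * Re (u r)) (\<lambda>r. Re (v r) - \<tau> * g r * Re (u r))"
  unfolding wave_pair_def
proof (intro ballI conjI)
  fix r :: real assume r: "r \<in> {0..1}"
  have u: "((\<lambda>r. Re (u r)) has_real_derivative Re (v r)) (at r within {0..1})"
    using solvesD(1)[OF sol r] unfolding has_vector_derivative_complex_iff by blast
  have v: "((\<lambda>r. Re (v r)) has_real_derivative \<tau>\<^sup>2 * (g r)\<^sup>2 * Re (u r)) (at r within {0..1})"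
    using solvesD(2)[OF sol r] unfolding has_vector_derivative_complex_iff
    by (simp add: power_mult_distrib g_sq[OF r])
  show "((\<lambda>r. Re (v r) + \<tau> * g r * Re (u r)) has_real_derivative
      \<tau> * g r * (Re (v r) + \<tau> * g r * Re (u r)) + h r * (Re (v r) + \<tau> * g r * Re (u r) - (Re (v r) - \<tau> * g r * Re (u r))))
      (at r within {0..1})"
    by (rule derivative_eq_intros u v dg r refl)+ (simp add: algebra_simps power2_eq_square)
  show "((\<lambda>r. Re (v r) - \<tau> * g r * Re (u r)) has_real_derivative
      - (\<tau> * g r * (Re (v r) - \<tau> * g r * Re (u r))) - h r * (Re (v r) + \<tau> * g r * Re (u r) - (Re (v r) - \<tau> * g r * Re (u r))))
      (at r within {0..1})"
    by (rule derivative_eq_intros u v dg r refl)+ (simp add: algebra_simps power2_eq_square)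
qed

text \<open>\<open>k\<^sup>2 = - \<tau>\<^sup>2\<close> is real, so conjugation maps the solution to
  one with the same data at \<open>s\<close>, and uniqueness applies.\<close>

lemma solves_real_on_imag_axis:
  assumes sol: "solves \<eta> (\<i> * of_real \<tau>) u v" and s: "s \<in> {0..1}" and im: "Im (u s) = 0" "Im (v s) = 0"
    and r: "r \<in> {0..1}"
  shows "Im (u r) = 0" "Im (v r) = 0"
proof -
  have "solves \<eta> (\<i> * of_real \<tau>) (\<lambda>r. cnj (u r)) (\<lambda>r. cnj (v r))"
    unfolding solves_def
  proof (intro ballI conjI)
    fix t :: real assume t: "t \<in> {0..1}"
    show "((\<lambda>r. cnj (u r)) has_vector_derivative cnj (v t)) (at t within {0..1})"
      by (rule has_vector_derivative_cnj[OF solvesD(1)[OF sol t]])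
    show "((\<lambda>r. cnj (v r)) has_vector_derivative - ((\<i> * of_real \<tau>)\<^sup>2 * of_real (\<eta> t) * cnj (u t))) (at t within {0..1})"
      using has_vector_derivative_cnj[OF solvesD(2)[OF sol t]] by (simp add: power_mult_distrib)
  qed
  from solves_unique[OF c0 sol this s _ _ r] im have "u r = cnj (u r)" "v r = cnj (v r)"
    by (auto simp: complex_eq_iff)
  then show "Im (u r) = 0" "Im (v r) = 0" by (auto simp: complex_eq_iff)
qed

lemma wave_pairD:
  assumes "wave_pair \<tau> p n" "r \<in> {0..1}"
  shows "(p has_real_derivative \<tau> * g r * p r + h r * (p r - n r)) (at r within {0..1})"
    "(n has_real_derivative - (\<tau> * g r * n r) - h r * (p r - n r)) (at r within {0..1})"
  using assms by (auto simp: wave_pair_def)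

text \<open>Apart from the coupling \<open>h\<close>, \<open>n\<close> decays and \<open>p\<close>
  grows, so the form decreases; the coupling costs at most \<open>6 * H\<close> times
  \<open>n\<^sup>2 + c p\<^sup>2\<close>, whence the condition on \<tau>. The cone where
  \<open>p\<close> dominates is thus preserved outwards, the one where \<open>n\<close> dominates
  inwards. The values 1/4, 1 and 4 of \<open>c\<close> are used.\<close>

lemma cone_antitone:
  assumes w: "wave_pair \<tau> p n" and \<tau>: "\<tau> * gmin \<ge> 6 * H" and c: "1/4 \<le> c" "c \<le> 4"
    and rs: "0 \<le> s" "s \<le> r" "r \<le> 1"
  shows "(n r)\<^sup>2 - c * (p r)\<^sup>2 \<le> (n s)\<^sup>2 - c * (p s)\<^sup>2"
proof (rule nonpos_deriv_le[OF rs(2) rs(1) rs(3)])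
  fix t assume "t \<in> {s..r}"
  then have t: "t \<in> {0..1}" using rs by auto
  show "((\<lambda>r. (n r)\<^sup>2 - c * (p r)\<^sup>2) has_real_derivative
     - 2 * (\<tau> * g t * ((n t)\<^sup>2 + c * (p t)\<^sup>2) + h t * ((p t - n t) * (n t + c * p t)))) (at t within {0..1})"
    by (rule derivative_eq_intros wave_pairD[OF w t] refl)+ (simp add: algebra_simps power2_eq_square)
  define Q where "Q = (n t)\<^sup>2 + c * (p t)\<^sup>2"
  have Q: "Q \<ge> 0" using c by (simp add: Q_def)
  have pn: "\<bar>p t\<bar> * \<bar>n t\<bar> \<le> Q"
  proof -
    have "\<bar>p t\<bar> * \<bar>n t\<bar> \<le> (n t)\<^sup>2 + 1/4 * (p t)\<^sup>2"
      using sum_squares_bound[of "\<bar>n t\<bar>" "1/2 * \<bar>p t\<bar>"] by (simp add: power_mult_distrib power2_eq_square algebra_simps)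
    also have "\<dots> \<le> Q" unfolding Q_def using c by (intro add_left_mono mult_right_mono) auto
    finally show ?thesis .
  qed
  have "\<bar>(p t - n t) * (n t + c * p t)\<bar> \<le> (\<bar>p t\<bar> + \<bar>n t\<bar>) * (\<bar>n t\<bar> + c * \<bar>p t\<bar>)"
    unfolding abs_mult using c by (intro mult_mono order_trans[OF abs_triangle_ineq4] order_trans[OF abs_triangle_ineq]) (auto simp: abs_mult)
  also have "\<dots> = Q + (1 + c) * (\<bar>p t\<bar> * \<bar>n t\<bar>)"
    by (simp add: Q_def algebra_simps power2_eq_square)
  also have "\<dots> \<le> Q + 5 * Q" using pn c Q by (intro add_left_mono mult_mono) auto
  finally have 1: "\<bar>(p t - n t) * (n t + c * p t)\<bar> \<le> 6 * Q" by simp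
  have "\<bar>h t * ((p t - n t) * (n t + c * p t))\<bar> \<le> H * (6 * Q)"
    unfolding abs_mult[of "h t"] using H(2)[OF t] 1 H(1) by (intro mult_mono) auto
  also have "\<dots> \<le> \<tau> * gmin * Q" using mult_right_mono[OF \<tau> Q] by (simp add: mult_ac)
  also have "\<dots> \<le> \<tau> * g t * Q"
  proof -
    have "\<tau> * gmin \<ge> 0" using \<tau> H(1) by linarith
    then have "\<tau> \<ge> 0" using gmin(1) by (simp add: zero_le_mult_iff)
    then show ?thesis using gmin(2)[OF t] Q by (intro mult_right_mono mult_left_mono) auto
  qed
  finally have "- (h t * ((p t - n t) * (n t + c * p t))) \<le> \<tau> * g t * Q" by (simp only: abs_le_iff)
  then have "\<tau> * g t * Q + h t * ((p t - n t) * (n t + c * p t)) \<ge> 0" by linarith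
  then show "- 2 * (\<tau> * g t * ((n t)\<^sup>2 + c * (p t)\<^sup>2) + h t * ((p t - n t) * (n t + c * p t))) \<le> 0"
    unfolding Q_def by (intro mult_nonpos_nonneg) auto
qed

text \<open>Squares are used because the sign of \<open>p\<close> is unknown. Inside the cone the
  coupling changes the rate of the square by at most \<open>2 * (1 + B) * H\<close>.\<close>

lemma p_square_growth:
  assumes w: "wave_pair \<tau> p n" and rs: "0 \<le> s" "s \<le> r" "r \<le> 1"
    and B: "B \<ge> 0" "\<And>t. t \<in> {s..r} \<Longrightarrow> \<bar>n t\<bar> \<le> B * \<bar>p t\<bar>"
  shows "(p s)\<^sup>2 * exp (2 * \<tau> * (X r - X s) - 2 * (1 + B) * H) \<le> (p r)\<^sup>2"
proof -
  define W where "W t = 2 * \<tau> * X t - 2 * (1 + B) * H * t" for t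
  have "(p s)\<^sup>2 * exp (W r - W s) \<le> (p r)\<^sup>2"
  proof (rule gronwall_ge[OF rs(2) rs(1) rs(3)])
    fix t assume tt: "t \<in> {s..r}"
    then have t: "t \<in> {0..1}" using rs by auto
    show "((\<lambda>r. (p r)\<^sup>2) has_real_derivative 2 * \<tau> * g t * (p t)\<^sup>2 + 2 * (h t * (p t * (p t - n t)))) (at t within {0..1})"
      by (rule derivative_eq_intros wave_pairD[OF w t] refl)+ (simp add: algebra_simps power2_eq_square)
    show "(W has_real_derivative 2 * \<tau> * g t - 2 * (1 + B) * H) (at t within {0..1})"
      unfolding W_def by (auto intro!: derivative_eq_intros dX t)
    have "\<bar>h t * (p t * (p t - n t))\<bar> \<le> H * (\<bar>p t\<bar> * ((1 + B) * \<bar>p t\<bar>))"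
      unfolding abs_mult using H(1) H(2)[of t] t B(2)[OF tt] abs_triangle_ineq4[of "p t" "n t"]
      by (intro mult_mono) (auto simp: algebra_simps)
    also have "\<dots> = (1 + B) * H * (p t)\<^sup>2" by (simp add: power2_eq_square)
    finally show "(2 * \<tau> * g t - 2 * (1 + B) * H) * (p t)\<^sup>2 \<le> 2 * \<tau> * g t * (p t)\<^sup>2 + 2 * (h t * (p t * (p t - n t)))"
      by (simp add: algebra_simps abs_le_iff)
  qed
  moreover have "2 * \<tau> * (X r - X s) - 2 * (1 + B) * H \<le> W r - W s"
  proof -
    have "2 * (1 + B) * H * (r - s) \<le> 2 * (1 + B) * H * 1" using rs B H(1) by (intro mult_left_mono) auto
    then show ?thesis by (simp add: W_def algebra_simps)
  qed
  then have "(p s)\<^sup>2 * exp (2 * \<tau> * (X r - X s) - 2 * (1 + B) * H) \<le> (p s)\<^sup>2 * exp (W r - W s)"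
    by (intro mult_left_mono) auto
  ultimately show ?thesis by linarith
qed

lemma n_square_growth:
  assumes w: "wave_pair \<tau> p n" and rs: "0 \<le> s" "s \<le> r" "r \<le> 1"
    and B: "B \<ge> 0" "\<And>t. t \<in> {s..r} \<Longrightarrow> \<bar>p t\<bar> \<le> B * \<bar>n t\<bar>"
  shows "(n r)\<^sup>2 * exp (2 * \<tau> * (X r - X s) - 2 * (1 + B) * H) \<le> (n s)\<^sup>2"
proof -
  define W where "W t = - (2 * \<tau> * X t) + 2 * (1 + B) * H * t" for t
  have "(n r)\<^sup>2 \<le> (n s)\<^sup>2 * exp (W r - W s)"
  proof (rule gronwall_le[OF rs(2) rs(1) rs(3)])
    fix t assume tt: "t \<in> {s..r}"
    then have t: "t \<in> {0..1}" using rs by auto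
    show "((\<lambda>r. (n r)\<^sup>2) has_real_derivative - (2 * \<tau> * g t * (n t)\<^sup>2) - 2 * (h t * (n t * (p t - n t)))) (at t within {0..1})"
      by (rule derivative_eq_intros wave_pairD[OF w t] refl)+ (simp add: algebra_simps power2_eq_square)
    show "(W has_real_derivative - (2 * \<tau> * g t) + 2 * (1 + B) * H) (at t within {0..1})"
      unfolding W_def by (auto intro!: derivative_eq_intros dX t)
    have "\<bar>h t * (n t * (p t - n t))\<bar> \<le> H * (\<bar>n t\<bar> * ((1 + B) * \<bar>n t\<bar>))"
      unfolding abs_mult using H(1) H(2)[of t] t B(2)[OF tt] abs_triangle_ineq4[of "p t" "n t"]
      by (intro mult_mono) (auto simp: algebra_simps)
    also have "\<dots> = (1 + B) * H * (n t)\<^sup>2" by (simp add: power2_eq_square)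
    finally show "- (2 * \<tau> * g t * (n t)\<^sup>2) - 2 * (h t * (n t * (p t - n t))) \<le> (- (2 * \<tau> * g t) + 2 * (1 + B) * H) * (n t)\<^sup>2"
      by (simp add: algebra_simps abs_le_iff)
  qed
  then have "(n r)\<^sup>2 * exp (W s - W r) \<le> (n s)\<^sup>2 * exp (W r - W s) * exp (W s - W r)" by (intro mult_right_mono) auto
  then have "(n r)\<^sup>2 * exp (W s - W r) \<le> (n s)\<^sup>2" by (simp add: mult.assoc exp_add[symmetric])
  moreover have "2 * \<tau> * (X r - X s) - 2 * (1 + B) * H \<le> W s - W r"
  proof -
    have "2 * (1 + B) * H * (r - s) \<le> 2 * (1 + B) * H * 1" using rs B H(1) by (intro mult_left_mono) auto
    then show ?thesis by (simp add: W_def algebra_simps)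
  qed
  then have "(n r)\<^sup>2 * exp (2 * \<tau> * (X r - X s) - 2 * (1 + B) * H) \<le> (n r)\<^sup>2 * exp (W s - W r)"
    by (intro mult_left_mono) auto
  ultimately show ?thesis by linarith
qed

lemma p_linear_bounds:
  assumes w: "wave_pair \<tau> p n" and rs: "0 \<le> s" "s \<le> r" "r \<le> 1"
    and B: "\<And>t. t \<in> {s..r} \<Longrightarrow> p t \<ge> 0" "\<And>t. t \<in> {s..r} \<Longrightarrow> \<bar>n t\<bar> \<le> p t"
  shows "p s * exp (\<tau> * (X r - X s) - 2 * H) \<le> p r" "p r \<le> p s * exp (\<tau> * (X r - X s) + 2 * H)"
proof -
  have b: "\<bar>h t * (p t - n t)\<bar> \<le> 2 * H * p t" if "t \<in> {s..r}" for t
  proof -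
    have "\<bar>h t * (p t - n t)\<bar> \<le> H * (2 * p t)"
      unfolding abs_mult using H(1) H(2)[of t] rs that B(1)[OF that] B(2)[OF that]
      by (intro mult_mono) (auto simp: abs_le_iff)
    then show ?thesis by simp
  qed
  have rs1: "2 * H * (r - s) \<le> 2 * H * 1" using rs H(1) by (intro mult_left_mono) auto
  have p0: "p s \<ge> 0" using B(1)[of s] rs by auto
  have "p s * exp ((\<tau> * X r - 2 * H * r) - (\<tau> * X s - 2 * H * s)) \<le> p r"
  proof (rule gronwall_ge[OF rs(2) rs(1) rs(3)])
    fix t assume tt: "t \<in> {s..r}"
    then have t: "t \<in> {0..1}" using rs by auto
    show "(p has_real_derivative \<tau> * g t * p t + h t * (p t - n t)) (at t within {0..1})" by (rule wave_pairD[OF w t])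
    show "((\<lambda>t. \<tau> * X t - 2 * H * t) has_real_derivative \<tau> * g t - 2 * H) (at t within {0..1})"
      by (auto intro!: derivative_eq_intros dX t)
    show "(\<tau> * g t - 2 * H) * p t \<le> \<tau> * g t * p t + h t * (p t - n t)"
      using b[OF tt] unfolding abs_le_iff by (simp only: left_diff_distrib) linarith
  qed
  moreover have "p s * exp (\<tau> * (X r - X s) - 2 * H) \<le> p s * exp ((\<tau> * X r - 2 * H * r) - (\<tau> * X s - 2 * H * s))"
    using p0 rs1 by (intro mult_left_mono) (auto simp: algebra_simps)
  ultimately show "p s * exp (\<tau> * (X r - X s) - 2 * H) \<le> p r" by linarith
  have "p r \<le> p s * exp ((\<tau> * X r + 2 * H * r) - (\<tau> * X s + 2 * H * s))"
  proof (rule gronwall_le[OF rs(2) rs(1) rs(3)])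
    fix t assume tt: "t \<in> {s..r}"
    then have t: "t \<in> {0..1}" using rs by auto
    show "(p has_real_derivative \<tau> * g t * p t + h t * (p t - n t)) (at t within {0..1})" by (rule wave_pairD[OF w t])
    show "((\<lambda>t. \<tau> * X t + 2 * H * t) has_real_derivative \<tau> * g t + 2 * H) (at t within {0..1})"
      by (auto intro!: derivative_eq_intros dX t)
    show "\<tau> * g t * p t + h t * (p t - n t) \<le> (\<tau> * g t + 2 * H) * p t"
      using b[OF tt] unfolding abs_le_iff by (simp only: distrib_right) linarith
  qed
  moreover have "p s * exp ((\<tau> * X r + 2 * H * r) - (\<tau> * X s + 2 * H * s)) \<le> p s * exp (\<tau> * (X r - X s) + 2 * H)"
    using p0 rs1 by (intro mult_left_mono) (auto simp: algebra_simps)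
  ultimately show "p r \<le> p s * exp (\<tau> * (X r - X s) + 2 * H)" by linarith
qed

text \<open>Near \<open>r = 1\<close> the outgoing wave \<open>p\<close> feeds \<open>n\<close> through \<open>h\<close>. As \<open>h\<close> has a fixed sign there,
  these contributions cannot cancel, and \<open>n\<close> overtakes \<open>p\<close> before \<open>r2\<close> is reached.\<close>
lemma reflected_wave_turnover:
  assumes r: "0 \<le> r2" "r2 < r3" "r3 < r4" "r4 < 1" and z: "z = 1 \<or> z = -1"
    and h0: "h0 > 0" "\<And>x. x \<in> {r3..r4} \<Longrightarrow> h0 \<le> z * h x" "\<And>x. x \<in> {r2..1} \<Longrightarrow> 0 \<le> z * h x"
    and X: "X 1 - X r3 \<le> 1/2"
  obtains T where "\<And>\<tau> p n. \<tau> \<ge> T \<Longrightarrow> wave_pair \<tau> p n \<Longrightarrow> p 1 = exp \<tau> \<Longrightarrow> n 1 = exp (- \<tau>) \<Longrightarrow>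
    (p r2)\<^sup>2 \<le> 4 * (n r2)\<^sup>2"
proof -
  define \<gamma> where "\<gamma> = X r3 - X r2"
  have \<gamma>: "\<gamma> > 0" using X_mono_strict[of r2 r3] r by (simp add: \<gamma>_def)
  \<comment> \<open>The reflection collected on \<open>{r3..r4}\<close>: its length, the minimal
    coupling \<open>h0\<close>, and the loss \<open>exp (- 2 * H) / 2\<close> in bounding
    \<open>p - n\<close> below by the undisturbed wave.\<close>
  define c1 where "c1 = (r4 - r3) * h0 * (exp (- 2 * H) / 2)"
  have c1: "c1 > 0" using r h0 by (simp add: c1_def)
  obtain T1 where T1: "T1 \<ge> 0" "\<And>\<tau>. \<tau> \<ge> T1 \<Longrightarrow> 1 * exp (- (1 * \<tau>)) < c1 / 2"
    using exp_decay_below[of 1 "c1/2" 1] c1 by auto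
  obtain T2 where T2: "T2 \<ge> 0" "\<And>\<tau>. \<tau> \<ge> T2 \<Longrightarrow> exp (2 * H) * exp (- (2 * \<gamma> * \<tau>)) < c1 / 2"
    using exp_decay_below[of "2 * \<gamma>" "c1/2" "exp (2 * H)"] c1 \<gamma> by auto
  define T where "T = max (max T1 T2) (6 * H / gmin)"
  show ?thesis
  proof (rule that[of T], rule ccontr)
    fix \<tau> p n assume \<tau>: "\<tau> \<ge> T" and w: "wave_pair \<tau> p n" and p1: "p 1 = exp \<tau>" and n1: "n 1 = exp (- \<tau>)"
      and not: "\<not> (p r2)\<^sup>2 \<le> 4 * (n r2)\<^sup>2"
    have \<tau>0: "\<tau> \<ge> 0" using \<tau> T1(1) by (simp add: T_def)
    have \<tau>g: "\<tau> * gmin \<ge> 6 * H" using \<tau> gmin(1) by (simp add: T_def field_simps)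
    \<comment> \<open>If \<open>p\<close> dominates at \<open>r2\<close>, the cone with
      \<open>c = 1/4\<close> makes it dominate up to 1, so \<open>p\<close> is there an undisturbed
      wave up to constant factors.\<close>
    have lt: "4 * (n t)\<^sup>2 < (p t)\<^sup>2" if "t \<in> {r2..1}" for t
      using cone_antitone[OF w \<tau>g, of "1/4" r2 t] not that r by auto
    have lt': "2 * \<bar>n t\<bar> < \<bar>p t\<bar>" if "t \<in> {r2..1}" for t
    proof -
      have "(2 * \<bar>n t\<bar>)\<^sup>2 < \<bar>p t\<bar>\<^sup>2" using lt[OF that] by (simp add: power_mult_distrib)
      then show ?thesis by (rule power2_less_imp_less) simp
    qed
    have pc: "continuous_on {0..1} p"
      using wave_pairD(1)[OF w] by (meson has_field_derivative_imp_has_derivative has_derivative_continuous continuous_on_eq_continuous_within)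
    have pp: "p t > 0" if t: "t \<in> {r2..1}" for t
    proof (rule ccontr)
      assume "\<not> p t > 0"
      then have "\<exists>x\<ge>t. x \<le> 1 \<and> p x = 0"
        using t r p1 by (intro IVT' continuous_on_subset[OF pc]) auto
      then obtain x where "x \<ge> t" "x \<le> 1" "p x = 0" by blast
      then show False using lt'[of x] t by simp
    qed
    have np: "\<bar>n t\<bar> \<le> p t" "p t - n t \<ge> p t / 2" if "t \<in> {r2..1}" for t
      using lt'[OF that] pp[OF that] by (auto simp: abs_le_iff)
    define \<xi> where "\<xi> t = X 1 - X t" for t
    have plow: "exp (\<tau> - \<tau> * \<xi> t - 2 * H) \<le> p t" if t: "t \<in> {r2..1}" for t
    proof -
      have "exp \<tau> \<le> p t * exp (\<tau> * (X 1 - X t) + 2 * H)"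
        using p_linear_bounds(2)[OF w, of t 1] t r np pp p1 by (force intro: less_imp_le)
      then have "exp \<tau> * exp (- (\<tau> * (X 1 - X t) + 2 * H)) \<le> p t * exp (\<tau> * (X 1 - X t) + 2 * H) * exp (- (\<tau> * (X 1 - X t) + 2 * H))"
        by (intro mult_right_mono) auto
      then show ?thesis by (simp add: mult.assoc exp_add[symmetric] \<xi>_def algebra_simps)
    qed
    have pup: "p r2 \<le> exp (\<tau> - \<tau> * \<xi> r2 + 2 * H)"
    proof -
      have "p r2 * exp (\<tau> * (X 1 - X r2) - 2 * H) \<le> exp \<tau>"
        using p_linear_bounds(1)[OF w, of r2 1] r np pp p1 by (force intro: less_imp_le)
      then have "p r2 * exp (\<tau> * (X 1 - X r2) - 2 * H) * exp (- (\<tau> * (X 1 - X r2) - 2 * H)) \<le> exp \<tau> * exp (- (\<tau> * (X 1 - X r2) - 2 * H))"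
        by (intro mult_right_mono) auto
      then show ?thesis by (simp add: mult.assoc exp_add[symmetric] \<xi>_def algebra_simps)
    qed
    \<comment> \<open>\<open>N\<close> is \<open>n\<close> with its free growth and the sign of the
      coupling divided out. Its derivative is the pure source term, of one sign, so moving inwards
      from 1 it can only increase.\<close>
    define N where "N t = z * (n t * exp (- (\<tau> * \<xi> t)))" for t
    have dN: "(N has_real_derivative - (z * h t) * ((p t - n t) * exp (- (\<tau> * \<xi> t)))) (at t within {0..1})"
      if t: "t \<in> {0..1}" for t
      unfolding N_def \<xi>_def
      by (rule derivative_eq_intros wave_pairD[OF w t] dX t refl)+ (simp add: algebra_simps)
    have Nmono: "N b \<le> N a" if "r2 \<le> a" "a \<le> b" "b \<le> 1" for a b
    proof (rule nonpos_deriv_le[OF that(2) _ that(3) dN])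
      fix t assume t: "t \<in> {a..b}"
      then show "t \<in> {0..1}" using that r by auto
      have "t \<in> {r2..1}" using t that by auto
      then show "- (z * h t) * ((p t - n t) * exp (- (\<tau> * \<xi> t))) \<le> 0"
        using h0(3)[of t] np(2)[of t] pp[of t] by (intro mult_nonpos_nonneg) auto
    qed (use that r in auto)
    define E where "E = exp (\<tau> - 2 * (\<tau> * \<xi> r3))"
    have step: "N r4 + c1 * E \<le> N r3"
    proof -
      define m where "m = h0 * (exp (- 2 * H) / 2) * E"
      have "N r4 + m * r4 \<le> N r3 + m * r3"
      proof (rule nonpos_deriv_le[of r3 r4 "\<lambda>t. N t + m * t"])
        fix t assume t: "t \<in> {r3..r4}"
        then have t01: "t \<in> {0..1}" and t2: "t \<in> {r2..1}" using r by auto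
        show "((\<lambda>t. N t + m * t) has_real_derivative - (z * h t) * ((p t - n t) * exp (- (\<tau> * \<xi> t))) + m) (at t within {0..1})"
          by (auto intro!: derivative_eq_intros dN[OF t01])
        have "\<xi> t \<le> \<xi> r3" using X_mono[of r3 t] t r by (simp add: \<xi>_def)
        then have "\<tau> * \<xi> t \<le> \<tau> * \<xi> r3" using \<tau>0 by (intro mult_left_mono) auto
        then have "exp (\<tau> - 2 * (\<tau> * \<xi> r3)) * exp (- 2 * H) \<le> exp (\<tau> - \<tau> * \<xi> t - 2 * H) * exp (- (\<tau> * \<xi> t))"
          by (simp add: exp_add[symmetric])
        also have "\<dots> \<le> p t * exp (- (\<tau> * \<xi> t))" using plow[OF t2] by (intro mult_right_mono) auto
        also have "\<dots> \<le> 2 * (p t - n t) * exp (- (\<tau> * \<xi> t))" using np(2)[OF t2] by (intro mult_right_mono) auto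
        finally have 1: "E * exp (- 2 * H) / 2 \<le> (p t - n t) * exp (- (\<tau> * \<xi> t))" by (simp add: E_def algebra_simps)
        have "h0 * (E * exp (- 2 * H) / 2) \<le> (z * h t) * ((p t - n t) * exp (- (\<tau> * \<xi> t)))"
          using h0(1) h0(2)[OF t] 1 by (intro mult_mono) (auto simp: E_def)
        then show "- (z * h t) * ((p t - n t) * exp (- (\<tau> * \<xi> t))) + m \<le> 0" by (simp add: m_def mult_ac)
      qed (use r in auto)
      moreover have "m * r4 - m * r3 = c1 * E" by (simp add: m_def c1_def algebra_simps)
      ultimately show ?thesis by linarith
    qed
    have N1: "N 1 \<ge> - exp (- \<tau>)" using z by (auto simp: N_def n1 \<xi>_def)
    have "c1 * E - exp (- \<tau>) \<le> N r2"
      using step N1 Nmono[of r2 r3] Nmono[of r4 1] r by linarith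
    also have "N r2 \<le> p r2 * exp (- (\<tau> * \<xi> r2))"
    proof -
      have "z * n r2 \<le> p r2" using np(1)[of r2] z r by (auto simp: abs_le_iff)
      then show ?thesis unfolding N_def mult.assoc[symmetric] by (intro mult_right_mono) auto
    qed
    also have "\<dots> \<le> exp (\<tau> - \<tau> * \<xi> r2 + 2 * H) * exp (- (\<tau> * \<xi> r2))" using pup by (intro mult_right_mono) auto
    \<comment> \<open>Between \<open>r3\<close> and \<open>r2\<close> the wave \<open>p\<close> and
      the removed growth factor each lose \<open>exp (- (\<gamma> * \<tau>))\<close>. Since
      \<open>p\<close> dominates, \<open>N r2\<close> is then too small for the amount
      \<open>c1 * E\<close> that it has collected.\<close>
    also have "\<dots> = E * (exp (2 * H) * exp (- (2 * \<gamma> * \<tau>)))"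
      by (simp add: E_def exp_add[symmetric] \<gamma>_def \<xi>_def algebra_simps)
    also have "\<dots> < E * (c1 / 2)"
      using T2(2)[of \<tau>] \<tau> by (intro mult_strict_left_mono) (auto simp: E_def T_def)
    finally have "c1 * E / 2 < exp (- \<tau>)" by (simp add: algebra_simps)
    moreover have "exp (- \<tau>) \<le> E * exp (- \<tau>)"
    proof -
      \<comment> \<open>The limit 1/2 on the travel time from \<open>r3\<close> to 1 yields
        \<open>E \<ge> 1\<close>; the initial value \<open>exp (- \<tau>)\<close> of
        \<open>n\<close>, possibly of the wrong sign, is then negligible.\<close>
      have "\<tau> * (2 * \<xi> r3) \<le> \<tau> * 1" using X \<tau>0 by (intro mult_left_mono) (auto simp: \<xi>_def)
      then have "E \<ge> 1" by (simp add: E_def)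
      then show ?thesis by simp
    qed
    moreover have "E * exp (- \<tau>) < E * (c1 / 2)"
      using T1(2)[of \<tau>] \<tau> by (intro mult_strict_left_mono) (auto simp: E_def T_def)
    ultimately show False by (simp add: algebra_simps)
  qed
qed

lemma wave_energy_growth:
  assumes w: "wave_pair \<tau> p n" and \<tau>: "\<tau> \<ge> 0" and rs: "0 \<le> s" "s \<le> r" "r \<le> 1"
  shows "(p r)\<^sup>2 + (n r)\<^sup>2 \<le> ((p s)\<^sup>2 + (n s)\<^sup>2) * exp (2 * \<tau> * (X r - X s) + 4 * H)"
proof -
  have "(p r)\<^sup>2 + (n r)\<^sup>2 \<le> ((p s)\<^sup>2 + (n s)\<^sup>2) * exp ((2 * \<tau> * X r + 4 * H * r) - (2 * \<tau> * X s + 4 * H * s))"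
  proof (rule gronwall_le[OF rs(2) rs(1) rs(3)])
    fix t assume "t \<in> {s..r}"
    then have t: "t \<in> {0..1}" using rs by auto
    show "((\<lambda>r. (p r)\<^sup>2 + (n r)\<^sup>2) has_real_derivative
       2 * \<tau> * g t * ((p t)\<^sup>2 - (n t)\<^sup>2) + 2 * (h t * (p t - n t)\<^sup>2)) (at t within {0..1})"
      by (rule derivative_eq_intros wave_pairD[OF w t] refl)+ (simp add: algebra_simps power2_eq_square)
    show "((\<lambda>t. 2 * \<tau> * X t + 4 * H * t) has_real_derivative 2 * \<tau> * g t + 4 * H) (at t within {0..1})"
      by (auto intro!: derivative_eq_intros dX t)
    have "h t * (p t - n t)\<^sup>2 \<le> H * (2 * ((p t)\<^sup>2 + (n t)\<^sup>2))"
    proof (rule mult_mono)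
      have "0 \<le> (p t + n t)\<^sup>2" by simp
      then show "(p t - n t)\<^sup>2 \<le> 2 * ((p t)\<^sup>2 + (n t)\<^sup>2)" by (simp add: power2_eq_square algebra_simps)
    qed (use H(1) H(2)[OF t] in \<open>auto simp: abs_le_iff\<close>)
    moreover have "2 * \<tau> * g t * ((p t)\<^sup>2 - (n t)\<^sup>2) \<le> 2 * \<tau> * g t * ((p t)\<^sup>2 + (n t)\<^sup>2)"
      using \<tau> g_pos[OF t] by (intro mult_left_mono) auto
    ultimately show "2 * \<tau> * g t * ((p t)\<^sup>2 - (n t)\<^sup>2) + 2 * (h t * (p t - n t)\<^sup>2) \<le> (2 * \<tau> * g t + 4 * H) * ((p t)\<^sup>2 + (n t)\<^sup>2)"
      unfolding distrib_right[of "2 * \<tau> * g t"] by linarith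
  qed
  also have "\<dots> \<le> ((p s)\<^sup>2 + (n s)\<^sup>2) * exp (2 * \<tau> * (X r - X s) + 4 * H)"
  proof (rule mult_left_mono)
    have "4 * H * (r - s) \<le> 4 * H * 1" using rs H(1) by (intro mult_left_mono) auto
    then show "exp ((2 * \<tau> * X r + 4 * H * r) - (2 * \<tau> * X s + 4 * H * s)) \<le> exp (2 * \<tau> * (X r - X s) + 4 * H)"
      by (simp add: algebra_simps)
  qed simp
  finally show ?thesis .
qed

text \<open>The turnover point \<open>r2\<close> can be put so close to 1 that \<sigma> pays for
  twice the travel time \<open>X 1 - X r2\<close>: once because the energy may decay from 1 to
  \<open>r2\<close>, once because the growth of \<open>n\<close> is counted only from
  \<open>r2\<close> inwards. From there to \<open>e\<close> the dominating \<open>n\<close> grows at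
  its free rate.\<close>

lemma reflected_wave_growth:
  assumes \<delta>: "\<delta> > 0" "\<And>x. x \<in> {1 - \<delta><..<1} \<Longrightarrow> \<eta>1 x \<noteq> 0" and e: "0 \<le> e" "e < 1" and \<sigma>: "\<sigma> > 0"
  obtains c T where "c > 0" "\<And>\<tau> p n. \<tau> \<ge> T \<Longrightarrow> wave_pair \<tau> p n \<Longrightarrow> p 1 = exp \<tau> \<Longrightarrow> n 1 = exp (- \<tau>) \<Longrightarrow>
    c * exp (2 * \<tau> * (1 + X 1 - X e - \<sigma>)) \<le> (n e)\<^sup>2 \<and> 4 * (p e)\<^sup>2 \<le> (n e)\<^sup>2"
proof -
  have "continuous (at 1 within {0..1}) X" using cX by (simp add: continuous_on_eq_continuous_within)
  then obtain d where d: "d > 0" "\<And>x. x \<in> {0..1} \<Longrightarrow> dist x 1 < d \<Longrightarrow> dist (X x) (X 1) < min (\<sigma> / 2) (1/2)"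
    unfolding continuous_within_eps_delta using \<sigma> by (metis half_gt_zero min_less_iff_conj zero_less_one)
  define \<kappa> where "\<kappa> = min (min (d / 2) (\<delta> / 2)) (min ((1 - e) / 2) (1 / 2))"
  have \<kappa>: "\<kappa> > 0" "\<kappa> < d" "\<kappa> < \<delta>" "\<kappa> < 1 - e" "\<kappa> < 1" using d \<delta> e by (auto simp: \<kappa>_def min_def)
  \<comment> \<open>\<open>h\<close> may vanish at 1, so its positive lower bound is taken on
    \<open>{r3..r4}\<close>, strictly inside the interval where \<open>\<eta>1\<close> has no
    zero.\<close>
  define r2 r3 r4 where "r2 = 1 - \<kappa>" and "r3 = 1 - \<kappa> / 2" and "r4 = 1 - \<kappa> / 4"
  have r: "0 \<le> r2" "r2 < r3" "r3 < r4" "r4 < 1" "e < r2" using \<kappa> by (auto simp: r2_def r3_def r4_def)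
  have X2: "X 1 - X r2 \<le> \<sigma> / 2" "X 1 - X r2 \<le> 1/2"
  proof -
    have "dist (X r2) (X 1) < min (\<sigma> / 2) (1/2)" using r \<kappa> by (intro d(2)) (auto simp: dist_real_def r2_def)
    then show "X 1 - X r2 \<le> \<sigma> / 2" "X 1 - X r2 \<le> 1/2" unfolding dist_real_def by linarith+
  qed
  have X3: "X 1 - X r3 \<le> 1/2" using X2 X_mono[of r2 r3] r by simp
  have hn: "h x \<noteq> 0" if "x \<in> {r2..<1}" for x
    using \<delta>(2)[of x] that pos[of x] \<kappa> r by (auto simp: h_def r2_def)
  have hsign: "\<exists>z. (z = 1 \<or> z = -1) \<and> (\<forall>x\<in>{r2..<1}. z * h x > 0)"
  proof -
    have nosign: False if "x \<in> {r2..<1}" "y \<in> {r2..<1}" "h x < 0" "h y > 0" for x y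
    proof -
      have cont: "continuous_on {min x y..max x y} h"
        by (rule continuous_on_subset[OF ch]) (use that r in auto)
      have "connected (h ` {min x y..max x y})" using cont by (intro connected_continuous_image) auto
      moreover have "h x \<in> h ` {min x y..max x y}" "h y \<in> h ` {min x y..max x y}" by auto
      ultimately have "0 \<in> h ` {min x y..max x y}"
        using that connectedD_interval[of "h ` {min x y..max x y}" "h x" "h y" 0] by auto
      then obtain t where "t \<in> {min x y..max x y}" "h t = 0" by auto
      then show False using hn[of t] that by (auto simp: min_def max_def split: if_splits)
    qed
    have r2in: "r2 \<in> {r2..<1}" using r by auto
    show ?thesis
    proof (cases "h r2 > 0")
      case True
      then have "\<forall>x\<in>{r2..<1}. 1 * h x > 0" using nosign[of _ r2] hn r2in by (metis linorder_neqE_linordered_idom mult_1)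
      then show ?thesis by blast
    next
      case False
      then have "h r2 < 0" using hn[OF r2in] by simp
      then have "\<forall>x\<in>{r2..<1}. (-1) * h x > 0" using nosign[of r2] hn r2in by (metis linorder_neqE_linordered_idom mult_minus1 neg_0_less_iff_less)
      then show ?thesis by blast
    qed
  qed
  then obtain z where z: "z = 1 \<or> z = -1" "\<And>x. x \<in> {r2..<1} \<Longrightarrow> z * h x > 0" by blast
  have hz: "0 \<le> z * h x" if "x \<in> {r2..1}" for x
  proof (cases "x = 1")
    case True
    have "((\<lambda>x. z * h x) \<longlongrightarrow> z * h 1) (at 1 within {0..1})"
      using ch by (intro tendsto_intros) (simp add: continuous_on_def)
    then have "((\<lambda>x. z * h x) \<longlongrightarrow> z * h 1) (at 1 within {r2..<1})"
      by (rule tendsto_within_subset) (use r in auto)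
    moreover have "at 1 within {r2..<1} \<noteq> bot"
      using r by (auto simp: trivial_limit_within islimpt_in_closure closure_atLeastLessThan)
    moreover have "\<forall>\<^sub>F x in at 1 within {r2..<1}. 0 \<le> z * h x"
      unfolding eventually_at_filter by (rule always_eventually) (use z(2) in \<open>auto intro: less_imp_le\<close>)
    ultimately show ?thesis unfolding True by (intro tendsto_lowerbound)
  qed (use z(2)[of x] that in auto)
  obtain x0 where x0: "x0 \<in> {r3..r4}" "\<And>y. y \<in> {r3..r4} \<Longrightarrow> z * h x0 \<le> z * h y"
  proof -
    have "continuous_on {r3..r4} (\<lambda>x. z * h x)"
      by (intro continuous_intros continuous_on_subset[OF ch]) (use r in auto)
    then show ?thesis using continuous_attains_inf[of "{r3..r4}" "\<lambda>x. z * h x"] that r by auto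
  qed
  obtain T1 where T1: "\<And>\<tau> p n. \<tau> \<ge> T1 \<Longrightarrow> wave_pair \<tau> p n \<Longrightarrow> p 1 = exp \<tau> \<Longrightarrow> n 1 = exp (- \<tau>) \<Longrightarrow>
    (p r2)\<^sup>2 \<le> 4 * (n r2)\<^sup>2"
    using reflected_wave_turnover[OF r(1-4) z(1) _ x0(2) hz X3] z(2)[of x0] x0(1) r by auto
  define \<gamma> where "\<gamma> = X r2 - X e"
  have \<gamma>: "\<gamma> > 0" using X_mono_strict[of e r2] r e by (simp add: \<gamma>_def)
  obtain T2 where T2: "T2 \<ge> 0" "\<And>\<tau>. \<tau> \<ge> T2 \<Longrightarrow> (16 * exp (12 * H)) * exp (- (4 * \<gamma> * \<tau>)) < 1"
    using exp_decay_below[of "4 * \<gamma>" 1 "16 * exp (12 * H)"] \<gamma> by auto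
  define T where "T = max (max T1 T2) (6 * H / gmin)"
  \<comment> \<open>\<open>4 * H\<close> comes from the energy estimate between \<open>r2\<close>
    and 1, \<open>6 * H\<close> from the growth of \<open>n\<close> with \<open>B = 2\<close>, and 5
    from \<open>p\<^sup>2 + n\<^sup>2 \<le> 5 n\<^sup>2\<close> at \<open>r2\<close>.\<close>
  define c where "c = exp (- 10 * H) / 5"
  show ?thesis
  proof (rule that[of c T])
    show "c > 0" by (simp add: c_def)
    fix \<tau> p n assume \<tau>: "\<tau> \<ge> T" and w: "wave_pair \<tau> p n" and p1: "p 1 = exp \<tau>" and n1: "n 1 = exp (- \<tau>)"
    have \<tau>0: "\<tau> \<ge> 0" using \<tau> T2(1) by (simp add: T_def)
    have \<tau>g: "\<tau> * gmin \<ge> 6 * H" using \<tau> gmin(1) by (simp add: T_def field_simps)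
    have pn2: "(p r2)\<^sup>2 \<le> 4 * (n r2)\<^sup>2" using T1[OF _ w p1 n1] \<tau> by (simp add: T_def)
    have pn: "(p t)\<^sup>2 \<le> 4 * (n t)\<^sup>2" if "t \<in> {e..r2}" for t
      using cone_antitone[OF w \<tau>g, of "1/4" t r2] pn2 that e r by auto
    have sq: "\<bar>x\<bar> \<le> 2 * \<bar>y\<bar>" if "x\<^sup>2 \<le> 4 * y\<^sup>2" for x y :: real
    proof -
      have "\<bar>x\<bar>\<^sup>2 \<le> (2 * \<bar>y\<bar>)\<^sup>2" using that by (simp add: power_mult_distrib)
      then show ?thesis by (rule power2_le_imp_le) simp
    qed
    have ng: "(n r2)\<^sup>2 * exp (2 * \<tau> * \<gamma> - 6 * H) \<le> (n e)\<^sup>2"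
      using n_square_growth[OF w, of e r2 2] e r sq[OF pn] by (simp add: \<gamma>_def)
    have "c * exp (2 * \<tau> * (1 + X 1 - X e - \<sigma>)) \<le> (n e)\<^sup>2"
    proof -
      have "exp (2 * \<tau>) \<le> (p 1)\<^sup>2 + (n 1)\<^sup>2" unfolding p1 by (simp add: exp_double power2_eq_square[symmetric])
      also have "\<dots> \<le> ((p r2)\<^sup>2 + (n r2)\<^sup>2) * exp (2 * \<tau> * (X 1 - X r2) + 4 * H)"
        using wave_energy_growth[OF w \<tau>0, of r2 1] r by simp
      also have "\<dots> \<le> (5 * (n r2)\<^sup>2) * exp (2 * \<tau> * (X 1 - X r2) + 4 * H)" using pn2 by (intro mult_right_mono) auto
      finally have "exp (2 * \<tau>) * exp (- (2 * \<tau> * (X 1 - X r2) + 4 * H))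
          \<le> (5 * (n r2)\<^sup>2) * exp (2 * \<tau> * (X 1 - X r2) + 4 * H) * exp (- (2 * \<tau> * (X 1 - X r2) + 4 * H))"
        by (intro mult_right_mono) auto
      also have "\<dots> = 5 * (n r2)\<^sup>2" by (simp only: mult.assoc exp_add[symmetric]) simp
      finally have "exp (2 * \<tau>) * exp (- (2 * \<tau> * (X 1 - X r2) + 4 * H)) / 5 \<le> (n r2)\<^sup>2" by simp
      then have "exp (2 * \<tau>) * exp (- (2 * \<tau> * (X 1 - X r2) + 4 * H)) / 5 * exp (2 * \<tau> * \<gamma> - 6 * H) \<le> (n r2)\<^sup>2 * exp (2 * \<tau> * \<gamma> - 6 * H)"
        by (intro mult_right_mono) auto
      also note ng
      also have "exp (2 * \<tau>) * exp (- (2 * \<tau> * (X 1 - X r2) + 4 * H)) / 5 * exp (2 * \<tau> * \<gamma> - 6 * H)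
        = c * exp (2 * \<tau> * (1 + X 1 - X e - 2 * (X 1 - X r2)))"
        by (simp add: c_def exp_add[symmetric] \<gamma>_def algebra_simps)
      finally have "c * exp (2 * \<tau> * (1 + X 1 - X e - 2 * (X 1 - X r2))) \<le> (n e)\<^sup>2" .
      moreover have "c * exp (2 * \<tau> * (1 + X 1 - X e - \<sigma>)) \<le> c * exp (2 * \<tau> * (1 + X 1 - X e - 2 * (X 1 - X r2)))"
        using X2 \<tau>0 by (intro mult_left_mono iffD2[OF exp_le_cancel_iff]) (auto simp: c_def)
      ultimately show ?thesis by linarith
    qed
    moreover have "4 * (p e)\<^sup>2 \<le> (n e)\<^sup>2"
    proof (rule ccontr)
      assume not: "\<not> 4 * (p e)\<^sup>2 \<le> (n e)\<^sup>2"
      \<comment> \<open>Otherwise the cone with \<open>c = 4\<close> makes \<open>p\<close> grow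
        from \<open>e\<close> to \<open>r2\<close>, while \<open>n\<close> grows from
        \<open>r2\<close> to \<open>e\<close>. Each gains \<open>exp (\<gamma> * \<tau>)\<close> up
        to constants, which for large \<tau> contradicts
        \<open>\<bar>p\<bar> \<le> 2 \<bar>n\<bar>\<close> at \<open>r2\<close>.\<close>
      have np: "(n t)\<^sup>2 \<le> 4 * (p t)\<^sup>2" if "t \<in> {e..r2}" for t
        using cone_antitone[OF w \<tau>g, of 4 e t] not that e r by auto
      have pg: "(p e)\<^sup>2 * exp (2 * \<tau> * \<gamma> - 6 * H) \<le> (p r2)\<^sup>2"
        using p_square_growth[OF w, of e r2 2] e r sq[OF np] by (simp add: \<gamma>_def)
      define q where "q = exp (2 * \<tau> * \<gamma> - 6 * H)"
      have "(p e)\<^sup>2 * q * q \<le> (p r2)\<^sup>2 * q" using pg by (intro mult_right_mono) (auto simp: q_def)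
      also have "\<dots> \<le> 4 * ((n r2)\<^sup>2 * q)" using pn2 by (simp add: q_def)
      also have "\<dots> \<le> 4 * (n e)\<^sup>2" using ng by (simp add: q_def)
      also have "\<dots> < 16 * (p e)\<^sup>2" using not by simp
      finally have 1: "(p e)\<^sup>2 * (q * q) < (p e)\<^sup>2 * 16" by (simp add: mult_ac)
      have "q * q < 16"
      proof (rule ccontr)
        assume "\<not> q * q < 16"
        then have "(p e)\<^sup>2 * 16 \<le> (p e)\<^sup>2 * (q * q)" by (intro mult_left_mono) auto
        with 1 show False by simp
      qed
      moreover have "16 < q * q"
      proof -
        have "16 * (exp (12 * H) * exp (- (4 * \<gamma> * \<tau>))) * (q * q) = 16"
          by (simp add: q_def exp_add[symmetric] algebra_simps)
        moreover have "(16 * exp (12 * H)) * exp (- (4 * \<gamma> * \<tau>)) * (q * q) < 1 * (q * q)"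
          using T2(2)[of \<tau>] \<tau> by (intro mult_strict_right_mono) (auto simp: T_def q_def)
        ultimately show ?thesis by (simp add: mult_ac)
      qed
      ultimately show False by simp
    qed
    ultimately show "c * exp (2 * \<tau> * (1 + X 1 - X e - \<sigma>)) \<le> (n e)\<^sup>2 \<and> 4 * (p e)\<^sup>2 \<le> (n e)\<^sup>2" by blast
  qed
qed

text \<open>The regular solution starts with \<open>p = n\<close>, on the boundary of the cone
  \<open>c = 1\<close>, so \<open>p\<close> dominates everywhere.\<close>

lemma regular_wave_growth:
  assumes w: "wave_pair \<tau> p n" and \<tau>: "\<tau> * gmin \<ge> 6 * H" and p0: "p 0 = 1" "n 0 = 1"
  shows "r \<in> {0..1} \<Longrightarrow> (n r)\<^sup>2 \<le> (p r)\<^sup>2"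
    "0 \<le> s \<Longrightarrow> s \<le> r \<Longrightarrow> r \<le> 1 \<Longrightarrow> (p s)\<^sup>2 * exp (2 * \<tau> * (X r - X s) - 4 * H) \<le> (p r)\<^sup>2"
proof -
  show np: "(n r)\<^sup>2 \<le> (p r)\<^sup>2" if "r \<in> {0..1}" for r
    using cone_antitone[OF w \<tau>, of 1 0 r] p0 that by auto
  assume "0 \<le> s" "s \<le> r" "r \<le> 1"
  then show "(p s)\<^sup>2 * exp (2 * \<tau> * (X r - X s) - 4 * H) \<le> (p r)\<^sup>2"
    using p_square_growth[OF w, of s r 1] np by (auto simp: abs_le_square_iff)
qed

section \<open>High-frequency asymptotics on the real axis\<close>

definition "q r = \<eta>1 r / (4 * \<eta> r * g r)"
definition "q1 r = (\<eta>2 r * (4 * \<eta> r * g r) - \<eta>1 r * (4 * (\<eta>1 r * g r + \<eta> r * (2 * h r * g r)))) / (4 * \<eta> r * g r)\<^sup>2"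

lemma dq: "x \<in> {0..1} \<Longrightarrow> (q has_real_derivative q1 x) (at x within {0..1})"
proof -
  assume x: "x \<in> {0..1}"
  have "4 * \<eta> x * g x \<noteq> 0" using pos[OF x] g_pos[OF x] by simp
  moreover have "((\<lambda>r. 4 * \<eta> r * g r) has_real_derivative 4 * (\<eta>1 x * g x + \<eta> x * (2 * h x * g x))) (at x within {0..1})"
    by (rule derivative_eq_intros d1 dg x refl)+ (simp add: algebra_simps)
  ultimately show ?thesis unfolding q_def[abs_def] q1_def power2_eq_square
    by (intro DERIV_divide d2 x)
qed

lemma cq1: "continuous_on {0..1} q1"
  unfolding q1_def using pos g_pos by (intro continuous_intros c0 c1 c2 cg ch) force

text \<open>First order WKB approximation. The derivative of the amplitude is a multiple of its fast
  oscillating counterpart with \<open>v - \<i> k g u\<close>, and that is integrated by parts.\<close>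
lemma wkb_real_axis:
  obtains K where "\<And>k u v M r s. k > 0 \<Longrightarrow> solves \<eta> (of_real k) u v \<Longrightarrow> M \<ge> 0 \<Longrightarrow>
      (\<And>t. t \<in> {0..1} \<Longrightarrow> (norm (v t))\<^sup>2 + (k * g t * norm (u t))\<^sup>2 \<le> M\<^sup>2) \<Longrightarrow> r \<in> {0..1} \<Longrightarrow> s \<in> {0..1} \<Longrightarrow>
      norm ((v r + \<i> * of_real (k * g r) * u r) * cis (- (k * X r)) * of_real (1 / sqrt (g r))
          - (v s + \<i> * of_real (k * g s) * u s) * cis (- (k * X s)) * of_real (1 / sqrt (g s))) \<le> K * M / k"
proof -
  have cq: "continuous_on {0..1} q"
    using dq by (meson has_field_derivative_imp_has_derivative has_derivative_continuous continuous_on_eq_continuous_within)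
  have "bounded (q ` {0..1})" "bounded (q1 ` {0..1})"
    using cq cq1 by (auto intro!: compact_imp_bounded compact_continuous_image)
  then obtain B1 B2 where B12: "B1 > 0" "\<And>x. x \<in> {0..1} \<Longrightarrow> \<bar>q x\<bar> \<le> B1" "B2 > 0" "\<And>x. x \<in> {0..1} \<Longrightarrow> \<bar>q1 x\<bar> \<le> B2"
    unfolding bounded_pos by auto
  define B where "B = max B1 B2"
  have B: "B > 0" "\<bar>q x\<bar> \<le> B" "\<bar>q1 x\<bar> \<le> B" if "x \<in> {0..1}" for x
    using B12(2)[OF that] B12(4)[OF that] B12(1) by (auto simp: B_def)
  have B0: "B > 0" using B12 by (simp add: B_def)
  define A where "A = 1 / sqrt gmin"
  have A: "A > 0" using gmin(1) by (simp add: A_def)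
  define \<rho> where "\<rho> r = 1 / sqrt (g r)" for r
  have \<rho>: "0 \<le> \<rho> r" "\<rho> r \<le> A" if "r \<in> {0..1}" for r
    using gmin(1) gmin(2)[OF that] g_pos[OF that] by (auto simp: \<rho>_def A_def frac_le)
  have d\<rho>: "(\<rho> has_real_derivative - h r * \<rho> r) (at r within {0..1})" if r: "r \<in> {0..1}" for r
  proof -
    have "((\<lambda>r. sqrt (g r)) has_real_derivative (inverse (sqrt (g r)) / 2) * (2 * h r * g r)) (at r within {0..1})"
      by (rule DERIV_chain2[where f = sqrt, OF _ dg[OF r]]) (use DERIV_real_sqrt[OF g_pos[OF r]] in auto)
    moreover have "(inverse (sqrt (g r)) / 2) * (2 * h r * g r) = h r * sqrt (g r)"
      using g_pos[OF r] by (simp add: field_simps real_sqrt_mult_self)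
    ultimately have ds: "((\<lambda>r. sqrt (g r)) has_real_derivative h r * sqrt (g r)) (at r within {0..1})" by (simp only:)
    have nz: "sqrt (g r) \<noteq> 0" using g_pos[OF r] by simp
    have "((\<lambda>r. 1 / sqrt (g r)) has_real_derivative (0 * sqrt (g r) - 1 * (h r * sqrt (g r))) / (sqrt (g r) * sqrt (g r))) (at r within {0..1})"
      by (rule DERIV_divide[OF DERIV_const ds nz])
    moreover have "(0 * x - 1 * (h r * x)) / (x * x) = - h r * (1 / x)" if "x \<noteq> 0" for x
      using that by (simp add: field_simps)
    note this[OF nz]
    ultimately show ?thesis unfolding \<rho>_def by (simp only:)
  qed
  define K where "K = A * B * (3 + H)"
  have qg: "q r * g r = h r" if "r \<in> {0..1}" for r
    using g_pos[OF that] pos[OF that] by (simp add: q_def h_def)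
  show ?thesis
  proof (rule that[of K])
    fix k M r s :: real and u v :: "real \<Rightarrow> complex"
    assume k: "k > 0" and sol: "solves \<eta> (of_real k) u v" and M: "M \<ge> 0"
      and bd: "\<And>t. t \<in> {0..1} \<Longrightarrow> (norm (v t))\<^sup>2 + (k * g t * norm (u t))\<^sup>2 \<le> M\<^sup>2"
      and r: "r \<in> {0..1}" and s: "s \<in> {0..1}"
    define p n where "p t = v t + \<i> * of_real (k * g t) * u t" and "n t = v t - \<i> * of_real (k * g t) * u t" for t
    have pn: "norm (p t) \<le> 2 * M" "norm (n t) \<le> 2 * M" if "t \<in> {0..1}" for t
      unfolding p_def n_def
      using norm_add_imaginary_le[OF bd[OF that] M, of "\<i> * of_real (k * g t) * u t"] k g_pos[OF that]
      by (auto simp: norm_mult abs_mult)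
    \<comment> \<open>The phase removes the free propagation of \<open>p\<close>, and
      \<open>1 / sqrt (g r)\<close>, with logarithmic derivative \<open>- h\<close>, removes the
      diagonal coupling. The derivative of \<open>P\<close> is then just
      \<open>- h N\<close>.\<close>
    define P N where "P t = p t * cis (- (k * X t)) * of_real (\<rho> t)" and "N t = n t * cis (- (k * X t)) * of_real (\<rho> t)" for t
    have PN: "norm (P t) \<le> 2 * M * A" "norm (N t) \<le> 2 * M * A" if "t \<in> {0..1}" for t
      unfolding P_def N_def using pn[OF that] \<rho>[OF that] M by (auto simp: norm_mult intro!: mult_mono)
    define C where "C = 1 / (2 * \<i> * of_real k)"
    have C: "norm C = 1 / (2 * k)" "C * (2 * \<i> * of_real k) = 1" using k by (auto simp: C_def norm_divide norm_mult)
    have dP: "(P has_vector_derivative - of_real (h t) * N t) (at t within {0..1})"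
      and dN: "(N has_vector_derivative - of_real (h t) * P t - 2 * \<i> * of_real (k * g t) * N t) (at t within {0..1})"
      if t: "t \<in> {0..1}" for t
    proof -
      note D = solvesD[OF sol t]
      have dG: "((\<lambda>t. complex_of_real (k * g t)) has_vector_derivative of_real (k * (2 * h t * g t))) (at t within {0..1})"
        by (intro has_vector_derivative_of_real DERIV_cmult dg t)
      have e: "((\<lambda>t. cis (- (k * X t))) has_vector_derivative \<i> * of_real (- (k * g t)) * cis (- (k * X t))) (at t within {0..1})"
        by (intro has_vector_derivative_cis DERIV_minus DERIV_cmult dX t)
      have \<rho>': "((\<lambda>t. complex_of_real (\<rho> t)) has_vector_derivative of_real (- h t * \<rho> t)) (at t within {0..1})"
        by (intro has_vector_derivative_of_real d\<rho> t)
      have gg: "complex_of_real (\<eta> t) = of_real (g t) * of_real (g t)"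
        using g_sq[OF t] by (simp add: power2_eq_square flip: of_real_mult)
      have dp: "(p has_vector_derivative \<i> * of_real (k * g t) * p t + of_real (h t) * (p t - n t)) (at t within {0..1})"
        unfolding p_def n_def
        by (rule has_vector_derivative_eq_rhs, (rule derivative_intros D dG)+) (simp add: gg power2_eq_square algebra_simps)
      have dn: "(n has_vector_derivative - (\<i> * of_real (k * g t) * n t) - of_real (h t) * (p t - n t)) (at t within {0..1})"
        unfolding p_def n_def
        by (rule has_vector_derivative_eq_rhs, (rule derivative_intros D dG)+) (simp add: gg power2_eq_square algebra_simps)
      show "(P has_vector_derivative - of_real (h t) * N t) (at t within {0..1})"
        unfolding P_def N_def
        by (rule has_vector_derivative_eq_rhs, (rule derivative_intros dp e \<rho>')+) (simp add: algebra_simps)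
      show "(N has_vector_derivative - of_real (h t) * P t - 2 * \<i> * of_real (k * g t) * N t) (at t within {0..1})"
        unfolding P_def N_def
        by (rule has_vector_derivative_eq_rhs, (rule derivative_intros dn e \<rho>')+) (simp add: algebra_simps)
    qed
    \<comment> \<open>As \<open>q = h / g\<close> and \<open>N\<close> oscillates with frequency
      \<open>2 k g\<close>, the derivative of \<open>C q N\<close> contains exactly the term
      \<open>- h N\<close>. Subtracting it leaves a derivative with the prefactor \<open>C\<close>,
      of size \<open>1 / (2 k)\<close>.\<close>
    define Q where "Q t = P t - C * (of_real (q t) * N t)" for t
    define Q' where "Q' t = C * (of_real (q t * h t) * P t - of_real (q1 t) * N t)" for t
    have dQ: "(Q has_vector_derivative Q' t) (at t within {0..1})" if t: "t \<in> {0..1}" for t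
    proof -
      have dqc: "((\<lambda>t. complex_of_real (q t)) has_vector_derivative of_real (q1 t)) (at t within {0..1})"
        by (intro has_vector_derivative_of_real dq t)
      have hq: "complex_of_real (h t) = of_real (q t) * of_real (g t)" using qg[OF t] by (simp flip: of_real_mult)
      have "(Q has_vector_derivative - of_real (h t) * N t
          - C * (of_real (q t) * (- of_real (h t) * P t - 2 * \<i> * of_real (k * g t) * N t) + of_real (q1 t) * N t)) (at t within {0..1})"
        unfolding Q_def by (rule has_vector_derivative_eq_rhs, (rule derivative_intros dP dN dqc t)+) simp
      moreover have "- of_real (h t) * N t
          - C * (of_real (q t) * (- of_real (h t) * P t - 2 * \<i> * of_real (k * g t) * N t) + of_real (q1 t) * N t)
         = Q' t + (C * (2 * \<i> * of_real k) - 1) * (of_real (q t) * of_real (g t) * N t)"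
        unfolding Q'_def hq of_real_mult by (simp add: algebra_simps)
      ultimately show ?thesis by (simp add: C(2))
    qed
    have nQ': "norm (Q' t) \<le> A * B * (1 + H) * M / k" if t: "t \<in> {0..1}" for t
    proof -
      have 1: "norm (of_real (q t * h t) * P t) \<le> B * H * (2 * M * A)"
        unfolding norm_mult norm_of_real abs_mult
        using B0 B(2)[OF t] H(1) H(2)[OF t] PN(1)[OF t] by (intro mult_mono) auto
      have 2: "norm (of_real (q1 t) * N t) \<le> B * (2 * M * A)"
        unfolding norm_mult norm_of_real using B0 B(3)[OF t] PN(2)[OF t] by (intro mult_mono) auto
      have "norm (Q' t) = 1 / (2 * k) * norm (of_real (q t * h t) * P t - of_real (q1 t) * N t)"
        by (simp add: Q'_def norm_mult C(1))
      also have "\<dots> \<le> 1 / (2 * k) * (B * H * (2 * M * A) + B * (2 * M * A))"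
        using k 1 2 by (intro mult_left_mono order_trans[OF norm_triangle_ineq4]) auto
      also have "\<dots> = A * B * (1 + H) * M / k" using k by (simp add: field_simps)
      finally show ?thesis .
    qed
    have QP: "norm (Q t - P t) \<le> A * B * M / k" if t: "t \<in> {0..1}" for t
    proof -
      have "norm (Q t - P t) = 1 / (2 * k) * (\<bar>q t\<bar> * norm (N t))" by (simp add: Q_def norm_mult C(1))
      also have "\<dots> \<le> 1 / (2 * k) * (B * (2 * M * A))"
        using k B0 B(2)[OF t] PN(2)[OF t] by (intro mult_left_mono mult_mono) auto
      finally show ?thesis using k by (simp add: field_simps)
    qed
    have "norm (Q r - Q s) \<le> A * B * (1 + H) * M / k * norm (r - s)"
      by (rule differentiable_bound[of "{0..1}" Q "\<lambda>t x. x *\<^sub>R Q' t"])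
         (use dQ nQ' r s in \<open>auto simp: has_vector_derivative_def onorm_scaleR_left onorm_id intro!: onorm_le\<close>)
    also have "\<dots> \<le> A * B * (1 + H) * M / k * 1"
      using A B0 H(1) M k r s by (intro mult_left_mono) auto
    finally have QQ: "norm (Q r - Q s) \<le> A * B * (1 + H) * M / k" by simp
    have "P r - P s = (Q r - Q s) - (Q r - P r) + (Q s - P s)" by simp
    then have "norm (P r - P s) \<le> norm (Q r - Q s) + norm (Q r - P r) + norm (Q s - P s)"
      by (metis norm_triangle_ineq norm_triangle_ineq4 add_right_mono order_trans)
    also have "\<dots> \<le> A * B * (1 + H) * M / k + A * B * M / k + A * B * M / k"
      using QQ QP[OF r] QP[OF s] by linarith
    also have "\<dots> = K * M / k" using k by (simp add: K_def field_simps)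
    finally show "norm ((v r + \<i> * of_real (k * g r) * u r) * cis (- (k * X r)) * of_real (1 / sqrt (g r))
          - (v s + \<i> * of_real (k * g s) * u s) * cis (- (k * X s)) * of_real (1 / sqrt (g s))) \<le> K * M / k"
      by (simp only: P_def p_def \<rho>_def)
  qed
qed

end

section \<open>The characteristic function\<close>

definition exp_type :: "(complex \<Rightarrow> complex) \<Rightarrow> bool" where
  "exp_type f \<longleftrightarrow> (\<exists>K. \<forall>z. norm (f z) \<le> exp (K * (1 + norm z)))"

lemma exp_typeI_scaled:
  assumes "\<And>z. norm (f z) \<le> B * exp (K * (1 + norm z))"
  shows "exp_type f"
  unfolding exp_type_def
proof (intro exI allI)
  fix z :: complex
  have "B \<le> exp \<bar>B\<bar>" using exp_ge_add_one_self[of "\<bar>B\<bar>"] by linarith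
  also have "\<dots> \<le> exp (\<bar>B\<bar> * (1 + norm z))" by (simp add: mult_le_cancel_left1)
  finally have "B * exp (K * (1 + norm z)) \<le> exp (\<bar>B\<bar> * (1 + norm z)) * exp (K * (1 + norm z))"
    by (intro mult_right_mono) auto
  with assms[of z] show "norm (f z) \<le> exp ((\<bar>B\<bar> + K) * (1 + norm z))"
    by (simp add: exp_add[symmetric] distrib_right)
qed

lemma exp_type_const: "exp_type (\<lambda>_. c)"
  by (rule exp_typeI_scaled[of _ "norm c" 0]) simp

lemma exp_type_mult:
  assumes "exp_type f" "exp_type g"
  shows "exp_type (\<lambda>z. f z * g z)"
proof -
  obtain K1 K2 where K: "\<And>z. norm (f z) \<le> exp (K1 * (1 + norm z))" "\<And>z. norm (g z) \<le> exp (K2 * (1 + norm z))"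
    using assms unfolding exp_type_def by blast
  have "norm (f z * g z) \<le> exp ((K1 + K2) * (1 + norm z))" for z
    using mult_mono[OF K(1)[of z] K(2)[of z]] by (simp add: norm_mult exp_add distrib_right)
  then show ?thesis unfolding exp_type_def by blast
qed

lemma exp_type_add:
  assumes "exp_type f" "exp_type g"
  shows "exp_type (\<lambda>z. f z + g z)"
proof -
  obtain K1 K2 where K: "\<And>z. norm (f z) \<le> exp (K1 * (1 + norm z))" "\<And>z. norm (g z) \<le> exp (K2 * (1 + norm z))"
    using assms unfolding exp_type_def by blast
  have "norm (f z + g z) \<le> 2 * exp (max K1 K2 * (1 + norm z))" for z
  proof -
    have "exp (K1 * (1 + norm z)) \<le> exp (max K1 K2 * (1 + norm z))" "exp (K2 * (1 + norm z)) \<le> exp (max K1 K2 * (1 + norm z))"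
      by (auto intro!: mult_right_mono)
    then show ?thesis using K(1)[of z] K(2)[of z] norm_triangle_ineq[of "f z" "g z"] by linarith
  qed
  then show ?thesis by (rule exp_typeI_scaled)
qed

lemma exp_type_minus: "exp_type f \<Longrightarrow> exp_type (\<lambda>z. - f z)"
  by (simp add: exp_type_def)

lemma exp_type_diff: "exp_type f \<Longrightarrow> exp_type g \<Longrightarrow> exp_type (\<lambda>z. f z - g z)"
  using exp_type_add[of f "\<lambda>z. - g z"] exp_type_minus[of g] by simp

lemma half_sum_le: "(a::real) \<le> e \<Longrightarrow> b \<le> e \<Longrightarrow> (a + b) / 2 \<le> e" by simp

lemma exp_type_cos: "exp_type cos"
proof (rule exp_typeI_scaled[of _ 1 1])
  fix z :: complex
  have "norm (cos z) \<le> (norm (exp (\<i> * z)) + norm (exp (- (\<i> * z)))) / 2"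
    unfolding cos_exp_eq using norm_triangle_ineq[of "exp (\<i> * z)" "exp (- (\<i> * z))"] by (simp add: norm_divide)
  also have "\<dots> \<le> exp (norm z)"
    using norm_exp[of "\<i> * z"] norm_exp[of "- (\<i> * z)"]
    unfolding norm_minus_cancel norm_mult norm_ii mult_1 by (rule half_sum_le)
  finally have "norm (cos z) \<le> exp (norm z)" .
  also have "\<dots> \<le> exp (1 * (1 + norm z))" by simp
  finally show "norm (cos z) \<le> 1 * exp (1 * (1 + norm z))" by simp
qed

lemma exp_type_sin: "exp_type sin"
proof (rule exp_typeI_scaled[of _ 1 1])
  fix z :: complex
  have "norm (sin z) \<le> (norm (exp (\<i> * z)) + norm (exp (- (\<i> * z)))) / 2"
    unfolding sin_exp_eq using norm_triangle_ineq4[of "exp (\<i> * z)" "exp (- (\<i> * z))"] by (simp add: norm_divide norm_mult)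
  also have "\<dots> \<le> exp (norm z)"
    using norm_exp[of "\<i> * z"] norm_exp[of "- (\<i> * z)"]
    unfolding norm_minus_cancel norm_mult norm_ii mult_1 by (rule half_sum_le)
  finally have "norm (sin z) \<le> exp (norm z)" .
  also have "\<dots> \<le> exp (1 * (1 + norm z))" by simp
  finally show "norm (sin z) \<le> 1 * exp (1 * (1 + norm z))" by simp
qed

lemma sinc_holomorphic: "sinc holomorphic_on UNIV"
proof -
  have "deriv sin (0::complex) = 1" using DERIV_imp_deriv[OF DERIV_sin[of "0::complex"]] by simp
  then have "sinc = (\<lambda>z. if z = 0 then deriv sin 0 else (sin z - sin 0) / (z - 0))"
    by (auto simp: sinc_def)
  then show ?thesis using pole_lemma[OF holomorphic_on_sin, of 0 UNIV] by simp
qed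

lemma sinc_mult: "k * sinc k = sin k" by (simp add: sinc_def)

lemma exp_type_sinc: "exp_type sinc"
proof -
  have "compact (sinc ` cball 0 1)"
    using holomorphic_on_imp_continuous_on[OF sinc_holomorphic]
    by (intro compact_continuous_image) (auto intro: continuous_on_subset)
  then have "bounded (sinc ` cball 0 1)" by (rule compact_imp_bounded)
  then obtain B where B0: "B > 0" "\<forall>x\<in>sinc ` cball 0 1. norm x \<le> B" unfolding bounded_pos by blast
  then have B: "B > 0" "\<And>z. norm z \<le> 1 \<Longrightarrow> norm (sinc z) \<le> B" by auto
  obtain K where K: "\<And>z. norm (sin z :: complex) \<le> exp (K * (1 + norm z))" using exp_type_sin unfolding exp_type_def by blast
  have "norm (sinc z) \<le> max B 1 * exp (\<bar>K\<bar> * (1 + norm z))" for z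
  proof (cases "norm z \<le> 1")
    case True
    have "norm (sinc z) \<le> B * 1" using B(2)[OF True] by simp
    also have "\<dots> \<le> max B 1 * exp (\<bar>K\<bar> * (1 + norm z))" using B(1) by (intro mult_mono) auto
    finally show ?thesis .
  next
    case False
    have "1 * norm (sinc z) \<le> norm z * norm (sinc z)" using False by (intro mult_right_mono) auto
    also have "\<dots> = norm (sin z)" using sinc_mult[of z] by (metis norm_mult)
    also have "\<dots> \<le> exp (K * (1 + norm z))" by (rule K)
    also have "\<dots> \<le> exp (\<bar>K\<bar> * (1 + norm z))" by (auto intro!: mult_right_mono)
    also have "\<dots> \<le> max B 1 * exp (\<bar>K\<bar> * (1 + norm z))" by (simp add: mult_le_cancel_right1)
    finally show ?thesis by simp
  qed
  then show ?thesis by (rule exp_typeI_scaled)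
qed

lemma sinc_even: "sinc (- k) = sinc k" by (simp add: sinc_def)

text \<open>The choice fixes one family for each set of data, so that evenness and exponential type
  are proved once for \<open>y\<close>, \<open>S\<close> and the transfer matrices.\<close>

definition sol_pair :: "(real \<Rightarrow> real) \<Rightarrow> real \<Rightarrow> (complex \<Rightarrow> complex) \<Rightarrow> (complex \<Rightarrow> complex) \<Rightarrow>
    (complex \<Rightarrow> real \<Rightarrow> complex) \<times> (complex \<Rightarrow> real \<Rightarrow> complex)" where
  "sol_pair eta s al be = (SOME (u, v). (\<forall>k. solves eta k (u k) (v k) \<and> u k s = al k \<and> v k s = be k) \<and>
     (\<forall>r\<in>{0..1}. (\<lambda>k. u k r) holomorphic_on UNIV \<and> (\<lambda>k. v k r) holomorphic_on UNIV))"

definition "sol eta s al be = fst (sol_pair eta s al be)"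
definition "sol' eta s al be = snd (sol_pair eta s al be)"

lemma sol_props:
  assumes cont: "continuous_on {0..1} eta" and s: "s \<in> {0..1}" and ab: "al holomorphic_on UNIV" "be holomorphic_on UNIV"
  shows "solves eta k (sol eta s al be k) (sol' eta s al be k)" "sol eta s al be k s = al k" "sol' eta s al be k s = be k"
    "r \<in> {0..1} \<Longrightarrow> (\<lambda>k. sol eta s al be k r) holomorphic_on UNIV" "r \<in> {0..1} \<Longrightarrow> (\<lambda>k. sol' eta s al be k r) holomorphic_on UNIV"
proof -
  obtain u v where uv: "\<And>k. solves eta k (u k) (v k)" "\<And>k. u k s = al k" "\<And>k. v k s = be k"
    "\<And>r. r \<in> {0..1} \<Longrightarrow> (\<lambda>k. u k r) holomorphic_on UNIV" "\<And>r. r \<in> {0..1} \<Longrightarrow> (\<lambda>k. v k r) holomorphic_on UNIV"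
    by (rule solution_family[OF cont s ab]) blast
  define P where "P = (\<lambda>(u, v). (\<forall>k. solves eta k (u k) (v k) \<and> u k s = al k \<and> v k s = be k) \<and>
     (\<forall>r\<in>{0..1}. (\<lambda>k. u k r) holomorphic_on UNIV \<and> (\<lambda>k. v k r) holomorphic_on UNIV))"
  have "P (u, v)" unfolding P_def using uv by simp
  then have "P (sol_pair eta s al be)" unfolding sol_pair_def P_def[symmetric] by (rule someI)
  then show "solves eta k (sol eta s al be k) (sol' eta s al be k)" "sol eta s al be k s = al k" "sol' eta s al be k s = be k"
    "r \<in> {0..1} \<Longrightarrow> (\<lambda>k. sol eta s al be k r) holomorphic_on UNIV" "r \<in> {0..1} \<Longrightarrow> (\<lambda>k. sol' eta s al be k r) holomorphic_on UNIV"
    by (auto simp: P_def sol_def sol'_def case_prod_beta)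
qed

lemma sol_even:
  assumes cont: "continuous_on {0..1} eta" and s: "s \<in> {0..1}" and ab: "al holomorphic_on UNIV" "be holomorphic_on UNIV"
    and ev: "al (- k) = al k" "be (- k) = be k" and r: "r \<in> {0..1}"
  shows "sol eta s al be (- k) r = sol eta s al be k r" "sol' eta s al be (- k) r = sol' eta s al be k r"
proof -
  have "solves eta k (sol eta s al be (- k)) (sol' eta s al be (- k))"
    using sol_props(1)[OF cont s ab, of "- k"] by (simp add: solves_def)
  from solves_unique[OF cont this sol_props(1)[OF cont s ab] s _ _ r]
  show "sol eta s al be (- k) r = sol eta s al be k r" "sol' eta s al be (- k) r = sol' eta s al be k r"
    using sol_props(2,3)[OF cont s ab] ev by auto
qed

lemma sol_exp_type:
  assumes cont: "continuous_on {0..1} eta" and s: "s \<in> {0..1}" and ab: "al holomorphic_on UNIV" "be holomorphic_on UNIV"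
    and et: "exp_type al" "exp_type be" and r: "r \<in> {0..1}"
  shows "exp_type (\<lambda>k. sol eta s al be k r)" "exp_type (\<lambda>k. sol' eta s al be k r)"
proof -
  have "bounded (eta ` {0..1})" using cont by (intro compact_imp_bounded compact_continuous_image) auto
  then obtain M where M: "M > 0" "\<And>x. x \<in> {0..1} \<Longrightarrow> \<bar>eta x\<bar> \<le> M" unfolding bounded_pos by auto
  obtain K1 K2 where K: "\<And>z. norm (al z) \<le> exp (K1 * (1 + norm z))" "\<And>z. norm (be z) \<le> exp (K2 * (1 + norm z))"
    using et unfolding exp_type_def by blast
  define K where "K = max K1 K2"
  define L where "L = (2 * K + 2 + (M + 1)) / 2"
  have main: "norm (sol eta s al be k r) \<le> exp (L * (1 + norm k)) \<and> norm (sol' eta s al be k r) \<le> exp (L * (1 + norm k))" for k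
  proof -
    define x where "x = norm k"
    have x: "x \<ge> 0" by (simp add: x_def)
    let ?E = "\<lambda>r. (norm (sol' eta s al be k r))\<^sup>2 + (1 + x\<^sup>2) * (norm (sol eta s al be k r))\<^sup>2"
    have mono: "exp (K1 * (1 + x)) \<le> exp (K * (1 + x))" "exp (K2 * (1 + x)) \<le> exp (K * (1 + x))"
      using x by (auto simp: K_def intro!: mult_right_mono)
    have ab1: "norm (al k) \<le> exp (K * (1 + x))" "norm (be k) \<le> exp (K * (1 + x))"
      using K(1)[of k] K(2)[of k] mono unfolding x_def by linarith+
    have e2: "(exp (K * (1 + x)))\<^sup>2 = exp (2 * K * (1 + x))" by (simp add: power2_eq_square exp_add[symmetric])
    have ab2: "(norm (al k))\<^sup>2 \<le> exp (2 * K * (1 + x))" "(norm (be k))\<^sup>2 \<le> exp (2 * K * (1 + x))"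
      using power_mono[OF ab1(1), of 2] power_mono[OF ab1(2), of 2] e2 by auto
    have "?E r \<le> ?E s * exp ((M + 1) * (1 + x))"
      unfolding x_def by (rule solves_exp_bound[OF sol_props(1)[OF cont s ab] M(2) r s])
    also have "?E s \<le> exp (2 * K * (1 + x)) + (1 + x\<^sup>2) * exp (2 * K * (1 + x))"
      using ab2 by (simp add: sol_props(2,3)[OF cont s ab] add_mono mult_left_mono)
    also have "\<dots> = (2 + x\<^sup>2) * exp (2 * K * (1 + x))" by (simp add: algebra_simps)
    also have "\<dots> \<le> exp (2 * (1 + x)) * exp (2 * K * (1 + x))"
    proof (rule mult_right_mono)
      have "2 + x\<^sup>2 \<le> (1 + (1 + x))\<^sup>2" using x by (simp add: power2_eq_square algebra_simps)
      also have "\<dots> \<le> (exp (1 + x))\<^sup>2" using x by (intro power_mono exp_ge_add_one_self) auto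
      also have "\<dots> = exp (2 * (1 + x))" by (simp add: exp_double[symmetric])
      finally show "2 + x\<^sup>2 \<le> exp (2 * (1 + x))" .
    qed simp
    finally have "?E r \<le> exp (2 * (1 + x)) * exp (2 * K * (1 + x)) * exp ((M + 1) * (1 + x))" by simp
    also have "\<dots> = (exp (L * (1 + x)))\<^sup>2"
      by (simp add: exp_double[symmetric] exp_add[symmetric] L_def field_simps)
    finally have E: "?E r \<le> (exp (L * (1 + x)))\<^sup>2" .
    have "(norm (sol' eta s al be k r))\<^sup>2 \<le> ?E r" by simp
    moreover have "(norm (sol eta s al be k r))\<^sup>2 \<le> ?E r" by (simp add: algebra_simps)
    ultimately show ?thesis using E unfolding x_def[symmetric]
      by (meson order_trans power2_le_imp_le exp_ge_zero)
  qed
  then show "exp_type (\<lambda>k. sol eta s al be k r)" "exp_type (\<lambda>k. sol' eta s al be k r)"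
    unfolding exp_type_def by blast+
qed

lemma char_fun_eq:
  assumes "continuous_on {0..1} eta" "solves eta k y y'" "y 0 = 0" "y' 0 = 1"
  shows "char_fun eta k = y' 1 * sinc k - y 1 * cos k"
  unfolding char_fun_def
proof (rule the_equality)
  show "\<exists>Y Y'. is_sol eta k Y Y' \<and> y' 1 * sinc k - y 1 * cos k = Y' 1 * sinc k - Y 1 * cos k"
    using assms by (auto simp: is_sol_def solves_def)
  fix v assume "\<exists>Y Y'. is_sol eta k Y Y' \<and> v = Y' 1 * sinc k - Y 1 * cos k"
  then obtain Y Y' where Y: "is_sol eta k Y Y'" "v = Y' 1 * sinc k - Y 1 * cos k" by blast
  then have "solves eta k Y Y'" "Y 0 = 0" "Y' 0 = 1" by (auto simp: is_sol_def solves_def)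
  then have "Y 1 = y 1" "Y' 1 = y' 1"
    using solves_unique[OF assms(1), of k Y Y' y y' 0 1] assms by auto
  then show "v = y' 1 * sinc k - y 1 * cos k" using Y by simp
qed

lemma char_fun_entire:
  assumes cont: "continuous_on {0..1} eta"
  shows "char_fun eta holomorphic_on UNIV" "exp_type (char_fun eta)" "char_fun eta (- k) = char_fun eta k"
proof -
  note P = sol_props[OF cont, of 0 "\<lambda>_. 0" "\<lambda>_. 1", simplified]
  have eq: "char_fun eta = (\<lambda>k. sol' eta 0 (\<lambda>_. 0) (\<lambda>_. 1) k 1 * sinc k - sol eta 0 (\<lambda>_. 0) (\<lambda>_. 1) k 1 * cos k)"
    using char_fun_eq[OF cont] P(1-3) by blast
  show "char_fun eta holomorphic_on UNIV" unfolding eq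
    by (intro holomorphic_intros sinc_holomorphic P(4,5)) auto
  show "exp_type (char_fun eta)" unfolding eq
    by (intro exp_type_diff exp_type_mult exp_type_sinc exp_type_cos sol_exp_type[OF cont] exp_type_const) (auto intro!: holomorphic_intros)
  show "char_fun eta (- k) = char_fun eta k" unfolding eq
    using sol_even[OF cont, of 0 "\<lambda>_. 0" "\<lambda>_. 1" k 1] by (simp add: sinc_even)
qed

section \<open>Entire functions with the same zeros\<close>

lemma factor_order_of_zero:
  assumes f: "f holomorphic_on UNIV" and z: "\<And>j. j < n \<Longrightarrow> (deriv ^^ j) f z = 0" and nz: "(deriv ^^ n) f z \<noteq> 0"
  obtains r F where "r > 0" "F holomorphic_on ball z r" "\<And>w. w \<in> ball z r \<Longrightarrow> f w = (w - z) ^ n * F w" "\<And>w. w \<in> ball z r \<Longrightarrow> F w \<noteq> 0"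
proof (cases "n = 0")
  case True
  have "continuous (at z) f" using f by (simp add: holomorphic_on_imp_differentiable_at field_differentiable_imp_continuous_at)
  then obtain r where "r > 0" "\<And>w. dist z w < r \<Longrightarrow> f w \<noteq> 0"
    using continuous_at_avoid[of z f 0] nz True by auto
  then show ?thesis using True f by (intro that[of r f]) (auto intro: holomorphic_on_subset)
next
  case False
  obtain g r where "0 < r" "g holomorphic_on ball z r" "\<And>w. w \<in> ball z r \<Longrightarrow> f w - f z = (w - z) ^ n * g w" "\<And>w. w \<in> ball z r \<Longrightarrow> g w \<noteq> 0"
    by (rule holomorphic_factor_order_of_zero[OF f open_UNIV _ _ nz]) (use z False in auto)
  then show ?thesis using z[of 0] False by (intro that[of r g]) auto
qed

lemma same_zeros_quotient:
  assumes f: "f holomorphic_on UNIV" and g: "g holomorphic_on UNIV" and same: "same_zeros_mult f g" and g0: "g z0 \<noteq> 0"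
  obtains h where "h holomorphic_on UNIV" "\<And>z. h z \<noteq> 0" "\<And>z. f z = h z * g z"
proof -
  \<comment> \<open>Limits extend \<open>f / g\<close> over the zeros of \<open>g\<close> by a
    formula free of the local factorisations, so the local pieces need no gluing.\<close>
  define h where "h z = Lim (at z) (\<lambda>w. f w / g w)" for z
  have loc: "\<exists>r q. r > 0 \<and> q holomorphic_on ball z r \<and> (\<forall>w\<in>ball z r. q w \<noteq> 0 \<and> h w = q w \<and> f w = q w * g w)" for z
  proof -
    have "\<exists>n. (deriv ^^ n) g z \<noteq> 0"
      using holomorphic_fun_eq_0_on_connected[OF g open_UNIV connected_UNIV, of z z0] g0 by auto
    define n where "n = (LEAST n. (deriv ^^ n) g z \<noteq> 0)"
    have gn: "(deriv ^^ n) g z \<noteq> 0" "\<And>j. j < n \<Longrightarrow> (deriv ^^ j) g z = 0"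
      using LeastI_ex[OF \<open>\<exists>n. _\<close>] not_less_Least unfolding n_def by auto
    have fn: "\<And>j. j < n \<Longrightarrow> (deriv ^^ j) f z = 0" using same gn(2) unfolding same_zeros_mult_def by blast
    \<comment> \<open>The hypothesis speaks of multiplicity at least \<open>n\<close>. Used at
      \<open>n\<close> and at \<open>Suc n\<close> it gives equal orders, including order 0.\<close>
    have "\<not> (\<forall>j<Suc n. (deriv ^^ j) g z = 0)" using gn(1) by auto
    then have "\<not> (\<forall>j<Suc n. (deriv ^^ j) f z = 0)" using same unfolding same_zeros_mult_def by blast
    then have fn': "(deriv ^^ n) f z \<noteq> 0" using fn less_Suc_eq by auto
    obtain r1 F where F: "r1 > 0" "F holomorphic_on ball z r1" "\<And>w. w \<in> ball z r1 \<Longrightarrow> f w = (w - z) ^ n * F w" "\<And>w. w \<in> ball z r1 \<Longrightarrow> F w \<noteq> 0"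
      by (rule factor_order_of_zero[OF f fn fn']) blast+
    obtain r2 G where G: "r2 > 0" "G holomorphic_on ball z r2" "\<And>w. w \<in> ball z r2 \<Longrightarrow> g w = (w - z) ^ n * G w" "\<And>w. w \<in> ball z r2 \<Longrightarrow> G w \<noteq> 0"
      by (rule factor_order_of_zero[OF g gn(2,1)]) blast+
    define r where "r = min r1 r2"
    define q where "q w = F w / G w" for w
    have sub: "ball z r \<subseteq> ball z r1" "ball z r \<subseteq> ball z r2" by (auto simp: r_def)
    have q: "q holomorphic_on ball z r"
      unfolding q_def using F(2) G(2,4) sub by (intro holomorphic_intros) (auto intro: holomorphic_on_subset)
    have fg: "f w = q w * g w" "q w \<noteq> 0" if "w \<in> ball z r" for w
      using F(3,4)[of w] G(3,4)[of w] subsetD[OF sub(1) that] subsetD[OF sub(2) that] by (auto simp: q_def)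
    have "h w = q w" if w: "w \<in> ball z r" for w
    proof -
      have "(q \<longlongrightarrow> q w) (at w)"
        using q w by (metis continuous_on_eq_continuous_at holomorphic_on_imp_continuous_on isContD open_ball)
      moreover have "\<forall>\<^sub>F x in at w. q x = f x / g x"
      proof -
        have 1: "\<forall>\<^sub>F x in at w. x \<in> ball z r" by (rule eventually_at_in_open'[OF open_ball w])
        have 2: "\<forall>\<^sub>F x in at w. x \<noteq> z"
        proof (cases "w = z")
          case False
          then show ?thesis using eventually_at_in_open'[of "- {z}" w] by (auto elim: eventually_mono)
        qed (auto simp: eventually_at_filter)
        show ?thesis using 1 2
        proof eventually_elim
          case (elim x)
          then have "g x \<noteq> 0" using G(3,4)[of x] subsetD[OF sub(2), of x] by auto
          then show ?case using fg(1)[of x] elim by simp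
        qed
      qed
      ultimately have "((\<lambda>x. f x / g x) \<longlongrightarrow> q w) (at w)" using tendsto_cong by force
      then show ?thesis unfolding h_def by (intro tendsto_Lim) auto
    qed
    then show ?thesis using q fg F(1) G(1) by (intro exI[of _ r] exI[of _ q]) (auto simp: r_def)
  qed
  show ?thesis
  proof (rule that[of h])
    show "h holomorphic_on UNIV"
      unfolding holomorphic_on_def
    proof
      fix z :: complex
      obtain r q where rq: "r > 0" "q holomorphic_on ball z r" "\<forall>w\<in>ball z r. h w = q w" using loc[of z] by blast
      then have "h holomorphic_on ball z r" by (metis holomorphic_transform)
      then show "h field_differentiable at z within UNIV" using rq(1) by (simp add: holomorphic_on_imp_differentiable_at)
    qed
    show "h z \<noteq> 0" "f z = h z * g z" for z using loc[of z] by (metis centre_in_ball)+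
  qed
qed

lemma same_zeros_proportional:
  assumes f: "f holomorphic_on UNIV" "exp_type f" "\<And>z. f (- z) = f z"
    and g: "g holomorphic_on UNIV" "exp_type g" "\<And>z. g (- z) = g z"
    and same: "same_zeros_mult f g" and g0: "g z0 \<noteq> 0"
  obtains c where "c \<noteq> 0" "\<And>z. f z = c * g z"
proof -
  obtain h where h: "h holomorphic_on UNIV" "\<And>z. h z \<noteq> 0" "\<And>z. f z = h z * g z"
    by (rule same_zeros_quotient[OF f(1) g(1) same g0]) blast
  obtain K1 K2 where K: "\<And>z. norm (f z) \<le> exp (K1 * (1 + norm z))" "\<And>z. norm (g z) \<le> exp (K2 * (1 + norm z))"
    using f(2) g(2) unfolding exp_type_def by blast
  define K where "K = max K1 K2"
  have mono: "exp (K1 * (1 + norm z)) \<le> exp (K * (1 + norm z))" "exp (K2 * (1 + norm z)) \<le> exp (K * (1 + norm z))" for z :: complex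
    by (auto simp: K_def intro!: mult_right_mono)
  obtain K' where K': "\<And>z. norm (h z) \<le> exp (K' * (1 + norm z))"
    using quotient_exp_type[OF h(1) g(1) g0, of K] K mono h(3) by (metis order_trans)
  have even: "h (- z) = h z" for z
  proof -
    \<comment> \<open>Evenness of \<open>f\<close> and \<open>g\<close> only gives
      \<open>(h (- w) - h w) * g w = 0\<close>. Were the first factor non-zero somewhere,
      \<open>g\<close> would vanish on a ball and hence everywhere.\<close>
    have diff0: "h (- w) - h w = 0" for w
    proof (rule ccontr)
      assume ne: "h (- w) - h w \<noteq> 0"
      have hd: "(\<lambda>w. h (- w) - h w) holomorphic_on UNIV"
        by (intro holomorphic_intros h(1) holomorphic_on_compose_gen[OF _ h(1), unfolded o_def]) auto
      have prod: "(h (- w) - h w) * g w = 0" for w using f(3)[of w] h(3)[of w] h(3)[of "- w"] g(3)[of w] by (simp add: algebra_simps)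
      have "continuous (at w) (\<lambda>w. h (- w) - h w)"
        using holomorphic_on_imp_differentiable_at[OF hd] by (simp add: field_differentiable_imp_continuous_at)
      then obtain r where r: "r > 0" "\<And>x. dist w x < r \<Longrightarrow> h (- x) - h x \<noteq> 0"
        using continuous_at_avoid[of w "\<lambda>w. h (- w) - h w" 0] ne by blast
      then have "g x = 0" if "x \<in> ball w r" for x using prod[of x] that by auto
      then have "g z0 = 0"
        using analytic_continuation_open[of "ball w r" UNIV g "\<lambda>_. 0" z0] r g(1) by auto
      then show False using g0 by simp
    qed
    then show ?thesis using diff0[of z] by simp
  qed
  have "h z = h 0" for z by (rule even_zero_free_exp_type_constant[OF h(1,2) even K'])
  then show ?thesis using h(2)[of 0] h(3) by (intro that[of "h 0"]) metis+
qed

text \<open>\<open>D (m + 2)\<close> is continuous and non-zero at 1, hence zero-free just to the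
  left of 1. The derivatives of orders 1 to m+1 vanish at 1, so the mean value theorem passes this
  property down to \<open>D 1\<close> on the same interval.\<close>

lemma admissible_medium:
  assumes "admissible m eta"
  obtains e1 e2 \<delta> where "medium eta e1 e2" "eta 1 = 1" "\<delta> > 0" "\<And>x. x \<in> {1 - \<delta><..<1} \<Longrightarrow> e1 x \<noteq> 0"
proof -
  obtain D where pos: "\<forall>x\<in>{0..1}. eta x > 0" and W: "W2_derivs (m + 3) eta D" and D0: "D 0 1 = 1"
    and Du: "\<forall>u\<in>{1..m+1}. D u 1 = 0" and Dm: "D (m + 2) 1 \<noteq> 0"
    using assms unfolding admissible_def by blast
  have De: "\<And>x. x \<in> {0..1} \<Longrightarrow> D 0 x = eta x" using W by (auto simp: W2_derivs_def)
  have Dd: "(D j has_real_derivative D (Suc j) x) (at x within {0..1})" if "j < m + 2" "x \<in> {0..1}" for j x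
    using W that by (auto simp: W2_derivs_def)
  obtain gg where gg0: "gg absolutely_integrable_on {0..1}"
    "\<forall>x\<in>{0..1}. D (m + 3 - 1) x = D (m + 3 - 1) 0 + integral {0..x} gg"
    using W unfolding W2_derivs_def by blast
  have "m + 3 - 1 = m + 2" by simp
  then have gg: "gg absolutely_integrable_on {0..1}" "\<And>x. x \<in> {0..1} \<Longrightarrow> D (m + 2) x = D (m + 2) 0 + integral {0..x} gg"
    using gg0 by (simp_all only:)
  have cm: "continuous_on {0..1} (D (m + 2))"
  proof -
    have "gg integrable_on {0..1}" using gg(1) by (simp add: absolutely_integrable_on_def)
    then have "continuous_on {0..1} (\<lambda>x. D (m + 2) 0 + integral {0..x} gg)"
      by (intro continuous_intros indefinite_integral_continuous_1)
    then show ?thesis by (rule continuous_on_eq) (rule gg(2)[symmetric])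
  qed
  have cD: "continuous_on {0..1} (D j)" if "j \<le> m + 2" for j
  proof (cases "j = m + 2")
    case False
    then have "\<forall>x\<in>{0..1}. (D j has_real_derivative D (Suc j) x) (at x within {0..1})" using Dd that by auto
    then show ?thesis by (meson has_field_derivative_imp_has_derivative has_derivative_continuous continuous_on_eq_continuous_within)
  qed (use cm in simp)
  have med: "medium eta (D 1) (D 2)"
  proof
    show "eta x > 0" if "x \<in> {0..1}" for x using pos that by blast
    show "(eta has_real_derivative D 1 x) (at x within {0..1})" if x: "x \<in> {0..1}" for x
    proof -
      have "(D 0 has_real_derivative D 1 x) (at x within {0..1})" using Dd[of 0 x] x by simp
      then show ?thesis unfolding has_field_derivative_def
        using De by (intro has_derivative_transform[OF x, of eta "D 0"]) auto
    qed
    show "(D 1 has_real_derivative D 2 x) (at x within {0..1})" if "x \<in> {0..1}" for x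
      using Dd[of 1 x] that by (simp add: numeral_2_eq_2)
    show "continuous_on {0..1} (D 2)" by (rule cD) simp
  qed
  obtain \<delta> where \<delta>: "\<delta> > 0" "\<delta> \<le> 1" "\<And>x. x \<in> {1 - \<delta><..<1} \<Longrightarrow> D (m + 2) x \<noteq> 0"
  proof -
    have "continuous (at 1 within {0..1}) (D (m + 2))" using cm by (simp add: continuous_on_eq_continuous_within)
    note cw = iffD1[OF continuous_within_eps_delta this, rule_format]
    have "\<bar>D (m + 2) 1\<bar> > 0" using Dm by simp
    from cw[OF this] obtain d where d: "d > 0" "\<And>x. x \<in> {0..1} \<Longrightarrow> dist x 1 < d \<Longrightarrow> dist (D (m + 2) x) (D (m + 2) 1) < \<bar>D (m + 2) 1\<bar>"
      by (elim exE conjE) simp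
    show ?thesis
    proof (rule that[of "min d 1"])
      fix x assume "x \<in> {1 - min d 1<..<1}"
      then have "dist (D (m + 2) x) (D (m + 2) 1) < \<bar>D (m + 2) 1\<bar>" by (intro d(2)) (auto simp: dist_real_def)
      then show "D (m + 2) x \<noteq> 0" by (auto simp: dist_real_def)
    qed (use d in auto)
  qed
  have descend: "\<forall>x\<in>{1 - \<delta><..<1}. D (Suc j) x \<noteq> 0" if "j \<le> m + 1" for j
    using that
  proof (induction j rule: inc_induct)
    case base
    then show ?case using \<delta>(3) by simp
  next
    case (step j)
    show ?case
    proof
      fix x assume x: "x \<in> {1 - \<delta><..<1}"
      have "\<exists>t\<in>{x<..<1}. D (Suc j) 1 - D (Suc j) x = D (Suc (Suc j)) t * (1 - x)"
      proof (rule mvt_simple)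
        fix t assume t: "x \<le> t" "t \<le> 1"
        then have "(D (Suc j) has_real_derivative D (Suc (Suc j)) t) (at t within {x..1})"
          using Dd[of "Suc j" t] step(2) x \<delta>(2) by (auto intro: has_field_derivative_subset)
        then show "(D (Suc j) has_derivative (\<lambda>h. D (Suc (Suc j)) t * h)) (at t within {x..1})" by (simp add: has_field_derivative_def)
      qed (use x in auto)
      then obtain t where t: "t \<in> {x<..<1}" "D (Suc j) 1 - D (Suc j) x = D (Suc (Suc j)) t * (1 - x)" by blast
      have "D (Suc (Suc j)) t \<noteq> 0" using step(3) t x by auto
      moreover have "D (Suc j) 1 = 0" using Du step(2) by auto
      ultimately show "D (Suc j) x \<noteq> 0" using t x by auto
    qed
  qed
  show ?thesis
  proof (rule that[OF med _ \<delta>(1)])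
    show "eta 1 = 1" using De[of 1] D0 by simp
    show "D 1 x \<noteq> 0" if "x \<in> {1 - \<delta><..<1}" for x using descend[of 0] that by simp
  qed
qed

lemma char_fun_wronskian:
  assumes cont: "continuous_on {0..1} eta" and S: "solves eta k S S'" "S 1 = sinc k" "S' 1 = cos k"
    and y: "solves eta k y y'" "y 0 = 0" "y' 0 = 1" and r: "r \<in> {0..1}"
  shows "char_fun eta k = y' r * S r - y r * S' r"
  using wronskian_constant[OF S(1) y(1) r, of 1] S(2,3) char_fun_eq[OF cont y]
  by (simp add: mult.commute)

lemma cos_imag: "cos (\<i> * complex_of_real \<tau>) = of_real (cosh \<tau>)"
  by (simp add: cos_exp_eq cosh_field_def exp_of_real[symmetric] mult.assoc[symmetric] add.commute)

lemma sinc_imag: "\<tau> \<noteq> 0 \<Longrightarrow> sinc (\<i> * complex_of_real \<tau>) = of_real (sinh \<tau> / \<tau>)"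
proof -
  assume "\<tau> \<noteq> 0"
  have "sin (\<i> * complex_of_real \<tau>) = \<i> * of_real (sinh \<tau>)"
    by (simp add: sin_exp_eq sinh_field_def exp_of_real[symmetric] mult.assoc[symmetric] field_simps)
  then show ?thesis using \<open>\<tau> \<noteq> 0\<close> by (simp add: sinc_def)
qed

section \<open>The solutions \<open>y\<close> and \<open>S\<close> on the imaginary axis\<close>

context medium
begin

abbreviation "y \<equiv> sol \<eta> 0 (\<lambda>_. 0) (\<lambda>_. 1)"
abbreviation "yd \<equiv> sol' \<eta> 0 (\<lambda>_. 0) (\<lambda>_. 1)"
abbreviation "S \<equiv> sol \<eta> 1 sinc cos"
abbreviation "Sd \<equiv> sol' \<eta> 1 sinc cos"

lemma y_props: "solves \<eta> k (y k) (yd k)" "y k 0 = 0" "yd k 0 = 1"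
  using sol_props(1-3)[OF c0, of 0 "\<lambda>_. 0" "\<lambda>_. 1" k] by auto

lemma cos_holomorphic: "(cos :: complex \<Rightarrow> complex) holomorphic_on UNIV" by (rule holomorphic_on_cos)

lemma S_props: "solves \<eta> k (S k) (Sd k)" "S k 1 = sinc k" "Sd k 1 = cos k"
  using sol_props(1-3)[OF c0 _ sinc_holomorphic cos_holomorphic, of 1 k] by auto

definition "pY \<tau> r = Re (yd (\<i> * of_real \<tau>) r) + \<tau> * g r * Re (y (\<i> * of_real \<tau>) r)"
definition "nY \<tau> r = Re (yd (\<i> * of_real \<tau>) r) - \<tau> * g r * Re (y (\<i> * of_real \<tau>) r)"
definition "pS \<tau> r = Re (Sd (\<i> * of_real \<tau>) r) + \<tau> * g r * Re (S (\<i> * of_real \<tau>) r)"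
definition "nS \<tau> r = Re (Sd (\<i> * of_real \<tau>) r) - \<tau> * g r * Re (S (\<i> * of_real \<tau>) r)"

lemma y_imag_real:
  assumes "r \<in> {0..1}"
  shows "Im (y (\<i> * of_real \<tau>) r) = 0" "Im (yd (\<i> * of_real \<tau>) r) = 0"
  using solves_real_on_imag_axis[OF y_props(1) _ _ _ assms, of 0 \<tau>] y_props(2,3) by auto

lemma S_imag_real:
  assumes "r \<in> {0..1}" "\<tau> > 0"
  shows "Im (S (\<i> * of_real \<tau>) r) = 0" "Im (Sd (\<i> * of_real \<tau>) r) = 0"
  using solves_real_on_imag_axis[OF S_props(1) _ _ _ assms(1), of 1 \<tau>] S_props(2,3) assms(2)
  by (auto simp: cos_imag sinc_imag simp del: of_real_divide)

lemma y_wave: "wave_pair \<tau> (pY \<tau>) (nY \<tau>)" "pY \<tau> 0 = 1" "nY \<tau> 0 = 1"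
  using solves_imp_wave_pair[OF y_props(1), of \<tau>] y_props(2,3) by (auto simp: pY_def[abs_def] nY_def[abs_def])

text \<open>Because \<open>\<eta> 1 = 1\<close>, the factor \<open>g\<close> at 1 matches the data
  \<open>sinh \<tau> / \<tau>\<close> and \<open>cosh \<tau>\<close>, which split into pure
  exponentials.\<close>

lemma S_wave:
  assumes "\<tau> > 0" "\<eta> 1 = 1"
  shows "wave_pair \<tau> (pS \<tau>) (nS \<tau>)" "pS \<tau> 1 = exp \<tau>" "nS \<tau> 1 = exp (- \<tau>)"
proof -
  show "wave_pair \<tau> (pS \<tau>) (nS \<tau>)"
    using solves_imp_wave_pair[OF S_props(1), of \<tau>] by (simp add: pS_def[abs_def] nS_def[abs_def])
  have "Re (S (\<i> * of_real \<tau>) 1) = sinh \<tau> / \<tau>" "Re (Sd (\<i> * of_real \<tau>) 1) = cosh \<tau>"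
    using assms by (simp_all add: S_props(2,3) cos_imag sinc_imag del: of_real_divide)
  then show "pS \<tau> 1 = exp \<tau>" "nS \<tau> 1 = exp (- \<tau>)"
    using assms by (simp_all add: pS_def nS_def g_def cosh_plus_sinh cosh_minus_sinh)
qed

lemma X_0: "X 0 = 0" by (simp add: X_def)

lemma y_energy_le:
  assumes "\<tau> \<ge> 0" "r \<in> {0..1}"
  shows "(norm (yd (\<i> * of_real \<tau>) r))\<^sup>2 + (\<tau> * g r * norm (y (\<i> * of_real \<tau>) r))\<^sup>2 \<le> exp (4 * H + 2 * \<tau> * X r)"
  using energy_imag_axis[OF y_props(1) assms(1) assms(2), of 0] y_props(2,3) X_mono[of 0 r] assms
  by (simp add: X_0)

lemma y_energy_wave:
  assumes r: "r \<in> {0..1}"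
  shows "2 * ((norm (yd (\<i> * of_real \<tau>) r))\<^sup>2 + (\<tau> * g r * norm (y (\<i> * of_real \<tau>) r))\<^sup>2) = (pY \<tau> r)\<^sup>2 + (nY \<tau> r)\<^sup>2"
proof -
  have "norm (y (\<i> * of_real \<tau>) r) = \<bar>Re (y (\<i> * of_real \<tau>) r)\<bar>" "norm (yd (\<i> * of_real \<tau>) r) = \<bar>Re (yd (\<i> * of_real \<tau>) r)\<bar>"
    using y_imag_real[OF r, of \<tau>] by (simp_all add: norm_complex_def cmod_def)
  then show ?thesis by (simp add: pY_def nY_def power_mult_distrib power2_eq_square algebra_simps)
qed

text \<open>The lower bound comes from the cone, the upper one from the energy: up to constants the
  regular solution grows exactly with the travel time.\<close>

lemma pY_bounds:
  assumes \<tau>: "\<tau> * gmin \<ge> 6 * H" and r: "r \<in> {0..1}"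
  shows "(nY \<tau> r)\<^sup>2 \<le> (pY \<tau> r)\<^sup>2" "exp (2 * \<tau> * X r - 4 * H) \<le> (pY \<tau> r)\<^sup>2" "(pY \<tau> r)\<^sup>2 \<le> 2 * exp (4 * H + 2 * \<tau> * X r)"
proof -
  show "(nY \<tau> r)\<^sup>2 \<le> (pY \<tau> r)\<^sup>2" by (rule regular_wave_growth(1)[OF y_wave(1) \<tau> y_wave(2,3) r])
  show "exp (2 * \<tau> * X r - 4 * H) \<le> (pY \<tau> r)\<^sup>2"
    using regular_wave_growth(2)[OF y_wave(1) \<tau> y_wave(2,3), of 0 r] r by (simp add: X_0 y_wave(2))
  have "\<tau> * gmin \<ge> 0" using \<tau> H(1) by linarith
  then have "\<tau> \<ge> 0" using gmin(1) by (simp add: zero_le_mult_iff)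
  then have "(pY \<tau> r)\<^sup>2 + (nY \<tau> r)\<^sup>2 \<le> 2 * exp (4 * H + 2 * \<tau> * X r)"
    using y_energy_le[of \<tau> r] y_energy_wave[OF r, of \<tau>] r by simp
  then show "(pY \<tau> r)\<^sup>2 \<le> 2 * exp (4 * H + 2 * \<tau> * X r)"
    using zero_le_power2[of "nY \<tau> r"] by linarith
qed

text \<open>Proportionality of characteristic functions requires a point where one of them is
  non-zero. At large imaginary \<open>k\<close>, \<open>y\<close> lies in the cone of
  \<open>p\<close> and \<open>S\<close> strictly in that of \<open>n\<close>, so the Wronskian
  \<open>n1 p2 - p1 n2\<close> cannot vanish.\<close>

lemma char_fun_not_zero:
  assumes \<delta>: "\<delta> > 0" "\<And>x. x \<in> {1 - \<delta><..<1} \<Longrightarrow> \<eta>1 x \<noteq> 0" and e1: "\<eta> 1 = 1"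
  shows "\<exists>k. char_fun \<eta> k \<noteq> 0"
proof -
  \<comment> \<open>The point 1/2 and the loss \<sigma> = 1 are arbitrary choices; what counts is
    that \<open>n\<close> is non-zero there and dominates \<open>p\<close>.\<close>
  obtain c T where cT: "c > 0" "\<And>\<tau> p n. \<tau> \<ge> T \<Longrightarrow> wave_pair \<tau> p n \<Longrightarrow> p 1 = exp \<tau> \<Longrightarrow> n 1 = exp (- \<tau>) \<Longrightarrow>
    c * exp (2 * \<tau> * (1 + X 1 - X (1/2) - 1)) \<le> (n (1/2))\<^sup>2 \<and> 4 * (p (1/2))\<^sup>2 \<le> (n (1/2))\<^sup>2"
    by (rule reflected_wave_growth[OF \<delta>, of "1/2" 1]) auto
  define \<tau> where "\<tau> = max (max T 1) (6 * H / gmin)"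
  have "6 * H / gmin \<le> \<tau>" by (simp add: \<tau>_def)
  then have "\<tau> * gmin \<ge> 6 * H" using gmin(1) by (simp add: pos_divide_le_eq)
  moreover have "\<tau> \<ge> T" "\<tau> > 0" by (auto simp: \<tau>_def)
  ultimately have \<tau>: "\<tau> \<ge> T" "\<tau> > 0" "\<tau> * gmin \<ge> 6 * H" by auto
  define k where "k = \<i> * complex_of_real \<tau>"
  define p1 n1 p2 n2 where "p1 = pY \<tau> (1/2)" and "n1 = nY \<tau> (1/2)" and "p2 = pS \<tau> (1/2)" and "n2 = nS \<tau> (1/2)"
  have half: "(1/2::real) \<in> {0..1}" by simp
  have S2: "n2\<^sup>2 > 0" "4 * p2\<^sup>2 \<le> n2\<^sup>2"
    using cT(2)[OF \<tau>(1) S_wave[OF \<tau>(2) e1]] mult_pos_pos[OF cT(1) exp_gt_zero[of "2 * \<tau> * (1 + X 1 - X (1/2) - 1)"]]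
    unfolding p2_def n2_def by linarith+
  have Y2: "n1\<^sup>2 \<le> p1\<^sup>2" "p1\<^sup>2 > 0"
    using pY_bounds(1,2)[OF \<tau>(3) half] exp_gt_zero[of "2 * \<tau> * X (1/2) - 4 * H"]
    unfolding p1_def n1_def by linarith+
  have "char_fun \<eta> k = yd k (1/2) * S k (1/2) - y k (1/2) * Sd k (1/2)"
    by (rule char_fun_wronskian[OF c0 S_props y_props half])
  then have "2 * of_real (\<tau> * g (1/2)) * char_fun \<eta> k = of_real (n1 * p2 - p1 * n2)"
    using wave_wronskian[OF y_imag_real(1)[OF half] y_imag_real(2)[OF half] S_imag_real(1)[OF half \<tau>(2)] S_imag_real(2)[OF half \<tau>(2)], of "\<tau> * g (1/2)" \<tau>]
    by (simp add: k_def p1_def n1_def p2_def n2_def pY_def nY_def pS_def nS_def)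
  moreover have "n1 * p2 \<noteq> p1 * n2"
  proof
    assume "n1 * p2 = p1 * n2"
    then have "4 * (p1\<^sup>2 * n2\<^sup>2) = n1\<^sup>2 * (4 * p2\<^sup>2)" by (metis power_mult_distrib mult.left_commute)
    also have "\<dots> \<le> p1\<^sup>2 * n2\<^sup>2" using Y2 S2 by (intro mult_mono) auto
    finally have "p1\<^sup>2 * n2\<^sup>2 \<le> 0" by linarith
    then show False using mult_pos_pos[OF Y2(2) S2(1)] by linarith
  qed
  ultimately have "char_fun \<eta> k \<noteq> 0"
    by (metis eq_iff_diff_eq_0 mult_zero_right of_real_eq_0_iff)
  then show ?thesis by blast
qed

end

text \<open>The two equations have to coincide on \<open>{e..1}\<close> only. This lets the same
  \<open>S\<close>, built from \<eta>, serve for the characteristic functions of both media.\<close>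

lemma wronskian_constant_agree:
  assumes 1: "solves eta k u1 v1" and 2: "solves eta2 k u2 v2" and e: "0 \<le> e" "e \<le> 1"
    and ag: "\<And>r. r \<in> {e..1} \<Longrightarrow> eta2 r = eta r"
  shows "u1 e * v2 e - v1 e * u2 e = u1 1 * v2 1 - v1 1 * u2 1"
proof -
  have "((\<lambda>r. u1 r * v2 r - v1 r * u2 r) has_vector_derivative 0) (at r within {e..1})" if "r \<in> {e..1}" for r
  proof -
    have r: "r \<in> {0..1}" using that e by auto
    have "((\<lambda>r. u1 r * v2 r - v1 r * u2 r) has_vector_derivative 0) (at r within {0..1})"
      using ag[OF that]
      by (auto intro!: derivative_eq_intros solvesD[OF 1 r] solvesD[OF 2 r] simp: algebra_simps)
    then show ?thesis by (rule has_vector_derivative_within_subset) (use e in auto)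
  qed
  then obtain c where "\<And>r. r \<in> {e..1} \<Longrightarrow> u1 r * v2 r - v1 r * u2 r = c"
    using has_vector_derivative_zero_constant[of "{e..1}" "\<lambda>r. u1 r * v2 r - v1 r * u2 r"] by auto
  then show ?thesis using e by simp
qed

section \<open>Two media: comparison of the regular solutions at \<epsilon>\<close>

locale media_pair = A: medium \<eta> \<eta>1 \<eta>2 + B: medium \<mu> \<mu>1 \<mu>2
  for \<eta> \<eta>1 \<eta>2 \<mu> \<mu>1 \<mu>2 :: "real \<Rightarrow> real" +
  fixes \<epsilon> \<delta> :: real and c :: complex
  assumes eps: "0 < \<epsilon>" "\<epsilon> < 1"
    and travel: "A.X 1 - A.X \<epsilon> = (A.X 1 - 1) / 2" and a1: "A.X 1 > 1"
    and agree: "\<And>r. r \<in> {\<epsilon>..1} \<Longrightarrow> \<mu> r = \<eta> r"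
    and eta1: "\<eta> 1 = 1"
    and delta: "\<delta> > 0" "\<And>x. x \<in> {1 - \<delta><..<1} \<Longrightarrow> \<eta>1 x \<noteq> 0"
    and c: "c \<noteq> 0"
    and proportional: "\<And>k. char_fun \<eta> k = c * char_fun \<mu> k"
begin

lemma eps01: "\<epsilon> \<in> {0..1}" using eps by simp

lemma g_agree: "B.g \<epsilon> = A.g \<epsilon>" using agree[of \<epsilon>] eps by (simp add: A.g_def B.g_def)

lemma wronskian_relation:
  "A.yd k \<epsilon> * A.S k \<epsilon> - A.y k \<epsilon> * A.Sd k \<epsilon> = c * (B.yd k \<epsilon> * A.S k \<epsilon> - B.y k \<epsilon> * A.Sd k \<epsilon>)"
proof -
  have "char_fun \<eta> k = A.yd k \<epsilon> * A.S k \<epsilon> - A.y k \<epsilon> * A.Sd k \<epsilon>"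
    by (rule char_fun_wronskian[OF A.c0 A.S_props A.y_props eps01])
  moreover have "char_fun \<mu> k = B.yd k \<epsilon> * A.S k \<epsilon> - B.y k \<epsilon> * A.Sd k \<epsilon>"
    using wronskian_constant_agree[OF A.S_props(1) B.y_props(1), of \<epsilon> k] agree eps
      char_fun_eq[OF B.c0 B.y_props] A.S_props(2,3) by (simp add: mult.commute)
  ultimately show ?thesis using proportional[of k] by simp
qed

text \<open>With \<open>|n\<^sub>Y| \<le> |p\<^sub>Y|\<close> and \<open>2 |p\<^sub>S| \<le> |n\<^sub>S|\<close> the Wronskian is comparable to \<open>p\<^sub>Y n\<^sub>S\<close>, so the
  relation above forces both regular solutions to have the same size at \<open>\<epsilon>\<close>.\<close>
lemma regular_waves_comparable:
  assumes \<sigma>: "\<sigma> > 0"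
  obtains T c0 where "c0 > 0" "T > 0"
    "\<And>\<tau>. \<tau> \<ge> T \<Longrightarrow> \<tau> * A.gmin \<ge> 6 * A.H \<and> \<tau> * B.gmin \<ge> 6 * B.H \<and>
      norm c * \<bar>B.pY \<tau> \<epsilon>\<bar> \<le> 3 * \<bar>A.pY \<tau> \<epsilon>\<bar> \<and> \<bar>A.pY \<tau> \<epsilon>\<bar> \<le> 3 * norm c * \<bar>B.pY \<tau> \<epsilon>\<bar> \<and>
      c0 * exp (2 * \<tau> * (A.X \<epsilon> - \<sigma>)) \<le> (A.nS \<tau> \<epsilon>)\<^sup>2"
proof -
  obtain c0 T0 where cT: "c0 > 0" "\<And>\<tau> p n. \<tau> \<ge> T0 \<Longrightarrow> A.wave_pair \<tau> p n \<Longrightarrow> p 1 = exp \<tau> \<Longrightarrow> n 1 = exp (- \<tau>) \<Longrightarrow>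
    c0 * exp (2 * \<tau> * (1 + A.X 1 - A.X \<epsilon> - \<sigma>)) \<le> (n \<epsilon>)\<^sup>2 \<and> 4 * (p \<epsilon>)\<^sup>2 \<le> (n \<epsilon>)\<^sup>2"
    by (rule A.reflected_wave_growth[OF delta, of \<epsilon> \<sigma>]) (use eps \<sigma> in auto)
  \<comment> \<open>The choice of \<epsilon> enters here: the reflected wave of \<open>S\<close>,
    with rate 1 plus the travel time between \<epsilon> and 1, arrives with the rate
    \<open>A.X \<epsilon>\<close> of \<open>y\<close>.\<close>
  have Xe: "1 + A.X 1 - A.X \<epsilon> = A.X \<epsilon>" using travel by (simp add: field_simps)
  define T where "T = max (max T0 1) (max (6 * A.H / A.gmin) (6 * B.H / B.gmin))"
  show ?thesis
  proof (rule that[of c0 T])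
    show "T > 0" by (simp add: T_def)
    fix \<tau> assume t: "\<tau> \<ge> T"
    have \<tau>: "\<tau> \<ge> T0" "\<tau> > 0" "\<tau> * A.gmin \<ge> 6 * A.H" "\<tau> * B.gmin \<ge> 6 * B.H"
      using t A.gmin(1) B.gmin(1) by (auto simp: T_def field_simps)
    define p1 n1 p2 n2 pS nS where "p1 = A.pY \<tau> \<epsilon>" and "n1 = A.nY \<tau> \<epsilon>" and "p2 = B.pY \<tau> \<epsilon>" and "n2 = B.nY \<tau> \<epsilon>"
      and "pS = A.pS \<tau> \<epsilon>" and "nS = A.nS \<tau> \<epsilon>"
    define t0 where "t0 = \<tau> * A.g \<epsilon>"
    have t0: "t0 > 0" using \<tau>(2) A.g_pos[OF eps01] by (simp add: t0_def)
    have S: "c0 * exp (2 * \<tau> * (A.X \<epsilon> - \<sigma>)) \<le> nS\<^sup>2" "4 * pS\<^sup>2 \<le> nS\<^sup>2"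
      using cT(2)[OF \<tau>(1) A.S_wave[OF \<tau>(2) eta1]] unfolding Xe by (auto simp: pS_def nS_def)
    have "nS\<^sup>2 > 0" using S(1) cT(1) by (smt (verit) exp_gt_zero mult_pos_pos)
    then have nS0: "\<bar>nS\<bar> > 0" by simp
    have pS: "2 * \<bar>pS\<bar> \<le> \<bar>nS\<bar>"
    proof -
      have "(2 * \<bar>pS\<bar>)\<^sup>2 \<le> \<bar>nS\<bar>\<^sup>2" using S(2) by (simp add: power_mult_distrib)
      then show ?thesis by (rule power2_le_imp_le) simp
    qed
    have n1: "\<bar>n1\<bar> \<le> \<bar>p1\<bar>" using A.pY_bounds(1)[OF \<tau>(3) eps01] by (simp add: p1_def n1_def abs_le_square_iff)
    have n2: "\<bar>n2\<bar> \<le> \<bar>p2\<bar>" using B.pY_bounds(1)[OF \<tau>(4) eps01] by (simp add: p2_def n2_def abs_le_square_iff)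
    define k where "k = \<i> * complex_of_real \<tau>"
    have W1: "2 * of_real t0 * (A.yd k \<epsilon> * A.S k \<epsilon> - A.y k \<epsilon> * A.Sd k \<epsilon>) = of_real (n1 * pS - p1 * nS)"
      using wave_wronskian[OF A.y_imag_real(1)[OF eps01] A.y_imag_real(2)[OF eps01] A.S_imag_real(1)[OF eps01 \<tau>(2)] A.S_imag_real(2)[OF eps01 \<tau>(2)], of t0 \<tau>]
      by (simp add: k_def t0_def p1_def n1_def pS_def nS_def A.pY_def A.nY_def A.pS_def A.nS_def)
    have W2: "2 * of_real t0 * (B.yd k \<epsilon> * A.S k \<epsilon> - B.y k \<epsilon> * A.Sd k \<epsilon>) = of_real (n2 * pS - p2 * nS)"
      using wave_wronskian[OF B.y_imag_real(1)[OF eps01] B.y_imag_real(2)[OF eps01] A.S_imag_real(1)[OF eps01 \<tau>(2)] A.S_imag_real(2)[OF eps01 \<tau>(2)], of t0 \<tau>]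
      by (simp add: k_def t0_def p2_def n2_def pS_def nS_def B.pY_def B.nY_def A.pS_def A.nS_def g_agree)
    have "complex_of_real (n1 * pS - p1 * nS) = c * of_real (n2 * pS - p2 * nS)"
      unfolding W1[symmetric] W2[symmetric] wronskian_relation by (simp add: algebra_simps)
    then have W: "\<bar>n1 * pS - p1 * nS\<bar> = norm c * \<bar>n2 * pS - p2 * nS\<bar>"
      by (metis norm_mult norm_of_real)
    \<comment> \<open>\<open>\<bar>n * pS\<bar>\<close> is at most half of
      \<open>\<bar>p * nS\<bar>\<close>, so the Wronskian lies between 1/2 and 3/2 of the latter;
      the factor 3 of the conclusion is the ratio of the two.\<close>
    have comp: "\<bar>p\<bar> * \<bar>nS\<bar> / 2 \<le> \<bar>n * pS - p * nS\<bar>" "\<bar>n * pS - p * nS\<bar> \<le> 3 * (\<bar>p\<bar> * \<bar>nS\<bar> / 2)" if "\<bar>n\<bar> \<le> \<bar>p\<bar>" for p n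
    proof -
      have "\<bar>n\<bar> * (2 * \<bar>pS\<bar>) \<le> \<bar>p\<bar> * \<bar>nS\<bar>" using that pS by (intro mult_mono) auto
      then have "\<bar>n * pS\<bar> \<le> \<bar>p\<bar> * \<bar>nS\<bar> / 2" by (simp add: abs_mult)
      moreover have "\<bar>p * nS\<bar> = \<bar>p\<bar> * \<bar>nS\<bar>" by (simp add: abs_mult)
      ultimately show "\<bar>p\<bar> * \<bar>nS\<bar> / 2 \<le> \<bar>n * pS - p * nS\<bar>" "\<bar>n * pS - p * nS\<bar> \<le> 3 * (\<bar>p\<bar> * \<bar>nS\<bar> / 2)" by linarith+
    qed
    have "norm c * (\<bar>p2\<bar> * \<bar>nS\<bar> / 2) \<le> 3 * (\<bar>p1\<bar> * \<bar>nS\<bar> / 2)"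
      using comp(2)[OF n1] comp(1)[OF n2] W mult_left_mono[OF comp(1)[OF n2], of "norm c"] by simp
    then have "norm c * \<bar>p2\<bar> \<le> 3 * \<bar>p1\<bar>" using nS0 by simp
    moreover have "\<bar>p1\<bar> * \<bar>nS\<bar> / 2 \<le> norm c * (3 * (\<bar>p2\<bar> * \<bar>nS\<bar> / 2))"
      using comp(1)[OF n1] W mult_left_mono[OF comp(2)[OF n2], of "norm c"] by simp
    then have "\<bar>p1\<bar> \<le> 3 * norm c * \<bar>p2\<bar>" using nS0 by simp
    ultimately show "\<tau> * A.gmin \<ge> 6 * A.H \<and> \<tau> * B.gmin \<ge> 6 * B.H \<and>
      norm c * \<bar>B.pY \<tau> \<epsilon>\<bar> \<le> 3 * \<bar>A.pY \<tau> \<epsilon>\<bar> \<and> \<bar>A.pY \<tau> \<epsilon>\<bar> \<le> 3 * norm c * \<bar>B.pY \<tau> \<epsilon>\<bar> \<and>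
      c0 * exp (2 * \<tau> * (A.X \<epsilon> - \<sigma>)) \<le> (A.nS \<tau> \<epsilon>)\<^sup>2"
      using S(1) \<tau> by (simp add: p1_def p2_def nS_def)
  qed (use cT in auto)
qed

text \<open>Each \<open>pY\<close> has exactly the rate given by the travel time of its own medium,
  and the two are comparable by proportionality, so the rates coincide. Up to this point the media
  are unrelated on \<open>{0..<\<epsilon>}\<close>.\<close>

lemma same_travel_time: "B.X \<epsilon> = A.X \<epsilon>"
proof -
  obtain T c0 where T: "\<And>\<tau>. \<tau> \<ge> T \<Longrightarrow> \<tau> * A.gmin \<ge> 6 * A.H \<and> \<tau> * B.gmin \<ge> 6 * B.H \<and>
      norm c * \<bar>B.pY \<tau> \<epsilon>\<bar> \<le> 3 * \<bar>A.pY \<tau> \<epsilon>\<bar> \<and> \<bar>A.pY \<tau> \<epsilon>\<bar> \<le> 3 * norm c * \<bar>B.pY \<tau> \<epsilon>\<bar> \<and>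
      c0 * exp (2 * \<tau> * (A.X \<epsilon> - 1)) \<le> (A.nS \<tau> \<epsilon>)\<^sup>2"
    by (rule regular_waves_comparable[of 1]) auto
  have nc: "norm c > 0" using c by simp
  have "B.X \<epsilon> \<le> A.X \<epsilon>"
  proof (rule exponent_le[of T _ "18 * exp (4 * A.H) * exp (4 * B.H) / (norm c)\<^sup>2"])
    fix \<tau> assume "\<tau> \<ge> T"
    note t = T[OF this]
    have "(norm c)\<^sup>2 * (B.pY \<tau> \<epsilon>)\<^sup>2 \<le> 9 * (A.pY \<tau> \<epsilon>)\<^sup>2"
      using power_mono[of "norm c * \<bar>B.pY \<tau> \<epsilon>\<bar>" "3 * \<bar>A.pY \<tau> \<epsilon>\<bar>" 2] t by (simp add: power_mult_distrib)
    also have "\<dots> \<le> 9 * (2 * exp (4 * A.H + 2 * \<tau> * A.X \<epsilon>))" using A.pY_bounds(3)[of \<tau> \<epsilon>] t eps01 by simp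
    finally have "(norm c)\<^sup>2 * (B.pY \<tau> \<epsilon>)\<^sup>2 \<le> 18 * exp (4 * A.H + 2 * \<tau> * A.X \<epsilon>)" by simp
    moreover have "(norm c)\<^sup>2 * exp (2 * \<tau> * B.X \<epsilon> - 4 * B.H) \<le> (norm c)\<^sup>2 * (B.pY \<tau> \<epsilon>)\<^sup>2"
      using B.pY_bounds(2)[of \<tau> \<epsilon>] t eps01 by (intro mult_left_mono) auto
    ultimately have "(norm c)\<^sup>2 * exp (2 * \<tau> * B.X \<epsilon> - 4 * B.H) \<le> 18 * exp (4 * A.H + 2 * \<tau> * A.X \<epsilon>)" by linarith
    then have "(norm c)\<^sup>2 * exp (2 * \<tau> * B.X \<epsilon> - 4 * B.H) * exp (4 * B.H) \<le> 18 * exp (4 * A.H + 2 * \<tau> * A.X \<epsilon>) * exp (4 * B.H)"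
      by (intro mult_right_mono) auto
    then have "(norm c)\<^sup>2 * exp (2 * \<tau> * B.X \<epsilon>) \<le> 18 * exp (4 * A.H) * exp (4 * B.H) * exp (2 * \<tau> * A.X \<epsilon>)"
      by (simp add: exp_add[symmetric] mult.assoc algebra_simps)
    then show "exp (2 * \<tau> * B.X \<epsilon>) \<le> 18 * exp (4 * A.H) * exp (4 * B.H) / (norm c)\<^sup>2 * exp (2 * \<tau> * A.X \<epsilon>)"
      using nc by (simp add: pos_le_divide_eq mult.commute)
  qed
  moreover have "A.X \<epsilon> \<le> B.X \<epsilon>"
  proof (rule exponent_le[of T _ "18 * exp (4 * A.H) * exp (4 * B.H) * (norm c)\<^sup>2"])
    fix \<tau> assume "\<tau> \<ge> T"
    note t = T[OF this]
    have "(A.pY \<tau> \<epsilon>)\<^sup>2 \<le> 9 * (norm c)\<^sup>2 * (B.pY \<tau> \<epsilon>)\<^sup>2"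
      using power_mono[of "\<bar>A.pY \<tau> \<epsilon>\<bar>" "3 * norm c * \<bar>B.pY \<tau> \<epsilon>\<bar>" 2] t by (simp add: power_mult_distrib)
    also have "\<dots> \<le> 9 * (norm c)\<^sup>2 * (2 * exp (4 * B.H + 2 * \<tau> * B.X \<epsilon>))"
      using B.pY_bounds(3)[of \<tau> \<epsilon>] t eps01 by (intro mult_left_mono) auto
    finally have "(A.pY \<tau> \<epsilon>)\<^sup>2 \<le> 18 * (norm c)\<^sup>2 * exp (4 * B.H + 2 * \<tau> * B.X \<epsilon>)" by simp
    moreover have "exp (2 * \<tau> * A.X \<epsilon> - 4 * A.H) \<le> (A.pY \<tau> \<epsilon>)\<^sup>2"
      using A.pY_bounds(2)[of \<tau> \<epsilon>] t eps01 by auto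
    ultimately have "exp (2 * \<tau> * A.X \<epsilon> - 4 * A.H) * exp (4 * A.H) \<le> 18 * (norm c)\<^sup>2 * exp (4 * B.H + 2 * \<tau> * B.X \<epsilon>) * exp (4 * A.H)"
      by (intro mult_right_mono) auto
    then show "exp (2 * \<tau> * A.X \<epsilon>) \<le> 18 * exp (4 * A.H) * exp (4 * B.H) * (norm c)\<^sup>2 * exp (2 * \<tau> * B.X \<epsilon>)"
      by (simp add: exp_add[symmetric] mult.assoc algebra_simps)
  qed
  ultimately show ?thesis by simp
qed

end

lemma le_over_Suc_imp_zero:
  fixes x K :: real
  assumes "\<And>n::nat. x \<le> K / real (Suc n)" "x \<ge> 0"
  shows "x = 0"
proof (rule ccontr)
  assume "x \<noteq> 0"
  then have x: "x > 0" using assms by simp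
  obtain n where "K / x < real n" using reals_Archimedean2 by blast
  then have "K < x * real (Suc n)" using x by (simp add: pos_divide_less_eq algebra_simps)
  then show False using assms(1)[of n] by (simp add: pos_le_divide_eq)
qed

lemma norm_sub_sq: "(norm (a - c * b :: complex))\<^sup>2 \<le> 2 * ((norm a)\<^sup>2 + (norm c)\<^sup>2 * (norm b)\<^sup>2)"
proof -
  have "(norm (a - c * b))\<^sup>2 \<le> (norm a + norm c * norm b)\<^sup>2"
    using norm_triangle_ineq4[of a "c * b"] by (intro power_mono) (auto simp: norm_mult)
  also have "\<dots> \<le> 2 * ((norm a)\<^sup>2 + (norm c * norm b)\<^sup>2)"
    using sum_squares_bound[of "norm a" "norm c * norm b"] by (simp add: power2_sum)
  finally show ?thesis by (simp add: power_mult_distrib)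
qed

section \<open>The quotient \<open>F\<close> and its vanishing\<close>

context medium
begin

lemma y_energy_real:
  assumes "r \<in> {0..1}"
  shows "(norm (yd (of_real k) r))\<^sup>2 + (k * g r * norm (y (of_real k) r))\<^sup>2 \<le> exp (4 * H)"
  using energy_real_axis[OF y_props(1) assms, of 0] y_props(2,3) by simp

text \<open>At 1 the energy is \<open>cos\<^sup>2 + sin\<^sup>2 = 1\<close>. The upper bound feeds
  the asymptotics; the lower one keeps the denominator of \<open>F\<close>, measured by energy, away
  from 0.\<close>

lemma S_energy_real:
  assumes r: "r \<in> {0..1}" and e1: "\<eta> 1 = 1"
  shows "(norm (Sd (of_real k) r))\<^sup>2 + (k * g r * norm (S (of_real k) r))\<^sup>2 \<le> exp (4 * H)"
    "1 \<le> ((norm (Sd (of_real k) r))\<^sup>2 + (k * g r * norm (S (of_real k) r))\<^sup>2) * exp (4 * H)"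
proof -
  have "(k * g 1 * norm (S (of_real k) 1))\<^sup>2 = (norm (of_real k * sinc (of_real k)))\<^sup>2"
    using e1 by (simp add: g_def S_props(2) norm_mult power_mult_distrib)
  also have "\<dots> = (norm (complex_of_real (sin k)))\<^sup>2" by (simp only: sinc_mult sin_of_real)
  finally have 1: "(norm (Sd (of_real k) 1))\<^sup>2 + (k * g 1 * norm (S (of_real k) 1))\<^sup>2 = 1"
    using norm_of_real[of "cos k", where 'a=complex] norm_of_real[of "sin k", where 'a=complex]
    by (simp add: S_props(3) cos_of_real[symmetric] flip: sin_of_real)
  show "(norm (Sd (of_real k) r))\<^sup>2 + (k * g r * norm (S (of_real k) r))\<^sup>2 \<le> exp (4 * H)"
    using energy_real_axis[OF S_props(1)[of "of_real k"] r, of 1] unfolding 1 by simp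
  show "1 \<le> ((norm (Sd (of_real k) r))\<^sup>2 + (k * g r * norm (S (of_real k) r))\<^sup>2) * exp (4 * H)"
    using energy_real_axis[OF S_props(1)[of "of_real k"] _ r, of 1] unfolding 1 by simp
qed

lemma solves_at_0: "solves \<eta> 0 (\<lambda>r. of_real (a + b * r)) (\<lambda>r. of_real b)"
  unfolding solves_def
proof (intro ballI conjI)
  fix r :: real assume "r \<in> {0..1}"
  have "((\<lambda>r. a + b * r) has_real_derivative b) (at r within {0..1})" by (auto intro!: derivative_eq_intros)
  then show "((\<lambda>r. complex_of_real (a + b * r)) has_vector_derivative of_real b) (at r within {0..1})"
    by (rule has_vector_derivative_of_real)
qed auto

lemma y_at_0: "r \<in> {0..1} \<Longrightarrow> y 0 r = of_real r"
  using solves_unique(1)[OF c0 y_props(1) solves_at_0[of 0 1], of 0 r] y_props(2,3)[of 0] by simp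

lemma S_at_0: "r \<in> {0..1} \<Longrightarrow> S 0 r = of_real r"
  using solves_unique(1)[OF c0 S_props(1) solves_at_0[of 0 1], of 1 r] S_props(2,3)[of 0] by (simp add: sinc_def)

text \<open>A double zero of a solution makes it vanish identically, whereas sin and cos have no
  common zero. Hence at every \<open>k\<close> one of the two quotients that define \<open>F\<close>
  is available.\<close>

lemma S_nontrivial:
  assumes r: "r \<in> {0..1}"
  shows "S k r \<noteq> 0 \<or> Sd k r \<noteq> 0"
proof (rule ccontr)
  assume "\<not> ?thesis"
  then have z: "S k r = 0" "Sd k r = 0" by auto
  have "solves \<eta> k (\<lambda>_. 0) (\<lambda>_. 0)" by (simp add: solves_def)
  from solves_unique[OF c0 S_props(1) this r, of 1] z have "S k 1 = 0" "Sd k 1 = 0" by auto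
  then have "sin k = 0" "cos k = 0" using S_props(2,3)[of k] sinc_mult[of k] by auto
  then show False using sin_cos_squared_add[of k] by simp
qed

lemma y_entire:
  assumes "r \<in> {0..1}"
  shows "(\<lambda>k. y k r) holomorphic_on UNIV" "(\<lambda>k. yd k r) holomorphic_on UNIV"
    "exp_type (\<lambda>k. y k r)" "exp_type (\<lambda>k. yd k r)" "y (- k) r = y k r" "yd (- k) r = yd k r"
proof -
  have c: "(\<lambda>_. 0 :: complex) holomorphic_on UNIV" "(\<lambda>_. 1 :: complex) holomorphic_on UNIV" by (auto intro!: holomorphic_intros)
  have z: "(0::real) \<in> {0..1}" by simp
  show "(\<lambda>k. y k r) holomorphic_on UNIV" "(\<lambda>k. yd k r) holomorphic_on UNIV"
    using sol_props(4,5)[OF c0 z c assms] by auto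
  show "exp_type (\<lambda>k. y k r)" "exp_type (\<lambda>k. yd k r)"
    using sol_exp_type[OF c0 z c exp_type_const exp_type_const assms] by auto
  show "y (- k) r = y k r" "yd (- k) r = yd k r"
    using sol_even[OF c0 z c refl refl assms] by auto
qed

lemma S_entire:
  assumes "r \<in> {0..1}"
  shows "(\<lambda>k. S k r) holomorphic_on UNIV" "(\<lambda>k. Sd k r) holomorphic_on UNIV"
    "exp_type (\<lambda>k. S k r)" "exp_type (\<lambda>k. Sd k r)" "S (- k) r = S k r" "Sd (- k) r = Sd k r"
proof -
  have z: "(1::real) \<in> {0..1}" by simp
  show "(\<lambda>k. S k r) holomorphic_on UNIV" "(\<lambda>k. Sd k r) holomorphic_on UNIV"
    using sol_props(4,5)[OF c0 z sinc_holomorphic cos_holomorphic assms] by auto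
  show "exp_type (\<lambda>k. S k r)" "exp_type (\<lambda>k. Sd k r)"
    using sol_exp_type[OF c0 z sinc_holomorphic cos_holomorphic exp_type_sinc exp_type_cos assms] by auto
  show "S (- k) r = S k r" "Sd (- k) r = Sd k r"
    using sol_even[OF c0 z sinc_holomorphic cos_holomorphic sinc_even _ assms, of k] by auto
qed

end

context media_pair
begin

definition "dy k = A.y k \<epsilon> - c * B.y k \<epsilon>"
definition "dyd k = A.yd k \<epsilon> - c * B.yd k \<epsilon>"
definition "F k = (if A.S k \<epsilon> \<noteq> 0 then dy k / A.S k \<epsilon> else dyd k / A.Sd k \<epsilon>)"

lemma dy_relation: "dyd k * A.S k \<epsilon> = dy k * A.Sd k \<epsilon>"
  using wronskian_relation[of k] by (simp add: dy_def dyd_def algebra_simps)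

lemma F_mult: "F k * A.S k \<epsilon> = dy k" "F k * A.Sd k \<epsilon> = dyd k"
  using A.S_nontrivial[OF eps01, of k] dy_relation[of k] by (auto simp: F_def field_simps)

lemma dy_entire:
  "dy holomorphic_on UNIV" "dyd holomorphic_on UNIV" "exp_type dy" "dy (- k) = dy k" "dyd (- k) = dyd k"
proof -
  show "dy holomorphic_on UNIV" "dyd holomorphic_on UNIV" unfolding dy_def[abs_def] dyd_def[abs_def]
    by (intro holomorphic_intros A.y_entire[OF eps01] B.y_entire[OF eps01])+
  show "exp_type dy" unfolding dy_def[abs_def]
    by (intro exp_type_diff exp_type_mult exp_type_const A.y_entire[OF eps01] B.y_entire[OF eps01])
  show "dy (- k) = dy k" "dyd (- k) = dyd k"
    by (simp_all add: dy_def dyd_def A.y_entire(5,6)[OF eps01] B.y_entire(5,6)[OF eps01])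
qed

lemma F_entire: "F holomorphic_on UNIV" "F (- k) = F k"
proof -
  have loc: "F field_differentiable at k" for k
  proof -
    have diff: "\<exists>f. f field_differentiable at k \<and> (\<forall>\<^sub>F x in nhds k. F x = f x)"
      if u: "u holomorphic_on UNIV" and s: "s holomorphic_on UNIV" and sk: "s k \<noteq> 0" and Fu: "\<And>x. F x * s x = u x" for u s
    proof (intro exI conjI)
      show "(\<lambda>x. u x / s x) field_differentiable at k"
        using u s sk by (intro field_differentiable_divide) (auto simp: holomorphic_on_imp_differentiable_at)
      have "continuous (at k) s" using s by (simp add: holomorphic_on_imp_differentiable_at field_differentiable_imp_continuous_at)
      then have "\<forall>\<^sub>F x in nhds k. s x \<noteq> 0"
        using sk by (simp add: continuous_at eventually_nhds_conv_at tendsto_imp_eventually_ne isCont_def)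
      then show "\<forall>\<^sub>F x in nhds k. F x = u x / s x"
        by eventually_elim (use Fu in \<open>simp add: field_simps\<close>)
    qed
    have "\<exists>f. f field_differentiable at k \<and> (\<forall>\<^sub>F x in nhds k. F x = f x)"
      using A.S_nontrivial[OF eps01, of k] diff[OF dy_entire(1) A.S_entire(1)[OF eps01] _ F_mult(1)]
        diff[OF dy_entire(2) A.S_entire(2)[OF eps01] _ F_mult(2)] by blast
    then obtain f where "f field_differentiable at k" "\<forall>\<^sub>F x in nhds k. F x = f x" by blast
    then show ?thesis
      unfolding field_differentiable_def using DERIV_cong_ev[OF refl _ refl] by blast
  qed
  then show "F holomorphic_on UNIV" by (simp add: holomorphic_on_def)
  show "F (- k) = F k"
    by (simp add: F_def dy_entire(4,5) A.S_entire(5,6)[OF eps01])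
qed

lemma F_exp_type: "exp_type F"
proof -
  obtain K1 K2 where K: "\<And>z. norm (dy z) \<le> exp (K1 * (1 + norm z))" "\<And>z. norm (A.S z \<epsilon>) \<le> exp (K2 * (1 + norm z))"
    using dy_entire(3) A.S_entire(3)[OF eps01] unfolding exp_type_def by blast
  define K where "K = max K1 K2"
  have mono: "exp (K1 * (1 + norm z)) \<le> exp (K * (1 + norm z))" "exp (K2 * (1 + norm z)) \<le> exp (K * (1 + norm z))" for z :: complex
    by (auto simp: K_def intro!: mult_right_mono)
  have "A.S 0 \<epsilon> \<noteq> 0" using A.S_at_0[OF eps01] eps by simp
  then show ?thesis
    unfolding exp_type_def
    using quotient_exp_type[OF F_entire(1) A.S_entire(1)[OF eps01], of 0 K] K mono F_mult(1) by (metis order_trans)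
qed

text \<open>By \<open>F_mult\<close> the energy of the numerators is
  \<open>(norm (F k))\<^sup>2\<close> times the energy of \<open>S\<close>, so real zeros of
  \<open>S\<close> itself do no harm.\<close>

lemma F_real_bound: "\<exists>M. \<forall>k. norm (F (of_real k)) \<le> M"
proof (intro exI allI)
  fix k :: real
  define E where "E = (norm (A.Sd (of_real k) \<epsilon>))\<^sup>2 + (k * A.g \<epsilon> * norm (A.S (of_real k) \<epsilon>))\<^sup>2"
  define R where "R = 2 * (exp (4 * A.H) + (norm c)\<^sup>2 * exp (4 * B.H)) * exp (4 * A.H)"
  let ?F = "norm (F (of_real k))"
  have "?F\<^sup>2 * 1 \<le> ?F\<^sup>2 * (E * exp (4 * A.H))"
    using A.S_energy_real(2)[OF eps01 eta1, of k] by (intro mult_left_mono) (auto simp: E_def)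
  also have "?F\<^sup>2 * E = (norm (dyd (of_real k)))\<^sup>2 + (k * A.g \<epsilon>)\<^sup>2 * (norm (dy (of_real k)))\<^sup>2"
    unfolding E_def F_mult[symmetric] by (simp add: norm_mult power_mult_distrib algebra_simps)
  then have "?F\<^sup>2 * (E * exp (4 * A.H)) = ((norm (dyd (of_real k)))\<^sup>2 + (k * A.g \<epsilon>)\<^sup>2 * (norm (dy (of_real k)))\<^sup>2) * exp (4 * A.H)"
    by (simp add: mult.assoc[symmetric])
  also have "\<dots> \<le> R" unfolding R_def
  proof (rule mult_right_mono)
    have 1: "(norm (dyd (of_real k)))\<^sup>2 \<le> 2 * ((norm (A.yd (of_real k) \<epsilon>))\<^sup>2 + (norm c)\<^sup>2 * (norm (B.yd (of_real k) \<epsilon>))\<^sup>2)"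
      unfolding dyd_def by (rule norm_sub_sq)
    have "(k * A.g \<epsilon>)\<^sup>2 * (norm (dy (of_real k)))\<^sup>2
        \<le> (k * A.g \<epsilon>)\<^sup>2 * (2 * ((norm (A.y (of_real k) \<epsilon>))\<^sup>2 + (norm c)\<^sup>2 * (norm (B.y (of_real k) \<epsilon>))\<^sup>2))"
      unfolding dy_def by (intro mult_left_mono norm_sub_sq) auto
    also have "\<dots> = 2 * ((k * A.g \<epsilon> * norm (A.y (of_real k) \<epsilon>))\<^sup>2 + (norm c)\<^sup>2 * (k * B.g \<epsilon> * norm (B.y (of_real k) \<epsilon>))\<^sup>2)"
      by (simp add: g_agree power_mult_distrib algebra_simps)
    finally have 2: "(k * A.g \<epsilon>)\<^sup>2 * (norm (dy (of_real k)))\<^sup>2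
      \<le> 2 * ((k * A.g \<epsilon> * norm (A.y (of_real k) \<epsilon>))\<^sup>2 + (norm c)\<^sup>2 * (k * B.g \<epsilon> * norm (B.y (of_real k) \<epsilon>))\<^sup>2)" .
    have 3: "(norm c)\<^sup>2 * ((norm (B.yd (of_real k) \<epsilon>))\<^sup>2 + (k * B.g \<epsilon> * norm (B.y (of_real k) \<epsilon>))\<^sup>2) \<le> (norm c)\<^sup>2 * exp (4 * B.H)"
      by (intro mult_left_mono B.y_energy_real[OF eps01]) auto
    show "(norm (dyd (of_real k)))\<^sup>2 + (k * A.g \<epsilon>)\<^sup>2 * (norm (dy (of_real k)))\<^sup>2 \<le> 2 * (exp (4 * A.H) + (norm c)\<^sup>2 * exp (4 * B.H))"
      using 1 2 3 A.y_energy_real[OF eps01, of k] unfolding distrib_left by linarith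
  qed simp
  finally have "?F\<^sup>2 \<le> R" by simp
  then show "?F \<le> sqrt R" by (rule real_le_rsqrt)
qed

text \<open>Subtracting \<open>t0\<close> times the first relation of \<open>F_mult\<close> from the
  second expresses \<open>F * nS\<close> through the components \<open>nY\<close> of the two media.
  Here \<open>nS\<close> is the component with a lower bound, and each \<open>nY\<close> is
  dominated by the corresponding \<open>pY\<close>.\<close>

lemma F_imag_bound:
  assumes \<sigma>: "\<sigma> > 0"
  shows "\<exists>M T. \<forall>\<tau>\<ge>T. norm (F (\<i> * of_real \<tau>)) \<le> M * exp (\<sigma> * \<tau>)"
proof -
  obtain T c0 where c0: "c0 > 0" and T: "\<And>\<tau>. \<tau> \<ge> T \<Longrightarrow> \<tau> * A.gmin \<ge> 6 * A.H \<and> \<tau> * B.gmin \<ge> 6 * B.H \<and>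
      norm c * \<bar>B.pY \<tau> \<epsilon>\<bar> \<le> 3 * \<bar>A.pY \<tau> \<epsilon>\<bar> \<and> \<bar>A.pY \<tau> \<epsilon>\<bar> \<le> 3 * norm c * \<bar>B.pY \<tau> \<epsilon>\<bar> \<and>
      c0 * exp (2 * \<tau> * (A.X \<epsilon> - \<sigma>)) \<le> (A.nS \<tau> \<epsilon>)\<^sup>2" and T0: "T > 0"
    by (rule regular_waves_comparable[OF \<sigma>]) auto
  define R where "R = 32 * exp (4 * A.H) / c0"
  have R: "R \<ge> 0" using c0 by (simp add: R_def)
  have "norm (F (\<i> * of_real \<tau>)) \<le> sqrt R * exp (\<sigma> * \<tau>)" if "\<tau> \<ge> T" for \<tau>
  proof -
    note t = T[OF that]
    have \<tau>: "\<tau> > 0" using that T0 by simp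
    define k where "k = \<i> * complex_of_real \<tau>"
    define t0 where "t0 = \<tau> * A.g \<epsilon>"
    have nS: "A.Sd k \<epsilon> - of_real t0 * A.S k \<epsilon> = of_real (A.nS \<tau> \<epsilon>)"
      using A.S_imag_real[OF eps01 \<tau>] by (simp add: k_def t0_def A.nS_def complex_eq_iff)
    have nA: "A.yd k \<epsilon> - of_real t0 * A.y k \<epsilon> = of_real (A.nY \<tau> \<epsilon>)"
      using A.y_imag_real[OF eps01, of \<tau>] by (simp add: k_def t0_def A.nY_def complex_eq_iff)
    have nB: "B.yd k \<epsilon> - of_real t0 * B.y k \<epsilon> = of_real (B.nY \<tau> \<epsilon>)"
      using B.y_imag_real[OF eps01, of \<tau>] by (simp add: k_def t0_def B.nY_def complex_eq_iff g_agree)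
    have "F k * of_real (A.nS \<tau> \<epsilon>) = dyd k - of_real t0 * dy k"
      unfolding nS[symmetric] by (simp add: right_diff_distrib F_mult[symmetric] algebra_simps)
    also have "\<dots> = of_real (A.nY \<tau> \<epsilon>) - c * of_real (B.nY \<tau> \<epsilon>)"
      unfolding nA[symmetric] nB[symmetric] by (simp add: dy_def dyd_def algebra_simps)
    finally have "norm (F k) * \<bar>A.nS \<tau> \<epsilon>\<bar> = norm (of_real (A.nY \<tau> \<epsilon>) - c * of_real (B.nY \<tau> \<epsilon>))"
      by (metis norm_mult norm_of_real)
    also have "\<dots> \<le> \<bar>A.nY \<tau> \<epsilon>\<bar> + norm c * \<bar>B.nY \<tau> \<epsilon>\<bar>"
      using norm_triangle_ineq4[of "of_real (A.nY \<tau> \<epsilon>)" "c * of_real (B.nY \<tau> \<epsilon>)"] by (simp add: norm_mult)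
    also have "\<dots> \<le> \<bar>A.pY \<tau> \<epsilon>\<bar> + norm c * \<bar>B.pY \<tau> \<epsilon>\<bar>"
      using A.pY_bounds(1)[OF _ eps01, of \<tau>] B.pY_bounds(1)[OF _ eps01, of \<tau>] t
      by (intro add_mono mult_left_mono) (auto simp: abs_le_square_iff)
    also have "\<dots> \<le> 4 * \<bar>A.pY \<tau> \<epsilon>\<bar>" using t by linarith
    finally have "norm (F k) * \<bar>A.nS \<tau> \<epsilon>\<bar> \<le> 4 * \<bar>A.pY \<tau> \<epsilon>\<bar>" .
    then have "(norm (F k) * \<bar>A.nS \<tau> \<epsilon>\<bar>)\<^sup>2 \<le> (4 * \<bar>A.pY \<tau> \<epsilon>\<bar>)\<^sup>2" by (intro power_mono) auto
    then have "(norm (F k))\<^sup>2 * (A.nS \<tau> \<epsilon>)\<^sup>2 \<le> 16 * (A.pY \<tau> \<epsilon>)\<^sup>2" by (simp add: power_mult_distrib)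
    also have "\<dots> \<le> 16 * (2 * exp (4 * A.H + 2 * \<tau> * A.X \<epsilon>))" using A.pY_bounds(3)[OF _ eps01, of \<tau>] t by simp
    finally have 1: "(norm (F k))\<^sup>2 * (A.nS \<tau> \<epsilon>)\<^sup>2 \<le> 32 * exp (4 * A.H + 2 * \<tau> * A.X \<epsilon>)" by simp
    have "(norm (F k))\<^sup>2 * (c0 * exp (2 * \<tau> * (A.X \<epsilon> - \<sigma>))) \<le> (norm (F k))\<^sup>2 * (A.nS \<tau> \<epsilon>)\<^sup>2"
      using t by (intro mult_left_mono) auto
    also note 1
    also have "32 * exp (4 * A.H + 2 * \<tau> * A.X \<epsilon>) = (R * exp (2 * (\<sigma> * \<tau>))) * (c0 * exp (2 * \<tau> * (A.X \<epsilon> - \<sigma>)))"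
      using c0 by (simp add: R_def exp_add[symmetric] algebra_simps)
    finally have "(norm (F k))\<^sup>2 \<le> R * exp (2 * (\<sigma> * \<tau>))" using c0 by simp
    also have "\<dots> = (sqrt R * exp (\<sigma> * \<tau>))\<^sup>2" using R by (simp add: power_mult_distrib exp_double)
    finally show ?thesis unfolding k_def by (rule power2_le_imp_le) (simp add: R)
  qed
  then show ?thesis by blast
qed

lemma F_constant: "F k = F 0"
proof -
  obtain K where K: "\<And>z. norm (F z) \<le> exp (K * (1 + norm z))" using F_exp_type unfolding exp_type_def by blast
  obtain M where M: "\<And>k. norm (F (of_real k)) \<le> M" using F_real_bound by blast
  show ?thesis by (rule even_exp_type_constant[OF F_entire(1) K F_entire(2) M F_imag_bound])
qed

text \<open>On the real axis \<open>S(\<epsilon>, k)\<close> oscillates with frequency \<open>X \<epsilon> + 1 - X 1\<close>, but \<open>y\<close> and \<open>y~\<close> with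
  frequency \<open>X \<epsilon>\<close>; hence \<open>F = 0\<close>.\<close>
lemma F_zero: "F 0 = 0"
proof -
  define C where "C = F 0"
  obtain KA where KA: "\<And>k u v M r s. k > 0 \<Longrightarrow> solves \<eta> (of_real k) u v \<Longrightarrow> M \<ge> 0 \<Longrightarrow>
      (\<And>t. t \<in> {0..1} \<Longrightarrow> (norm (v t))\<^sup>2 + (k * A.g t * norm (u t))\<^sup>2 \<le> M\<^sup>2) \<Longrightarrow> r \<in> {0..1} \<Longrightarrow> s \<in> {0..1} \<Longrightarrow>
      norm ((v r + \<i> * of_real (k * A.g r) * u r) * cis (- (k * A.X r)) * of_real (1 / sqrt (A.g r))
          - (v s + \<i> * of_real (k * A.g s) * u s) * cis (- (k * A.X s)) * of_real (1 / sqrt (A.g s))) \<le> KA * M / k"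
    by (rule A.wkb_real_axis) blast
  obtain KB where KB: "\<And>k u v M r s. k > 0 \<Longrightarrow> solves \<mu> (of_real k) u v \<Longrightarrow> M \<ge> 0 \<Longrightarrow>
      (\<And>t. t \<in> {0..1} \<Longrightarrow> (norm (v t))\<^sup>2 + (k * B.g t * norm (u t))\<^sup>2 \<le> M\<^sup>2) \<Longrightarrow> r \<in> {0..1} \<Longrightarrow> s \<in> {0..1} \<Longrightarrow>
      norm ((v r + \<i> * of_real (k * B.g r) * u r) * cis (- (k * B.X r)) * of_real (1 / sqrt (B.g r))
          - (v s + \<i> * of_real (k * B.g s) * u s) * cis (- (k * B.X s)) * of_real (1 / sqrt (B.g s))) \<le> KB * M / k"
    by (rule B.wkb_real_axis) blast
  define MA MB where "MA = exp (2 * A.H)" and "MB = exp (2 * B.H)"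
  have MA: "MA \<ge> 0" "MA\<^sup>2 = exp (4 * A.H)" and MB: "MB \<ge> 0" "MB\<^sup>2 = exp (4 * B.H)"
    by (simp_all add: MA_def MB_def exp_double[symmetric])
  \<comment> \<open>\<open>1 / sqrt (g 0)\<close> is the normalised amplitude of a regular solution
    at 0, where \<open>v = 1\<close> and \<open>u = 0\<close>. So \<open>D\<close> is the limit of
    the amplitude of the numerator.\<close>
  define D where "D = complex_of_real (1 / sqrt (A.g 0)) - c * of_real (1 / sqrt (B.g 0))"
  define K where "K = norm C * (KA * MA) + KA * MA + norm c * (KB * MB)"
  have main: "norm (C * cis (k - k * A.X 1) - D) \<le> K / k" if k: "k > 0" for k :: real
  proof -
    define E where "E = cis (- (k * A.X \<epsilon>)) * of_real (1 / sqrt (A.g \<epsilon>))"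
    define PS PA PB where "PS = (A.Sd k \<epsilon> + \<i> * of_real (k * A.g \<epsilon>) * A.S k \<epsilon>) * E"
      and "PA = (A.yd k \<epsilon> + \<i> * of_real (k * A.g \<epsilon>) * A.y k \<epsilon>) * E"
      and "PB = (B.yd k \<epsilon> + \<i> * of_real (k * A.g \<epsilon>) * B.y k \<epsilon>) * E"
    have "A.Sd (of_real k) 1 + \<i> * of_real (k * A.g 1) * A.S (of_real k) 1 = cis k"
    proof -
      have "A.Sd (of_real k) 1 + \<i> * of_real (k * A.g 1) * A.S (of_real k) 1 = cos (of_real k) + \<i> * (of_real k * sinc (of_real k))"
        using eta1 by (simp add: A.S_props(2,3) A.g_def mult.assoc)
      also have "\<dots> = cis k" by (simp only: sinc_mult) (simp add: complex_eq_iff cos_of_real sin_of_real)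
      finally show ?thesis .
    qed
    then have S: "norm (PS - cis (k - k * A.X 1)) \<le> KA * MA / k"
      using KA[OF k A.S_props(1) MA(1) _ eps01, of 1] A.S_energy_real(1)[OF _ eta1, of _ k] eta1
      by (simp add: MA(2) PS_def E_def A.g_def mult.assoc cis_mult)
    have yA: "norm (PA - of_real (1 / sqrt (A.g 0))) \<le> KA * MA / k"
      using KA[OF k A.y_props(1) MA(1) _ eps01, of 0] A.y_energy_real[of _ k]
      by (simp add: MA(2) PA_def E_def mult.assoc A.y_props(2,3) A.X_0)
    have yB: "norm (PB - of_real (1 / sqrt (B.g 0))) \<le> KB * MB / k"
      using KB[OF k B.y_props(1) MB(1) _ eps01, of 0] B.y_energy_real[of _ k]
      by (simp add: MB(2) PB_def E_def mult.assoc B.y_props(2,3) B.X_0 g_agree same_travel_time)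
    have CP: "C * PS = PA - c * PB"
    proof -
      have CS: "C * A.S k \<epsilon> = A.y k \<epsilon> - c * B.y k \<epsilon>" "C * A.Sd k \<epsilon> = A.yd k \<epsilon> - c * B.yd k \<epsilon>"
        using F_mult[of k] F_constant[of k] by (auto simp: C_def dy_def dyd_def)
      have "C * PS = (C * A.Sd k \<epsilon> + \<i> * of_real (k * A.g \<epsilon>) * (C * A.S k \<epsilon>)) * E" by (simp add: PS_def algebra_simps)
      also have "\<dots> = PA - c * PB" unfolding CS by (simp add: PA_def PB_def algebra_simps)
      finally show ?thesis .
    qed
    have tri: "norm (x - y - z) \<le> norm x + norm y + norm z" for x y z :: complex
      using norm_triangle_ineq4[of "x - y" z] norm_triangle_ineq4[of x y] by linarith
    have "C * cis (k - k * A.X 1) - D = (PA - of_real (1 / sqrt (A.g 0))) - c * (PB - of_real (1 / sqrt (B.g 0))) - C * (PS - cis (k - k * A.X 1))"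
      unfolding right_diff_distrib CP by (simp add: D_def algebra_simps)
    also have "norm \<dots> \<le> norm (PA - of_real (1 / sqrt (A.g 0))) + norm c * norm (PB - of_real (1 / sqrt (B.g 0))) + norm C * norm (PS - cis (k - k * A.X 1))"
      using tri[of "PA - of_real (1 / sqrt (A.g 0))" "c * (PB - of_real (1 / sqrt (B.g 0)))" "C * (PS - cis (k - k * A.X 1))"]
      by (simp only: norm_mult)
    also have "\<dots> \<le> KA * MA / k + norm c * (KB * MB / k) + norm C * (KA * MA / k)"
      using S yA yB by (intro add_mono mult_left_mono) auto
    also have "\<dots> = K / k" by (simp add: K_def add_divide_distrib)
    finally show ?thesis .
  qed
  \<comment> \<open>\<open>C * cis (- (k * b))\<close> must tend to \<open>D\<close>. Along
    \<open>k b = 2 pi n\<close> the phase factor is 1, along odd multiples of pi it is -1, so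
    \<open>C = D = - C\<close>. The sequences exist because a > 1 makes \<open>b\<close>
    positive.\<close>
  define b where "b = A.X 1 - 1"
  have b: "b > 0" using a1 by (simp add: b_def)
  have ph: "k - k * A.X 1 = - (k * b)" for k by (simp add: b_def algebra_simps)
  have "norm (C - D) = 0"
  proof (rule le_over_Suc_imp_zero)
    fix n :: nat
    define k where "k = 2 * pi * real (Suc n) / b"
    have k: "k > 0" using b by (simp add: k_def)
    have "k * b = 2 * pi * real (Suc n)" using b by (simp add: k_def)
    then have "cis (k - k * A.X 1) = 1"
      unfolding ph using cis_multiple_2pi[of "- real (Suc n)"] by (simp del: of_nat_Suc)
    then have "norm (C - D) \<le> K / k" using main[OF k] by simp
    also have "\<dots> = (K * b / (2 * pi)) / real (Suc n)" using b by (simp add: k_def field_simps)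
    finally show "norm (C - D) \<le> (K * b / (2 * pi)) / real (Suc n)" .
  qed simp
  moreover have "norm (- C - D) = 0"
  proof (rule le_over_Suc_imp_zero)
    fix n :: nat
    define k where "k = (2 * pi * real (Suc n) + pi) / b"
    have k: "k > 0" using b by (simp add: k_def add_pos_pos)
    have kb: "k * b = 2 * pi * real (Suc n) + pi" using b by (simp add: k_def)
    have "cis (- (2 * pi * real (Suc n))) = 1" using cis_multiple_2pi[of "- real (Suc n)"] by (simp del: of_nat_Suc)
    moreover have "cis (k - k * A.X 1) = cis (- (2 * pi * real (Suc n))) * cis (- pi)"
      unfolding ph kb by (simp add: cis_mult algebra_simps)
    ultimately have "cis (k - k * A.X 1) = - 1" by (simp add: cis.ctr complex_eq_iff)
    then have "norm (- C - D) \<le> K / k" using main[OF k] by simp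
    also have "\<dots> \<le> (\<bar>K\<bar> * b / (2 * pi)) / real (Suc n)"
    proof -
      have "2 * pi * real (Suc n) / b \<le> k" using b by (simp add: k_def divide_right_mono)
      then have "K / k \<le> \<bar>K\<bar> / (2 * pi * real (Suc n) / b)" using b k by (intro frac_le) auto
      then show ?thesis by simp
    qed
    finally show "norm (- C - D) \<le> (\<bar>K\<bar> * b / (2 * pi)) / real (Suc n)" .
  qed simp
  ultimately have "C = D" "- C = D" by auto
  then show ?thesis by (simp add: C_def)
qed

text \<open>At \<open>k = 0\<close> the medium drops out of the equation: both regular solutions
  take the value \<epsilon> at \<epsilon>, and \<open>F 0 = 0\<close> leaves only
  \<open>c = 1\<close>.\<close>

lemma c_eq_1: "c = 1"
proof -
  have "dy 0 = 0" using F_mult(1)[of 0] F_zero by simp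
  then have "of_real \<epsilon> - c * of_real \<epsilon> = 0" by (simp add: dy_def A.y_at_0[OF eps01] B.y_at_0[OF eps01])
  then show ?thesis using eps by (simp add: algebra_simps)
qed

lemma y_agree: "B.y k \<epsilon> = A.y k \<epsilon>" "B.yd k \<epsilon> = A.yd k \<epsilon>"
proof -
  have "dy k = 0" "dyd k = 0" using F_mult[of k] F_constant[of k] F_zero by auto
  then show "B.y k \<epsilon> = A.y k \<epsilon>" "B.yd k \<epsilon> = A.yd k \<epsilon>" unfolding dy_def dyd_def by (simp_all add: c_eq_1)
qed

end

section \<open>Recovery of the medium on \<open>[0, \<epsilon>]\<close>\<close>

context medium
begin

text \<open>The cosine-like and sine-like solutions normalised at \<open>s\<close>; with their
  derivatives they are the entries of the transfer matrix from \<open>s\<close>.\<close>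

abbreviation "th s \<equiv> sol \<eta> s (\<lambda>_. 1) (\<lambda>_. 0)"
abbreviation "thd s \<equiv> sol' \<eta> s (\<lambda>_. 1) (\<lambda>_. 0)"
abbreviation "ph s \<equiv> sol \<eta> s (\<lambda>_. 0) (\<lambda>_. 1)"
abbreviation "phd s \<equiv> sol' \<eta> s (\<lambda>_. 0) (\<lambda>_. 1)"

lemma basis_props:
  assumes s: "s \<in> {0..1}"
  shows "solves \<eta> k (th s k) (thd s k)" "th s k s = 1" "thd s k s = 0"
    "solves \<eta> k (ph s k) (phd s k)" "ph s k s = 0" "phd s k s = 1"
  using sol_props(1-3)[OF c0 s, of "\<lambda>_. 1" "\<lambda>_. 0" k] sol_props(1-3)[OF c0 s, of "\<lambda>_. 0" "\<lambda>_. 1" k] by auto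

lemma basis_entire:
  assumes s: "s \<in> {0..1}" and r: "r \<in> {0..1}"
  shows "(\<lambda>k. th s k r) holomorphic_on UNIV" "(\<lambda>k. ph s k r) holomorphic_on UNIV"
    "exp_type (\<lambda>k. th s k r)" "exp_type (\<lambda>k. ph s k r)" "th s (- k) r = th s k r" "ph s (- k) r = ph s k r"
proof -
  have c: "(\<lambda>_. 0 :: complex) holomorphic_on UNIV" "(\<lambda>_. 1 :: complex) holomorphic_on UNIV" by (auto intro!: holomorphic_intros)
  show "(\<lambda>k. th s k r) holomorphic_on UNIV" "(\<lambda>k. ph s k r) holomorphic_on UNIV"
    using sol_props(4)[OF c0 s c(2,1) r] sol_props(4)[OF c0 s c(1,2) r] by auto
  show "exp_type (\<lambda>k. th s k r)" "exp_type (\<lambda>k. ph s k r)"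
    using sol_exp_type(1)[OF c0 s c(2,1) exp_type_const exp_type_const r]
      sol_exp_type(1)[OF c0 s c(1,2) exp_type_const exp_type_const r] by auto
  show "th s (- k) r = th s k r" "ph s (- k) r = ph s k r"
    using sol_even(1)[OF c0 s c(2,1) refl refl r] sol_even(1)[OF c0 s c(1,2) refl refl r] by auto
qed

lemma basis_at_0:
  assumes s: "s \<in> {0..1}" and r: "r \<in> {0..1}"
  shows "th s 0 r = 1" "ph s 0 r = of_real (r - s)"
  using solves_unique(1)[OF c0 basis_props(1)[OF s, of 0] solves_at_0[of 1 0] s _ _ r] basis_props[OF s, of 0]
    solves_unique(1)[OF c0 basis_props(4)[OF s, of 0] solves_at_0[of "- s" 1] s _ _ r] by auto

lemma y_by_basis:
  assumes s: "s \<in> {0..1}" and r: "r \<in> {0..1}"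
  shows "y k r = y k s * th s k r + yd k s * ph s k r"
  using solves_by_fundamental(1)[OF basis_props(1)[OF s, of k] basis_props(4)[OF s, of k] y_props(1) s _ r]
    basis_props[OF s, of k] by simp

text \<open>On the real axis \<open>th\<close> is bounded while \<open>ph\<close> gains a factor
  \<open>1 / k\<close>. This decay later forces the constant value of \<open>G\<close> to be
  0.\<close>

lemma basis_real_bounds:
  assumes s: "s \<in> {0..1}" and r: "r \<in> {0..1}" and k: "k > 0"
  shows "norm (th s (of_real k) r) \<le> gmax / gmin * exp (2 * H)" "norm (ph s (of_real k) r) \<le> exp (2 * H) / (k * gmin)"
proof -
  have e: "exp (4 * H) = (exp (2 * H))\<^sup>2" by (simp add: exp_double[symmetric])
  have second_le: "z \<le> w" if "x + z \<le> w" "0 \<le> x" for x z w :: real using that by linarith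
  have low: "(k * gmin * x)\<^sup>2 \<le> (k * g r * x)\<^sup>2" if "x \<ge> 0" for x
    using gmin(1) gmin(2)[OF r] k that by (intro power_mono mult_right_mono mult_left_mono) auto
  have "(k * g r * norm (th s (of_real k) r))\<^sup>2 \<le> (k * g s)\<^sup>2 * exp (4 * H)"
    using second_le[OF energy_real_axis[OF basis_props(1)[OF s, of "of_real k"] r s] zero_le_power2] basis_props(2,3)[OF s] by simp
  also have "\<dots> \<le> (k * gmax * exp (2 * H))\<^sup>2"
    unfolding e power_mult_distrib[symmetric]
    using gmax(2)[OF s] g_pos[OF s] k by (intro power_mono mult_right_mono mult_left_mono) auto
  finally have "(k * gmin * norm (th s (of_real k) r))\<^sup>2 \<le> (k * gmax * exp (2 * H))\<^sup>2" using low[of "norm (th s (of_real k) r)"] by simp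
  then have "k * gmin * norm (th s (of_real k) r) \<le> k * gmax * exp (2 * H)"
    by (rule power2_le_imp_le) (use k gmax(1) in auto)
  then show "norm (th s (of_real k) r) \<le> gmax / gmin * exp (2 * H)" using k gmin(1) by (simp add: field_simps)
  have "(k * g r * norm (ph s (of_real k) r))\<^sup>2 \<le> exp (4 * H)"
    using second_le[OF energy_real_axis[OF basis_props(4)[OF s, of "of_real k"] r s] zero_le_power2] basis_props(5,6)[OF s] by simp
  then have "(k * gmin * norm (ph s (of_real k) r))\<^sup>2 \<le> (exp (2 * H))\<^sup>2" using low[of "norm (ph s (of_real k) r)"] e by simp
  then have "k * gmin * norm (ph s (of_real k) r) \<le> exp (2 * H)" by (rule power2_le_imp_le) simp
  then show "norm (ph s (of_real k) r) \<le> exp (2 * H) / (k * gmin)" using k gmin(1) by (simp add: field_simps)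
qed

lemma imag_size_le:
  assumes sol: "solves \<eta> (\<i> * of_real \<tau>) u v" and \<tau>: "\<tau> \<ge> 0" and r: "r \<in> {0..1}" and s: "s \<in> {0..1}"
  shows "(\<tau> * gmin * norm (u r))\<^sup>2 \<le> ((norm (v s))\<^sup>2 + (\<tau> * g s * norm (u s))\<^sup>2) * exp (4 * H + 2 * \<tau> * \<bar>X r - X s\<bar>)"
proof -
  have "(\<tau> * gmin * norm (u r))\<^sup>2 \<le> (\<tau> * g r * norm (u r))\<^sup>2"
    using gmin(1) gmin(2)[OF r] \<tau> by (intro power_mono mult_right_mono mult_left_mono) auto
  also have "\<dots> \<le> (norm (v r))\<^sup>2 + (\<tau> * g r * norm (u r))\<^sup>2" by simp
  also note energy_imag_axis[OF sol \<tau> r s]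
  finally show ?thesis .
qed

text \<open>The energy estimate alone would allow growth from \<open>s\<close> towards 0. Decay of
  the regular solution rests on the cone: \<open>p\<close> dominates and grows outwards, so its
  value at \<open>r\<close> is controlled by the energy at \<open>s\<close>.\<close>

lemma y_decay:
  assumes \<tau>: "\<tau> * gmin \<ge> 6 * H" "\<tau> \<ge> 0" and rs: "0 \<le> r" "r \<le> s" "s \<le> 1"
  shows "(\<tau> * gmin * norm (y (\<i> * of_real \<tau>) r))\<^sup>2
    \<le> 2 * ((norm (yd (\<i> * of_real \<tau>) s))\<^sup>2 + (\<tau> * g s * norm (y (\<i> * of_real \<tau>) s))\<^sup>2) * exp (4 * H - 2 * \<tau> * (X s - X r))"
proof -
  have r: "r \<in> {0..1}" and s: "s \<in> {0..1}" using rs by auto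
  have "(\<tau> * gmin * norm (y (\<i> * of_real \<tau>) r))\<^sup>2 \<le> (\<tau> * g r * norm (y (\<i> * of_real \<tau>) r))\<^sup>2"
    using gmin(1) gmin(2)[OF r] \<tau> by (intro power_mono mult_right_mono mult_left_mono) auto
  also have "\<dots> \<le> (pY \<tau> r)\<^sup>2"
  proof -
    have "b \<le> p" if "2 * (a + b) = p + n" "n \<le> p" "0 \<le> a" for a b p n :: real
      using that unfolding distrib_left by linarith
    from this[OF y_energy_wave[OF r] pY_bounds(1)[OF \<tau>(1) r] zero_le_power2] show ?thesis .
  qed
  finally have 1: "(\<tau> * gmin * norm (y (\<i> * of_real \<tau>) r))\<^sup>2 \<le> (pY \<tau> r)\<^sup>2" .
  have 2: "(pY \<tau> r)\<^sup>2 * exp (2 * \<tau> * (X s - X r) - 4 * H) \<le> (pY \<tau> s)\<^sup>2"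
    by (rule regular_wave_growth(2)[OF y_wave(1) \<tau>(1) y_wave(2,3) rs])
  have 3: "(pY \<tau> s)\<^sup>2 \<le> 2 * ((norm (yd (\<i> * of_real \<tau>) s))\<^sup>2 + (\<tau> * g s * norm (y (\<i> * of_real \<tau>) s))\<^sup>2)"
    unfolding y_energy_wave[OF s] by simp
  have "(pY \<tau> r)\<^sup>2 = (pY \<tau> r)\<^sup>2 * exp (2 * \<tau> * (X s - X r) - 4 * H) * exp (4 * H - 2 * \<tau> * (X s - X r))"
    by (simp add: mult.assoc exp_add[symmetric])
  also have "\<dots> \<le> 2 * ((norm (yd (\<i> * of_real \<tau>) s))\<^sup>2 + (\<tau> * g s * norm (y (\<i> * of_real \<tau>) s))\<^sup>2) * exp (4 * H - 2 * \<tau> * (X s - X r))"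
    using 2 3 by (intro mult_right_mono) auto
  finally show ?thesis using 1 by linarith
qed

end

context media_pair
begin

text \<open>Evaluated at \<open>k = 0\<close>, the function \<open>G\<close> of the following proof equals \<open>\<rho> - r\<close>. It only depends on
  the bilinear antisymmetric pairing of the two transfer matrices, so on the imaginary axis the basis
  \<open>th\<close>, \<open>ph\<close> can be replaced by the regular solution \<open>y\<close>, which decays away from \<open>\<epsilon>\<close>, and a complement \<open>\<chi>\<close>
  normalised by its energy; growth and decay rates cancel because the travel times agree.\<close>
lemma equal_travel_time_imp_equal:
  assumes r: "0 \<le> r" "r \<le> \<epsilon>" and \<rho>: "0 \<le> \<rho>" "\<rho> \<le> \<epsilon>" and X: "A.X r = B.X \<rho>"
  shows "\<rho> = r"
proof -
  have r01: "r \<in> {0..1}" and \<rho>01: "\<rho> \<in> {0..1}" using r \<rho> eps by auto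
  define G where "G k = B.ph \<epsilon> k \<rho> * A.th \<epsilon> k r - A.ph \<epsilon> k r * B.th \<epsilon> k \<rho>" for k
  note Ae = A.basis_entire[OF eps01 r01] and Be = B.basis_entire[OF eps01 \<rho>01]
  have holG: "G holomorphic_on UNIV" unfolding G_def[abs_def] by (intro holomorphic_intros Ae(1,2) Be(1,2))
  have "exp_type G" unfolding G_def[abs_def] by (intro exp_type_diff exp_type_mult Ae(3,4) Be(3,4))
  then obtain K where K: "\<And>z. norm (G z) \<le> exp (K * (1 + norm z))" unfolding exp_type_def by blast
  have evG: "G (- k) = G k" for k by (simp add: G_def Ae(5,6) Be(5,6))
  define M where "M = exp (2 * B.H) / B.gmin * (A.gmax / A.gmin * exp (2 * A.H)) + exp (2 * A.H) / A.gmin * (B.gmax / B.gmin * exp (2 * B.H))"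
  have M0: "M \<ge> 0" using A.gmin(1) B.gmin(1) A.gmax(1) B.gmax(1) by (simp add: M_def)
  have reG: "norm (G (of_real k)) \<le> M / k" if k: "k > 0" for k
  proof -
    note a = A.basis_real_bounds[OF eps01 r01 k] and b = B.basis_real_bounds[OF eps01 \<rho>01 k]
    have "norm (G (of_real k)) \<le> norm (B.ph \<epsilon> k \<rho>) * norm (A.th \<epsilon> k r) + norm (A.ph \<epsilon> k r) * norm (B.th \<epsilon> k \<rho>)"
      unfolding G_def norm_mult[symmetric] by (rule norm_triangle_ineq4)
    also have "\<dots> \<le> exp (2 * B.H) / (k * B.gmin) * (A.gmax / A.gmin * exp (2 * A.H)) + exp (2 * A.H) / (k * A.gmin) * (B.gmax / B.gmin * exp (2 * B.H))"
      using a b k A.gmin(1) B.gmin(1) by (intro add_mono mult_mono) auto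
    also have "\<dots> = M / k" using k by (simp add: M_def add_divide_distrib mult_ac)
    finally show ?thesis .
  qed
  define d where "d = A.X \<epsilon> - A.X r"
  have d: "d \<ge> 0" "B.X \<epsilon> - B.X \<rho> = d" using A.X_mono[of r \<epsilon>] r eps X same_travel_time by (auto simp: d_def)
  obtain T c0 where T: "\<And>\<tau>. \<tau> \<ge> T \<Longrightarrow> \<tau> * A.gmin \<ge> 6 * A.H \<and> \<tau> * B.gmin \<ge> 6 * B.H \<and>
      norm c * \<bar>B.pY \<tau> \<epsilon>\<bar> \<le> 3 * \<bar>A.pY \<tau> \<epsilon>\<bar> \<and> \<bar>A.pY \<tau> \<epsilon>\<bar> \<le> 3 * norm c * \<bar>B.pY \<tau> \<epsilon>\<bar> \<and>
      c0 * exp (2 * \<tau> * (A.X \<epsilon> - 1)) \<le> (A.nS \<tau> \<epsilon>)\<^sup>2"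
    by (rule regular_waves_comparable[of 1]) auto
  \<comment> \<open>Up to the minima of \<open>g\<close>, this is the square root of the product of
    the two size estimates below, in which \<open>N\<close> and the exponentials in \<tau>
    cancel.\<close>
  define Q where "Q = sqrt (2 * (A.g \<epsilon>)\<^sup>2 * exp (4 * A.H + 4 * B.H)) / (A.gmin * B.gmin)"
  have imG: "norm (G (\<i> * of_real \<tau>)) \<le> 2 * Q" if "\<tau> \<ge> max T 1" for \<tau>
  proof -
    have \<tau>: "\<tau> \<ge> 1" "\<tau> * A.gmin \<ge> 6 * A.H" "\<tau> * B.gmin \<ge> 6 * B.H" using that T[of \<tau>] by auto
    define k where "k = \<i> * complex_of_real \<tau>"
    define t where "t = \<tau> * A.g \<epsilon>"
    define a b where "a = A.y k \<epsilon>" and "b = A.yd k \<epsilon>"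
    have ab: "B.y k \<epsilon> = a" "B.yd k \<epsilon> = b" by (simp_all add: a_def b_def y_agree)
    have im: "Im a = 0" "Im b = 0" using A.y_imag_real[OF eps01, of \<tau>] by (auto simp: a_def b_def k_def)
    define N where "N = (norm b)\<^sup>2 + (t * norm a)\<^sup>2"
    have Nab: "b * b + (of_real t * a) * (of_real t * a) = of_real N"
      using im by (simp add: N_def complex_eq_iff cmod_power2 power_mult_distrib) (simp add: power2_eq_square)
    have N0: "N > 0"
    proof -
      have "0 < exp (2 * \<tau> * A.X \<epsilon> - 4 * A.H)" by simp
      also have "\<dots> \<le> (A.pY \<tau> \<epsilon>)\<^sup>2" by (rule A.pY_bounds(2)[OF \<tau>(2) eps01])
      also have "\<dots> \<le> 2 * N" using A.y_energy_wave[OF eps01, of \<tau>] zero_le_power2[of "A.nY \<tau> \<epsilon>"]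
        by (simp add: N_def a_def b_def t_def k_def)
      finally show ?thesis by simp
    qed
    \<comment> \<open>The data of \<chi> at \<epsilon> are chosen so that its Wronskian with
      \<open>y\<close> is 1 and its energy is \<open>t\<^sup>2 / N\<close>, inverse to the energy
      \<open>N\<close> of \<open>y\<close>. The unknown size of \<open>y\<close> at \<epsilon> thus
      drops out of every product.\<close>
    define c1 c2 where "c1 = - b / of_real N" and "c2 = (of_real t)\<^sup>2 * a / of_real N"
    define \<chi>A \<chi>A' \<chi>B \<chi>B' where "\<chi>A x = c1 * A.th \<epsilon> k x + c2 * A.ph \<epsilon> k x" and "\<chi>A' x = c1 * A.thd \<epsilon> k x + c2 * A.phd \<epsilon> k x"
      and "\<chi>B x = c1 * B.th \<epsilon> k x + c2 * B.ph \<epsilon> k x" and "\<chi>B' x = c1 * B.thd \<epsilon> k x + c2 * B.phd \<epsilon> k x" for x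
    have sA: "solves \<eta> k \<chi>A \<chi>A'" unfolding \<chi>A_def[abs_def] \<chi>A'_def[abs_def]
      by (rule solves_linear[OF A.basis_props(1)[OF eps01] A.basis_props(4)[OF eps01]])
    have sB: "solves \<mu> k \<chi>B \<chi>B'" unfolding \<chi>B_def[abs_def] \<chi>B'_def[abs_def]
      by (rule solves_linear[OF B.basis_props(1)[OF eps01] B.basis_props(4)[OF eps01]])
    have dA: "\<chi>A \<epsilon> = c1" "\<chi>A' \<epsilon> = c2" and dB: "\<chi>B \<epsilon> = c1" "\<chi>B' \<epsilon> = c2"
      by (simp_all add: \<chi>A_def \<chi>A'_def \<chi>B_def \<chi>B'_def A.basis_props(2,3,5,6)[OF eps01] B.basis_props(2,3,5,6)[OF eps01])
    have E\<chi>: "(norm c2)\<^sup>2 + (t * norm c1)\<^sup>2 = t\<^sup>2 / N"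
    proof -
      have "(norm c2)\<^sup>2 + (t * norm c1)\<^sup>2 = t\<^sup>2 * N / N\<^sup>2"
        using N0 unfolding N_def[symmetric]
        by (simp add: c1_def c2_def norm_mult norm_divide norm_power power_mult_distrib power_divide add_divide_distrib[symmetric])
           (simp add: N_def power_mult_distrib power2_eq_square power4_eq_xxxx algebra_simps)
      then show ?thesis using N0 by (simp add: power2_eq_square)
    qed
    have bA: "(\<tau> * A.gmin * norm (\<chi>A r))\<^sup>2 \<le> t\<^sup>2 / N * exp (4 * A.H + 2 * \<tau> * d)"
      using A.imag_size_le[OF sA[unfolded k_def] _ r01 eps01] \<tau>(1) d dA E\<chi> by (simp add: t_def d_def)
    have bB: "(\<tau> * B.gmin * norm (\<chi>B \<rho>))\<^sup>2 \<le> t\<^sup>2 / N * exp (4 * B.H + 2 * \<tau> * d)"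
    proof -
      have "\<bar>B.X \<rho> - B.X \<epsilon>\<bar> = d" using d by linarith
      then show ?thesis
        using B.imag_size_le[OF sB[unfolded k_def] _ \<rho>01 eps01] \<tau>(1) dB E\<chi> by (simp add: t_def g_agree)
    qed
    have yA: "(\<tau> * A.gmin * norm (A.y k r))\<^sup>2 \<le> 2 * N * exp (4 * A.H - 2 * \<tau> * d)"
      using A.y_decay[OF \<tau>(2) _ r(1,2)] \<tau>(1) eps by (simp add: k_def N_def a_def b_def t_def d_def)
    have yB: "(\<tau> * B.gmin * norm (B.y k \<rho>))\<^sup>2 \<le> 2 * N * exp (4 * B.H - 2 * \<tau> * d)"
      using B.y_decay[OF \<tau>(3) _ \<rho>(1,2)] \<tau>(1) eps ab by (simp add: k_def N_def t_def d(2) g_agree)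
    have prodbound: "norm p * norm q \<le> Q"
      if p: "(\<tau> * g1 * norm p)\<^sup>2 \<le> t\<^sup>2 / N * exp (h1 + 2 * \<tau> * d)" and q: "(\<tau> * g2 * norm q)\<^sup>2 \<le> 2 * N * exp (h2 - 2 * \<tau> * d)"
        and gg: "g1 > 0" "g2 > 0" "g1 * g2 = A.gmin * B.gmin" "h1 + h2 = 4 * A.H + 4 * B.H" for p q :: complex and g1 g2 h1 h2
    proof -
      have "(\<tau> * g1 * norm p)\<^sup>2 * (\<tau> * g2 * norm q)\<^sup>2 \<le> (t\<^sup>2 / N * exp (h1 + 2 * \<tau> * d)) * (2 * N * exp (h2 - 2 * \<tau> * d))"
        using p q N0 by (intro mult_mono) auto
      also have "\<dots> = 2 * t\<^sup>2 * (exp (h1 + 2 * \<tau> * d) * exp (h2 - 2 * \<tau> * d))" using N0 by simp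
      also have "exp (h1 + 2 * \<tau> * d) * exp (h2 - 2 * \<tau> * d) = exp (4 * A.H + 4 * B.H)"
        by (simp add: exp_add[symmetric] gg(4)[symmetric])
      also have "2 * t\<^sup>2 * exp (4 * A.H + 4 * B.H) = \<tau>\<^sup>2 * (Q * (g1 * g2))\<^sup>2"
        unfolding gg(3) Q_def using A.gmin(1) B.gmin(1) by (simp add: t_def power_mult_distrib)
      finally have "\<tau>\<^sup>2 * (\<tau> * (g1 * g2) * (norm p * norm q))\<^sup>2 \<le> \<tau>\<^sup>2 * (Q * (g1 * g2))\<^sup>2"
        by (simp add: power_mult_distrib power2_eq_square mult_ac)
      then have "(\<tau> * (g1 * g2) * (norm p * norm q))\<^sup>2 \<le> (Q * (g1 * g2))\<^sup>2" using \<tau>(1) by simp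
      then have "\<tau> * (g1 * g2) * (norm p * norm q) \<le> Q * (g1 * g2)"
        by (rule power2_le_imp_le) (use gg(1,2) A.gmin(1) B.gmin(1) in \<open>auto simp: Q_def\<close>)
      then have "\<tau> * (norm p * norm q) \<le> Q" using gg(1,2) by (simp add: mult_ac)
      moreover have "1 * (norm p * norm q) \<le> \<tau> * (norm p * norm q)" using \<tau>(1) by (intro mult_right_mono) auto
      ultimately show ?thesis by simp
    qed
    have "norm (\<chi>B \<rho>) * norm (A.y k r) \<le> Q"
      by (rule prodbound[OF bB yA]) (use A.gmin(1) B.gmin(1) in auto)
    moreover have "norm (\<chi>A r) * norm (B.y k \<rho>) \<le> Q"
      by (rule prodbound[OF bA yB]) (use A.gmin(1) B.gmin(1) in auto)
    \<comment> \<open>The passage from \<open>th\<close>, \<open>ph\<close> to \<chi>,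
      \<open>y\<close> is the same in both media because \<open>y\<close> and \<open>yd\<close>
      agree at \<epsilon>. It has determinant 1 by \<open>one\<close>, and an antisymmetric pairing
      is only multiplied by that determinant.\<close>
    moreover have "G k = \<chi>B \<rho> * A.y k r - \<chi>A r * B.y k \<rho>"
    proof -
      have one: "- (c1 * b) + c2 * a = 1"
      proof -
        have "(- (c1 * b) + c2 * a) * of_real N = b * b + (of_real t * a) * (of_real t * a)"
          using N0 by (simp add: c1_def c2_def field_simps power2_eq_square)
        also have "\<dots> = 1 * of_real N" by (simp add: Nab)
        finally show ?thesis using N0 by (metis mult_cancel_right of_real_eq_0_iff less_numeral_extra(3))
      qed
      have "\<chi>B \<rho> * A.y k r - \<chi>A r * B.y k \<rho> = (- (c1 * b) + c2 * a) * G k"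
        unfolding A.y_by_basis[OF eps01 r01] B.y_by_basis[OF eps01 \<rho>01] ab a_def[symmetric] b_def[symmetric] \<chi>A_def \<chi>B_def G_def
        by (simp add: algebra_simps)
      then show ?thesis by (simp only: one mult_1)
    qed
    ultimately show ?thesis
      unfolding k_def[symmetric] using norm_triangle_ineq4[of "\<chi>B \<rho> * A.y k r" "\<chi>A r * B.y k \<rho>"]
      by (simp add: norm_mult)
  qed
  have const: "G k = G 0" for k
  proof (rule even_exp_type_constant[OF holG K evG])
    show "norm (G (of_real x)) \<le> M" if "x \<ge> 1" for x
    proof -
      have "M / x \<le> M / 1" using M0 that by (intro divide_left_mono) auto
      then show ?thesis using reG[of x] that by simp
    qed
    show "\<exists>Ba X. \<forall>x\<ge>X. norm (G (\<i> * of_real x)) \<le> Ba * exp (\<delta> * x)" if "\<delta> > 0" for \<delta>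
    proof (intro exI allI impI)
      fix x assume x: "x \<ge> max T 1"
      have "Q \<ge> 0" using A.gmin(1) B.gmin(1) by (simp add: Q_def)
      then have "2 * Q * 1 \<le> 2 * Q * exp (\<delta> * x)" using that x by (intro mult_left_mono) auto
      then show "norm (G (\<i> * of_real x)) \<le> (2 * Q) * exp (\<delta> * x)" using imG[OF x] by simp
    qed
  qed
  have "norm (G 0) = 0"
  proof (rule le_over_Suc_imp_zero)
    show "norm (G 0) \<le> M / real (Suc n)" for n
      using reG[of "real (Suc n)"] const[of "of_real (real (Suc n))"] by simp
  qed simp
  moreover have "G 0 = of_real (\<rho> - \<epsilon>) - of_real (r - \<epsilon>)"
    unfolding G_def A.basis_at_0[OF eps01 r01] B.basis_at_0[OF eps01 \<rho>01] by simp
  ultimately show ?thesis by (simp flip: of_real_diff)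
qed

text \<open>Every travel time that one medium attains on \<open>[0, \<epsilon>]\<close> is attained
  by the other, and at the same point. Hence the functions \<open>X\<close> coincide there, and so
  do their derivatives \<open>g\<close>.\<close>

lemma media_equal:
  assumes x: "x \<in> {0..1}"
  shows "\<mu> x = \<eta> x"
proof (cases "x \<ge> \<epsilon>")
  case True
  then show ?thesis using agree x by simp
next
  case False
  have eqX: "A.X r = B.X r" if r: "r \<in> {0..\<epsilon>}" for r
  proof -
    have r01: "0 \<le> r" "r \<le> 1" using r eps by auto
    have "B.X 0 \<le> A.X r" using A.X_mono[of 0 r] r01 by (simp add: A.X_0 B.X_0)
    moreover have "A.X r \<le> B.X \<epsilon>" using A.X_mono[of r \<epsilon>] r eps same_travel_time by simp
    ultimately have "\<exists>\<rho>\<ge>0. \<rho> \<le> \<epsilon> \<and> B.X \<rho> = A.X r"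
      using eps by (intro IVT' continuous_on_subset[OF B.cX]) auto
    then obtain \<rho> where \<rho>: "0 \<le> \<rho>" "\<rho> \<le> \<epsilon>" "B.X \<rho> = A.X r" by blast
    have "r \<le> \<epsilon>" using r by simp
    then have "\<rho> = r" by (rule equal_travel_time_imp_equal[OF r01(1) _ \<rho>(1,2) \<rho>(3)[symmetric]])
    then show ?thesis using \<rho>(3) by (simp only:)
  qed
  have x': "x \<in> {0..\<epsilon>}" using False x by auto
  have "(A.X has_vector_derivative A.g x) (at x within {0..\<epsilon>})"
    using A.dX[OF x] eps by (auto simp: has_real_derivative_iff_has_vector_derivative intro: has_vector_derivative_within_subset)
  moreover have "(B.X has_vector_derivative B.g x) (at x within {0..\<epsilon>})"
    using B.dX[OF x] eps by (auto simp: has_real_derivative_iff_has_vector_derivative intro: has_vector_derivative_within_subset)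
  then have "(A.X has_vector_derivative B.g x) (at x within {0..\<epsilon>})"
    using has_vector_derivative_transform[OF x', of A.X B.X] eqX by auto
  ultimately have "A.g x = B.g x"
    using vector_derivative_unique_within_closed_interval[of 0 \<epsilon> x A.X "A.g x" "B.g x"] eps x' by auto
  then show ?thesis using A.g_sq[OF x] B.g_sq[OF x] by simp
qed

end

theorem theorem1p2:
  fixes m :: nat and eta eta' :: "real \<Rightarrow> real" and a \<epsilon> :: real
  assumes "admissible m eta" and "admissible m eta'"
    and "a = integral {0..1} (\<lambda>r. sqrt (eta r))" and "a > 1"
    and "0 < \<epsilon>" and "\<epsilon> < 1"
    and "integral {\<epsilon>..1} (\<lambda>r. sqrt (eta r)) = (a - 1) / 2"
    and "\<forall>r\<in>{\<epsilon>..1}. eta' r = eta r"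
    and "same_zeros_mult (char_fun eta) (char_fun eta')"
  shows "\<forall>r\<in>{0..1}. eta' r = eta r"
proof -
  obtain e1 e2 \<delta> where A: "medium eta e1 e2" "eta 1 = 1" "\<delta> > 0" "\<And>x. x \<in> {1 - \<delta><..<1} \<Longrightarrow> e1 x \<noteq> 0"
    by (rule admissible_medium[OF assms(1)]) blast
  obtain f1 f2 \<delta>' where B: "medium eta' f1 f2" "eta' 1 = 1" "\<delta>' > 0" "\<And>x. x \<in> {1 - \<delta>'<..<1} \<Longrightarrow> f1 x \<noteq> 0"
    by (rule admissible_medium[OF assms(2)]) blast
  interpret A: medium eta e1 e2 by fact
  interpret B: medium eta' f1 f2 by fact
  obtain z0 where z0: "char_fun eta' z0 \<noteq> 0" using B.char_fun_not_zero[OF B(3,4,2)] by blast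
  obtain c where c: "c \<noteq> 0" "\<And>z. char_fun eta z = c * char_fun eta' z"
    by (rule same_zeros_proportional[OF char_fun_entire[OF A.c0] char_fun_entire[OF B.c0] assms(9) z0]) blast
  have X1: "A.X 1 = a" using assms(3) by (simp add: A.X_def A.g_def[abs_def])
  have Xe: "A.X 1 - A.X \<epsilon> = (A.X 1 - 1) / 2"
    using A.X_diff[of \<epsilon> 1] assms(5-7) unfolding X1 by (simp add: A.g_def[abs_def])
  interpret media_pair eta e1 e2 eta' f1 f2 \<epsilon> \<delta> c
    by unfold_locales (use assms A c X1 Xe in auto)
  show ?thesis using media_equal by blast
qed

end
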